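(* For $|q|<1$, $$\frac{J_3^2}{J_6}\mathscr{F}_{12,-1}(q)=\sum_{k=-\infty}^{\infty}\frac{(-1)^{k-1}(6k-1)q^{3k^2}}{1+q^{6k-1}}+\frac{2qJ_{12}J_6J_2^5}{J_4J_1^2}.$$
   Context: $J_k:=(q^k;q^k)_\infty=\prod_{m\ge1}(1-q^{km})$. For a nonnegative integer $N$, the Hurwitz class number $H(N)$ is: $0$ if $N\equiv1,2\pmod 4$; $-1/12$ if $N=0$; and for $N>0$, $N\equiv 0,3\pmod 4$, the number of classes of positive definite binary quadratic forms of discriminant $-N$, with classes containing a multiple of $x^2+y^2$ (resp. $x^2+xy+y^2$) weighted $1/2$ (resp. $1/3$). For positive $m\equiv3\pmod4$, $F(m)=H(m)$ if $m\equiv 7\pmod 8$, $F(m)=3H(m)$ if $m\equiv3\pmod8$; $F(m)=0$ for $m<0$. $\mathscr{F}_{12,-1}(q)=\sum_{n\ge0}F(12n-1)q^n$. *)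

theory Defs
  imports "HOL-Analysis.Analysis"
begin

definition J :: "nat \<Rightarrow> complex \<Rightarrow> complex" where
  "J k q = (\<Prod>m. 1 - q ^ (k * Suc m))"

text \<open>The triple \<open>(a, b, c)\<close> stands for the integral binary quadratic form
  \<open>a x^2 + b x y + c y^2\<close>; forms are not required to be primitive.\<close>

type_synonym bqf = "int \<times> int \<times> int"

fun bqf_eval :: "bqf \<Rightarrow> int \<Rightarrow> int \<Rightarrow> int" where
  "bqf_eval (a, b, c) x y = a * x^2 + b * x * y + c * y^2"

fun bqf_disc :: "bqf \<Rightarrow> int" where
  "bqf_disc (a, b, c) = b^2 - 4 * a * c"

definition bqf_pos_def :: "bqf \<Rightarrow> bool" where
  "bqf_pos_def f \<longleftrightarrow> (\<forall>x y. (x, y) \<noteq> (0, 0) \<longrightarrow> bqf_eval f x y > 0)"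

definition pos_forms :: "nat \<Rightarrow> bqf set" where
  "pos_forms N = {f. bqf_pos_def f \<and> bqf_disc f = - int N}"

text \<open>Proper equivalence, that is, equivalence under the action of \<open>SL\<^sub>2(\<int>)\<close>.\<close>

definition bqf_equiv :: "bqf \<Rightarrow> bqf \<Rightarrow> bool" where
  "bqf_equiv f g \<longleftrightarrow>
     (\<exists>p r s t :: int. p * t - r * s = 1 \<and>
        (\<forall>x y. bqf_eval g x y = bqf_eval f (p * x + r * y) (s * x + t * y)))"

definition form_classes :: "nat \<Rightarrow> bqf set set" where
  "form_classes N =
     pos_forms N // {(f, g). f \<in> pos_forms N \<and> g \<in> pos_forms N \<and> bqf_equiv f g}"

definition class_weight :: "bqf set \<Rightarrow> real" where
  "class_weight C =
     (if \<exists>m. (m, 0, m) \<in> C then 1 / 2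
      else if \<exists>m. (m, m, m) \<in> C then 1 / 3
      else 1)"

definition hurwitz :: "nat \<Rightarrow> real" where
  "hurwitz N =
     (if N mod 4 = 1 \<or> N mod 4 = 2 then 0
      else if N = 0 then - 1 / 12
      else (\<Sum>C\<in>form_classes N. class_weight C))"

text \<open>Only negative \<open>m\<close> and positive \<open>m \<equiv> 3 (mod 4)\<close> are meaningful;
  the value \<open>0\<close> at the remaining arguments is a dummy.\<close>

definition F :: "int \<Rightarrow> real" where
  "F m =
     (if m < 0 then 0
      else if m mod 8 = 7 then hurwitz (nat m)
      else if m mod 8 = 3 then 3 * hurwitz (nat m)
      else 0)"

definition F_12_m1 :: "complex \<Rightarrow> complex" where
  "F_12_m1 q = (\<Sum>n. of_real (F (12 * int n - 1)) * q ^ n)"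

text \<open>For \<open>k \<le> 0\<close> the exponent \<open>6 k - 1\<close> is negative, so the summand has a removable
  singularity at \<open>q = 0\<close> (for instance \<open>k = 0\<close> gives \<open>q / (1 + q)\<close>). Since
  \<open>0 powi (6 k - 1) = 0\<close> in HOL, the value at \<open>q = 0\<close> is defined as the limit.\<close>

definition bilateral_expr :: "int \<Rightarrow> complex \<Rightarrow> complex" where
  "bilateral_expr k q =
     (-1) powi (k - 1) * of_int (6 * k - 1) * q powi (3 * k^2) / (1 + q powi (6 * k - 1))"

definition bilateral_term :: "int \<Rightarrow> complex \<Rightarrow> complex" where
  "bilateral_term k q =
     (if q = 0 then Lim (at 0) (bilateral_expr k) else bilateral_expr k q)"

end

theory Submission
  imports Defs
begin

text \<open>
  Voronoi-reducing a form of discriminant \<open>-M\<close>, \<open>M \<equiv> 3 (mod 4)\<close>, to a strictly obtuse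
  superbase turns \<open>3 H(M)\<close> into the number of triples of positive odd \<open>P, Q, R\<close> with
  \<open>PQ + QR + RP = M\<close>, and \<open>F(M)\<close> into the number of those with \<open>P \<equiv> Q (mod 4)\<close>. Hence
  \<open>G(q) = \<Sum> F(4N - 1) q^N\<close> is a sum over a cone. Summing it along the rays \<open>R = const\<close> and
  convolving with \<open>\<theta>(Y) = \<Sum> (-1)^n q^(n^2) Y^n\<close> makes everything telescope and gives Kronecker's relation
  \<open>\<theta>(1) G = - A'(1)\<close> with \<open>A(Y) = \<Sum> (-1)^n q^(n^2) Y^n / (1 + q^(2n-1))\<close>.

  To extract the exponents divisible by 3, \<open>\<theta>\<close> is replaced by its multiple-of-3 part
  \<open>\<theta>\<^sub>9(Y) = \<Sum> (-1)^k q^(9k^2) Y^(3k)\<close>. If \<open>C\<close> is the analogue of \<open>A\<close> for \<open>\<theta>\<^sub>9\<close>, the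
  coefficients of \<open>\<theta>\<^sub>9 A - \<theta> C\<close> satisfy a three-step recursion and are antisymmetric, so they are
  determined up to a scalar, and the difference is a multiple of a product of two theta functions.
  The scalar is read off at \<open>Y = q\<close>, where \<open>\<theta>\<close> vanishes. This gives
  \<open>\<theta>\<^sub>9(1) G = - C'(1) + q J\<^sub>6 \<phi>(q^3) \<Sum> q^n / (1 + q^(6n+3))\<close>, in which every term splits
  trivially by residues modulo 3; Kronecker's identity evaluates the remaining Lambert series.
\<close>

text \<open>Kronecker's relation cannot be dissected as it stands, because its multiplier, the sum
  of (-1)^n q^(n^2), mixes exponents modulo 3. The sum of (-1)^k q^(9k^2) does not: with x = q^3 it
  is J_3(x)^2 / J_6(x), the left factor of the theorem. Changing the multiplier costs an error term,
  of which only the derivative at Y = 1 is needed. The recursion of its coefficients, h(n+3) =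
  q^(6n+6) h(n), leaves h(0), h(1), h(2) free; h(1-n) = -h(n) gives h(0) = -h(1) and h(2) = 0, so a
  line remains. Evaluating at Y = q removes the unknown C together with theta, and turns A into the
  one Appell sum with a known product. The error is then an infinite product with no visible
  dissection. Kronecker's identity, read backwards, rewrites it as the old multiplier times a
  Lambert series, and the old multiplier cancels. With n = 3k - j the denominators 1 + q^(6n+3)
  depend on x only, while q^n carries the residue; after the prefactor q just j = 1 survives the
  average over the cube roots of x.\<close>

no_notation Infinite_Set_Sum.abs_summable_on (infix \<open>abs'_summable'_on\<close> 50)
notation Infinite_Sum.abs_summable_on (infixr \<open>abs'_summable'_on\<close> 46)

subsection \<open>Sums over the integers\<close>

lemma infsum_int_shift:
  fixes f :: "int \<Rightarrow> 'a::{comm_monoid_add,t2_space}"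
  shows "(\<Sum>\<^sub>\<infinity>i. f (i + k)) = (\<Sum>\<^sub>\<infinity>i. f i)"
  by (rule infsum_reindex_bij_witness[of _ "\<lambda>i. i - k" "\<lambda>i. i + k"]) auto

lemma infsum_int_reflect:
  fixes f :: "int \<Rightarrow> 'a::{comm_monoid_add,t2_space}"
  shows "(\<Sum>\<^sub>\<infinity>i. f (k - i)) = (\<Sum>\<^sub>\<infinity>i. f i)"
  by (rule infsum_reindex_bij_witness[of _ "\<lambda>i. k - i" "\<lambda>i. k - i"]) auto

lemma summable_on_int_shift:
  fixes f :: "int \<Rightarrow> 'a::{comm_monoid_add,topological_space}"
  shows "(\<lambda>i. f (i + k)) summable_on UNIV \<longleftrightarrow> f summable_on UNIV"
  by (rule summable_on_reindex_bij_witness[of _ "\<lambda>i. i - k" "\<lambda>i. i + k"]) auto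

lemma infsum_diff:
  fixes f g :: "'a \<Rightarrow> complex"
  assumes "f summable_on A" "g summable_on A"
  shows "(\<Sum>\<^sub>\<infinity>x\<in>A. f x - g x) = infsum f A - infsum g A"
  using infsum_add[OF assms(1), of "\<lambda>x. - g x"] assms(2)
  by (simp add: infsum_uminus summable_on_uminus)

lemma summable_on_diff:
  fixes f g :: "'a \<Rightarrow> complex"
  assumes "f summable_on A" "g summable_on A"
  shows "(\<lambda>x. f x - g x) summable_on A"
  using summable_on_add[OF assms(1), of "\<lambda>x. - g x"] assms(2) by (simp add: summable_on_uminus)

section \<open>Convolution of two-sided coefficient sequences\<close>

definition conv :: "(int \<Rightarrow> complex) \<Rightarrow> (int \<Rightarrow> complex) \<Rightarrow> int \<Rightarrow> complex" where
  "conv f g n = (\<Sum>\<^sub>\<infinity>i. f i * g (n - i))"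

lemma conv_commute: "conv f g n = conv g f n"
  unfolding conv_def
  by (subst infsum_int_reflect[of "\<lambda>i. f i * g (n - i)" n, symmetric]) (simp add: mult.commute)

lemma abs_summable_prod2:
  fixes f :: "'a \<Rightarrow> complex" and g :: "'b \<Rightarrow> complex"
  assumes "f abs_summable_on A" "g abs_summable_on B"
  shows "(\<lambda>(i, j). f i * g j) abs_summable_on (A \<times> B)"
proof (rule iffD2[OF Infinite_Sum.abs_summable_on_Sigma_iff], intro conjI ballI)
  fix x
  show "(\<lambda>y. case (x, y) of (i, j) \<Rightarrow> f i * g j) abs_summable_on B"
    using summable_on_cmult_right[OF assms(2), of "norm (f x)"] by (simp add: norm_mult)
next
  have "(\<lambda>x. norm (f x) * (\<Sum>\<^sub>\<infinity>y\<in>B. norm (g y))) summable_on A"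
    by (rule summable_on_cmult_left[OF assms(1)])
  then show "(\<lambda>x. \<Sum>\<^sub>\<infinity>y\<in>B. norm (case (x, y) of (i, j) \<Rightarrow> f i * g j)) abs_summable_on A"
    by (simp add: norm_mult infsum_cmult_right' infsum_nonneg abs_mult)
qed

text \<open>The substitution n = i + j turns the absolutely convergent product of two series into a
  double series over n and i; the interchanges of summation for \<open>conv\<close> rest on
  this.\<close>

lemma conv_pair_abs_summable:
  fixes f g :: "int \<Rightarrow> complex"
  assumes "f abs_summable_on UNIV" "g abs_summable_on UNIV"
  shows "(\<lambda>(n::int, i::int). f i * g (n - i)) abs_summable_on (UNIV \<times> UNIV)"
proof -
  have "(\<lambda>(i, j). f i * g j) abs_summable_on (UNIV \<times> UNIV)"
    by (rule abs_summable_prod2[OF assms])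
  also have "?this \<longleftrightarrow> ?thesis"
    by (rule summable_on_reindex_bij_witness[of _ "\<lambda>(n, i). (i, n - i)" "\<lambda>(i, j). (i + j, i)"]) auto
  finally show ?thesis .
qed

lemma conv_summable:
  fixes f g :: "int \<Rightarrow> complex"
  assumes "f abs_summable_on UNIV" "g abs_summable_on UNIV"
  shows "(\<lambda>i. f i * g (n - i)) summable_on UNIV"
proof -
  have "(\<lambda>(n::int, i::int). f i * g (n - i)) summable_on (UNIV \<times> UNIV)"
    using conv_pair_abs_summable[OF assms] abs_summable_summable by blast
  from summable_on_SigmaD1[OF this, of n] show ?thesis by simp
qed

lemma conv_abs_summable:
  fixes f g :: "int \<Rightarrow> complex"
  assumes "f abs_summable_on UNIV" "g abs_summable_on UNIV"
  shows "conv f g abs_summable_on UNIV"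
proof -
  have *: "(\<lambda>(n::int, i::int). norm (f i * g (n - i))) summable_on (UNIV \<times> UNIV)"
    using conv_pair_abs_summable[OF assms] by (simp add: case_prod_unfold)
  have "(\<lambda>n. \<Sum>\<^sub>\<infinity>i. norm (f i * g (n - i))) summable_on UNIV"
    using summable_on_Sigma_banach[OF *] by simp
  moreover have "norm (conv f g n) \<le> (\<Sum>\<^sub>\<infinity>i. norm (f i * g (n - i)))" for n
    unfolding conv_def
    by (rule norm_infsum_bound) (use summable_on_SigmaD1[OF *, of n] in simp)
  ultimately show ?thesis
    by (rule summable_on_comparison_test) auto
qed

lemma infsum_conv:
  fixes f g :: "int \<Rightarrow> complex"
  assumes "f abs_summable_on UNIV" "g abs_summable_on UNIV"
  shows "infsum (conv f g) UNIV = infsum f UNIV * infsum g UNIV"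
proof -
  have *: "(\<lambda>(n::int, i::int). f i * g (n - i)) summable_on (UNIV \<times> UNIV)"
    using conv_pair_abs_summable[OF assms] abs_summable_summable by blast
  have "infsum (conv f g) UNIV = (\<Sum>\<^sub>\<infinity>n. \<Sum>\<^sub>\<infinity>i. f i * g (n - i))"
    by (simp add: conv_def[abs_def])
  also have "\<dots> = (\<Sum>\<^sub>\<infinity>i. \<Sum>\<^sub>\<infinity>n. f i * g (n - i))"
    using infsum_swap_banach[OF *] by simp
  also have "\<dots> = (\<Sum>\<^sub>\<infinity>i. f i * infsum g UNIV)"
    by (subst infsum_cmult_right')
      (use infsum_int_shift[of g "- i" for i] in simp)
  also have "\<dots> = infsum f UNIV * infsum g UNIV"
    by (simp add: infsum_cmult_left')
  finally show ?thesis .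
qed

text \<open>Since z^n = z^i z^(n-i), weighting by powers of z commutes with \<open>conv\<close>.
  Together with \<open>infsum_conv\<close> this makes \<open>conv\<close> the multiplication of
  Laurent series evaluated at Y = z.\<close>

lemma conv_powi:
  assumes "z \<noteq> 0"
  shows "conv (\<lambda>n. f n * z powi n) (\<lambda>n. g n * z powi n) n = conv f g n * z powi n"
proof -
  have "(\<lambda>i. f i * z powi i * (g (n - i) * z powi (n - i))) = (\<lambda>i. f i * g (n - i) * z powi n)"
    using assms by (auto simp: fun_eq_iff power_int_diff)
  then show ?thesis
    by (simp add: conv_def infsum_cmult_left')
qed

lemma infsum_conv_powi:
  assumes "z \<noteq> 0" "(\<lambda>n. f n * z powi n) abs_summable_on UNIV" "(\<lambda>n. g n * z powi n) abs_summable_on UNIV"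
  shows "(\<Sum>\<^sub>\<infinity>n. conv f g n * z powi n) = (\<Sum>\<^sub>\<infinity>n. f n * z powi n) * (\<Sum>\<^sub>\<infinity>n. g n * z powi n)"
  using infsum_conv[OF assms(2,3)] conv_powi[OF assms(1), of f g, abs_def] by (simp add: fun_eq_iff)

text \<open>From n = i + (n - i): the Leibniz rule for Y d/dY, read on coefficients.\<close>

lemma conv_weight:
  assumes "f abs_summable_on UNIV" "g abs_summable_on UNIV"
    and "(\<lambda>n. of_int n * f n) abs_summable_on UNIV" "(\<lambda>n. of_int n * g n) abs_summable_on UNIV"
  shows "of_int n * conv f g n = conv (\<lambda>n. of_int n * f n) g n + conv f (\<lambda>n. of_int n * g n) n"
proof -
  have "conv (\<lambda>n. of_int n * f n) g n + conv f (\<lambda>n. of_int n * g n) n =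
     (\<Sum>\<^sub>\<infinity>i. of_int i * f i * g (n - i) + f i * (of_int (n - i) * g (n - i)))"
    unfolding conv_def
    by (rule infsum_add[symmetric]; rule conv_summable; fact assms)
  also have "\<dots> = (\<Sum>\<^sub>\<infinity>i. of_int n * (f i * g (n - i)))"
    by (simp add: algebra_simps)
  finally show ?thesis by (simp add: conv_def infsum_cmult_right')
qed

lemma infsum_conv_weight:
  assumes "f abs_summable_on UNIV" "g abs_summable_on UNIV"
    and "(\<lambda>n. of_int n * f n) abs_summable_on UNIV" "(\<lambda>n. of_int n * g n) abs_summable_on UNIV"
  shows "(\<Sum>\<^sub>\<infinity>n. of_int n * conv f g n) =
    (\<Sum>\<^sub>\<infinity>n. of_int n * f n) * infsum g UNIV + infsum f UNIV * (\<Sum>\<^sub>\<infinity>n. of_int n * g n)"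
proof -
  have "(\<Sum>\<^sub>\<infinity>n. of_int n * conv f g n) =
     (\<Sum>\<^sub>\<infinity>n. conv (\<lambda>n. of_int n * f n) g n + conv f (\<lambda>n. of_int n * g n) n)"
    by (rule infsum_cong, rule conv_weight[OF assms])
  also have "\<dots> = infsum (conv (\<lambda>n. of_int n * f n) g) UNIV + infsum (conv f (\<lambda>n. of_int n * g n)) UNIV"
    by (rule infsum_add; rule abs_summable_summable; rule conv_abs_summable; fact assms)
  finally show ?thesis using assms by (simp add: infsum_conv)
qed

text \<open>The factor r^(s^2) beats every exponential z^|s|, so this class is closed under
  multiplication by b^s, by s and by bounded factors. Theta and Appell type series therefore
  converge absolutely at every nonzero argument, with no case distinction.\<close>

definition gauss_bounded :: "(int \<Rightarrow> complex) \<Rightarrow> bool" where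
  "gauss_bounded f \<longleftrightarrow> (\<exists>r z C. 0 \<le> r \<and> r < 1 \<and> 0 \<le> z \<and> 0 \<le> C \<and>
     (\<forall>s. norm (f s) \<le> C * r ^ nat (s\<^sup>2) * z ^ nat \<bar>s\<bar>))"

lemma summable_gauss:
  fixes r z :: real
  assumes "0 \<le> r" "r < 1" "0 \<le> z"
  shows "summable (\<lambda>n. r ^ n\<^sup>2 * z ^ n)"
proof -
  have "(\<lambda>n. r ^ n * z) \<longlonglongrightarrow> 0 * z"
    by (intro tendsto_intros LIMSEQ_power_zero) (use assms in auto)
  then have "eventually (\<lambda>n. r ^ n * z < 1 / 2) sequentially"
    by (intro order_tendstoD(2)[of _ 0]) auto
  then have "eventually (\<lambda>n. norm (r ^ n\<^sup>2 * z ^ n) \<le> (1 / 2) ^ n) sequentially"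
  proof eventually_elim
    case (elim n)
    have "r ^ n\<^sup>2 * z ^ n = (r ^ n * z) ^ n"
      by (simp add: power_mult_distrib power_mult power2_eq_square)
    also have "\<dots> \<le> (1 / 2) ^ n"
      using elim assms by (intro power_mono) auto
    finally show ?case using assms by simp
  qed
  then show ?thesis
    by (rule summable_comparison_test_ev) (simp add: summable_geometric)
qed

lemma abs_summable_on_intI:
  fixes f :: "int \<Rightarrow> complex"
  assumes "summable (\<lambda>n::nat. norm (f (int n)))" "summable (\<lambda>n::nat. norm (f (- int n)))"
  shows "f abs_summable_on UNIV"
proof -
  have U: "(UNIV::int set) = {0..} \<union> {..0}" by auto
  have 1: "f abs_summable_on {0..}"
  proof -
    have "(\<lambda>n. norm (f (int n))) summable_on UNIV"
      using assms(1) by (intro norm_summable_imp_summable_on) simp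
    also have "?this \<longleftrightarrow> ?thesis"
      by (rule summable_on_reindex_bij_witness[of _ nat int]) auto
    finally show ?thesis .
  qed
  have 2: "f abs_summable_on {..0}"
  proof -
    have "(\<lambda>n. norm (f (- int n))) summable_on UNIV"
      using assms(2) by (intro norm_summable_imp_summable_on) simp
    also have "?this \<longleftrightarrow> ?thesis"
      by (rule summable_on_reindex_bij_witness[of _ "\<lambda>i. nat (- i)" "\<lambda>n. - int n"]) auto
    finally show ?thesis .
  qed
  show ?thesis unfolding U using 1 2 by (rule summable_on_union)
qed

lemma gauss_bounded_abs_summable:
  assumes "gauss_bounded f"
  shows "f abs_summable_on UNIV"
proof -
  obtain r z C where *: "0 \<le> r" "r < 1" "0 \<le> z"
    "\<And>s. norm (f s) \<le> C * r ^ nat (s\<^sup>2) * z ^ nat \<bar>s\<bar>"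
    using assms unfolding gauss_bounded_def by auto
  have sm: "summable (\<lambda>n. C * (r ^ n\<^sup>2 * z ^ n))"
    by (intro summable_mult summable_gauss * )
  have "norm (f (int n)) \<le> C * (r ^ n\<^sup>2 * z ^ n)" "norm (f (- int n)) \<le> C * (r ^ n\<^sup>2 * z ^ n)" for n
    using *(4)[of "int n"] *(4)[of "- int n"] by (simp_all add: nat_power_eq mult.assoc)
  then show ?thesis
    by (intro abs_summable_on_intI summable_comparison_test'[OF sm]) auto
qed

lemma gauss_bounded_summable: "gauss_bounded f \<Longrightarrow> f summable_on UNIV"
  using gauss_bounded_abs_summable by (rule abs_summable_summable)

lemma gauss_bounded_mult_bounded:
  assumes "gauss_bounded f" "\<And>s. norm (g s) \<le> K"
  shows "gauss_bounded (\<lambda>s. g s * f s)"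
proof -
  obtain r z C where *: "0 \<le> r" "r < 1" "0 \<le> z" "0 \<le> C"
    "\<And>s. norm (f s) \<le> C * r ^ nat (s\<^sup>2) * z ^ nat \<bar>s\<bar>"
    using assms unfolding gauss_bounded_def by auto
  have K: "0 \<le> K" using assms(2)[of 0] norm_ge_zero order_trans by blast
  have "norm (g s * f s) \<le> K * (C * r ^ nat (s\<^sup>2) * z ^ nat \<bar>s\<bar>)" for s
    unfolding norm_mult by (intro mult_mono assms * K) auto
  then have "norm (g s * f s) \<le> (K * C) * r ^ nat (s\<^sup>2) * z ^ nat \<bar>s\<bar>" for s
    by (simp add: mult_ac)
  then show ?thesis unfolding gauss_bounded_def using * K
    by (intro exI[of _ r] exI[of _ z] exI[of _ "K * C"]) auto
qed

lemma gauss_bounded_mult_powi: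
  assumes "gauss_bounded f" "b \<noteq> 0"
  shows "gauss_bounded (\<lambda>s. f s * b powi s)"
proof -
  obtain r z C where *: "0 \<le> r" "r < 1" "0 \<le> z" "0 \<le> C"
    "\<And>s. norm (f s) \<le> C * r ^ nat (s\<^sup>2) * z ^ nat \<bar>s\<bar>"
    using assms unfolding gauss_bounded_def by auto
  define m where "m = max (norm b) (inverse (norm b))"
  have m: "0 \<le> m" unfolding m_def by (simp add: le_max_iff_disj)
  have bd: "norm (b powi s) \<le> m ^ nat \<bar>s\<bar>" for s
  proof (cases "s \<ge> 0")
    case True
    then show ?thesis unfolding m_def
      by (auto simp: power_int_def norm_power intro!: power_mono)
  next
    case False
    then show ?thesis unfolding m_def
      by (auto simp: power_int_def norm_power norm_inverse intro!: power_mono)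
  qed
  have "norm (f s * b powi s) \<le> (C * r ^ nat (s\<^sup>2) * z ^ nat \<bar>s\<bar>) * m ^ nat \<bar>s\<bar>" for s
    unfolding norm_mult by (intro mult_mono bd *) (use * in auto)
  then have "norm (f s * b powi s) \<le> C * r ^ nat (s\<^sup>2) * (z * m) ^ nat \<bar>s\<bar>" for s
    by (simp add: mult_ac power_mult_distrib)
  then show ?thesis unfolding gauss_bounded_def using * m
    by (intro exI[of _ r] exI[of _ "z * m"] exI[of _ C]) auto
qed

lemma gauss_bounded_mult_of_int:
  assumes "gauss_bounded f"
  shows "gauss_bounded (\<lambda>s. of_int s * f s)"
proof -
  obtain r z C where *: "0 \<le> r" "r < 1" "0 \<le> z" "0 \<le> C"
    "\<And>s. norm (f s) \<le> C * r ^ nat (s\<^sup>2) * z ^ nat \<bar>s\<bar>"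
    using assms unfolding gauss_bounded_def by auto
  have bd: "norm (of_int s :: complex) \<le> 2 ^ nat \<bar>s\<bar>" for s
  proof -
    have "real (nat \<bar>s\<bar>) \<le> 2 ^ nat \<bar>s\<bar>"
      using less_exp[of "nat \<bar>s\<bar>"] by (metis less_imp_le of_nat_le_iff of_nat_numeral of_nat_power)
    then show ?thesis by simp
  qed
  have "norm (of_int s * f s) \<le> 2 ^ nat \<bar>s\<bar> * (C * r ^ nat (s\<^sup>2) * z ^ nat \<bar>s\<bar>)" for s
    unfolding norm_mult by (intro mult_mono bd *) auto
  then have "norm (of_int s * f s) \<le> C * r ^ nat (s\<^sup>2) * (2 * z) ^ nat \<bar>s\<bar>" for s
    by (simp add: mult_ac power_mult_distrib)
  then show ?thesis unfolding gauss_bounded_def using *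
    by (intro exI[of _ r] exI[of _ "2 * z"] exI[of _ C]) auto
qed

lemma gauss_bounded_powi_square:
  assumes "norm q < 1"
  shows "gauss_bounded (\<lambda>n. (-1) powi n * q powi (n\<^sup>2))"
proof -
  have "norm ((-1) powi s * q powi (s\<^sup>2)) \<le> 1 * norm q ^ nat (s\<^sup>2) * 1 ^ nat \<bar>s\<bar>" for s
    by (simp add: norm_mult norm_power_int power_int_def norm_power)
  then show ?thesis unfolding gauss_bounded_def using assms
    by (intro exI[of _ "norm q"] exI[of _ 1] exI[of _ 1]) auto
qed

text \<open>The exponent is (s^2 - s)/2. With r the square root of |q|, the quadratic part is
  r^(s^2), and the linear part r^(-s) is absorbed by the exponential allowance 1/r.\<close>

lemma gauss_bounded_powi_triangular:
  assumes "norm q < 1" "q \<noteq> 0"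
  shows "gauss_bounded (\<lambda>n. (-1) powi n * q powi (n * (n - 1) div 2))"
proof -
  define r where "r = sqrt (norm q)"
  have r: "0 < r" "r < 1" "norm q = r\<^sup>2" using assms by (auto simp: r_def)
  have "norm ((-1) powi s * q powi (s * (s - 1) div 2)) \<le> 1 * r ^ nat (s\<^sup>2) * (1 / r) ^ nat \<bar>s\<bar>" for s
  proof -
    have e: "2 * (s * (s - 1) div 2) = s\<^sup>2 - s"
      by (simp add: power2_eq_square algebra_simps)
    have "norm ((-1) powi s * q powi (s * (s - 1) div 2)) = (r powi 2) powi (s * (s - 1) div 2)"
      by (simp add: norm_mult norm_power_int r)
    also have "\<dots> = r powi (s\<^sup>2 - s)"
      by (simp only: power_int_mult[symmetric] e)
    also have "\<dots> = r powi (s\<^sup>2) * r powi (- s)"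
      using r by (simp add: power_int_diff power_int_minus divide_inverse)
    finally have eq: "norm ((-1) powi s * q powi (s * (s - 1) div 2)) = r powi (s\<^sup>2) * r powi (- s)" .
    have "r powi (- s) \<le> (1 / r) ^ nat \<bar>s\<bar>"
    proof (cases "s \<ge> 0")
      case True then show ?thesis by (simp add: power_int_def divide_inverse)
    next
      case False
      have "r powi (- s) \<le> 1"
        using False r by (auto simp: power_int_def power_le_one)
      also have "1 \<le> (1 / r) ^ nat \<bar>s\<bar>"
        using r by (intro one_le_power) auto
      finally show ?thesis .
    qed
    then have "r powi (s\<^sup>2) * r powi (- s) \<le> r powi (s\<^sup>2) * (1 / r) ^ nat \<bar>s\<bar>"
      using r by (intro mult_left_mono) auto
    moreover have "r powi (s\<^sup>2) = r ^ nat (s\<^sup>2)" by (simp add: power_int_def)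
    ultimately show ?thesis unfolding eq by simp
  qed
  then show ?thesis unfolding gauss_bounded_def using r
    by (intro exI[of _ r] exI[of _ "1 / r"] exI[of _ 1]) auto
qed

subsection \<open>The Jacobi triple product\<close>

definition qprod :: "complex \<Rightarrow> complex \<Rightarrow> complex" where
  "qprod a q = (\<Prod>n. 1 - a * q ^ n)"

lemma convergent_prod_qprod:
  fixes a q :: complex
  assumes "norm q < 1"
  shows "convergent_prod (\<lambda>n. 1 - a * q ^ n)"
proof -
  have "summable (\<lambda>n. norm (1 - a * q ^ n - 1))"
    using assms by (auto simp: norm_mult norm_power intro!: summable_mult summable_geometric)
  then show ?thesis
    by (intro abs_convergent_prod_imp_convergent_prod summable_imp_abs_convergent_prod)
qed

lemma qprod_LIMSEQ:
  assumes "norm q < 1"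
  shows "(\<lambda>n. \<Prod>i<n. 1 - a * q ^ i) \<longlonglongrightarrow> qprod a q"
  unfolding qprod_def
  by (rule has_prod_imp_tendsto') (use convergent_prod_qprod[OF assms] in blast)

lemma qprod_nonzero:
  assumes "norm q < 1" "\<And>n. a * q ^ n \<noteq> 1"
  shows "qprod a q \<noteq> 0"
  unfolding qprod_def
  by (rule prodinf_nonzero[OF convergent_prod_qprod[OF assms(1)]]) (use assms(2) in auto)

lemma qprod_nonzero_norm:
  assumes "norm q < 1" "norm a < 1"
  shows "qprod a q \<noteq> 0"
proof (rule qprod_nonzero[OF assms(1)])
  fix n
  have "norm (a * q ^ n) = norm a * norm q ^ n" by (simp add: norm_mult norm_power)
  also have "\<dots> \<le> norm a * 1"
    using assms by (intro mult_left_mono power_le_one) auto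
  finally have "norm (a * q ^ n) < 1" using assms by simp
  then show "a * q ^ n \<noteq> 1" by auto
qed

text \<open>Factors are sorted by the residue of their index modulo k. On partial products of length
  n k this is exact, and both arrangements converge.\<close>

lemma qprod_split:
  assumes "norm q < 1" "0 < k"
  shows "qprod a q = (\<Prod>i<k. qprod (a * q ^ i) (q ^ k))"
proof -
  have q: "norm (q ^ k) < 1"
    using assms by (simp add: norm_power power_less_one_iff)
  have "(\<lambda>n. \<Prod>i<k. \<Prod>m<n. 1 - (a * q ^ i) * (q ^ k) ^ m) \<longlonglongrightarrow> (\<Prod>i<k. qprod (a * q ^ i) (q ^ k))"
    by (intro tendsto_prod qprod_LIMSEQ q)
  moreover have "(\<Prod>i<k. \<Prod>m<n. 1 - (a * q ^ i) * (q ^ k) ^ m) = (\<Prod>i<n * k. 1 - a * q ^ i)" for n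
  proof -
    have "(\<Prod>i<n * k. 1 - a * q ^ i) = (\<Prod>m<n. \<Prod>i\<in>{m * k..<m * k + k}. 1 - a * q ^ i)"
      by (rule prod.nat_group[symmetric])
    also have "\<dots> = (\<Prod>m<n. \<Prod>i<k. 1 - a * q ^ (m * k + i))"
    proof (rule prod.cong[OF refl])
      fix m
      show "(\<Prod>i\<in>{m * k..<m * k + k}. 1 - a * q ^ i) = (\<Prod>i<k. 1 - a * q ^ (m * k + i))"
        by (rule prod.reindex_bij_witness[of _ "\<lambda>i. m * k + i" "\<lambda>i. i - m * k"]) auto
    qed
    also have "\<dots> = (\<Prod>i<k. \<Prod>m<n. 1 - a * q ^ (m * k + i))"
      by (rule prod.swap)
    also have "\<dots> = (\<Prod>i<k. \<Prod>m<n. 1 - (a * q ^ i) * (q ^ k) ^ m)"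
      by (simp add: power_add power_mult[symmetric] mult_ac)
    finally show ?thesis by simp
  qed
  moreover have "(\<lambda>n. \<Prod>i<n * k. 1 - a * q ^ i) \<longlonglongrightarrow> qprod a q"
  proof -
    have "filterlim (\<lambda>n. n * k) at_top sequentially"
      using assms(2) by (simp add: filterlim_subseq strict_mono_def)
    from filterlim_compose[OF qprod_LIMSEQ[OF assms(1)] this] show ?thesis by simp
  qed
  ultimately show ?thesis
    using LIMSEQ_unique by simp
qed

lemma qprod_head:
  assumes "norm q < 1"
  shows "qprod a q = (1 - a) * qprod (a * q) q"
proof -
  have "(\<lambda>n. \<Prod>i<Suc n. 1 - a * q ^ i) \<longlonglongrightarrow> qprod a q"
    using qprod_LIMSEQ[OF assms, of a] by (subst filterlim_sequentially_Suc)
  moreover have "(\<Prod>i<Suc n. 1 - a * q ^ i) = (1 - a) * (\<Prod>i<n. 1 - (a * q) * q ^ i)" for n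
    by (subst prod.lessThan_Suc_shift) (simp add: mult_ac)
  moreover have "(\<lambda>n. (1 - a) * (\<Prod>i<n. 1 - (a * q) * q ^ i)) \<longlonglongrightarrow> (1 - a) * qprod (a * q) q"
    by (intro tendsto_mult tendsto_const qprod_LIMSEQ assms)
  ultimately show ?thesis using LIMSEQ_unique by simp
qed

lemma qprod_mult_uminus:
  assumes "norm q < 1"
  shows "qprod a q * qprod (- a) q = qprod (a\<^sup>2) (q\<^sup>2)"
  unfolding qprod_def
  by (subst prodinf_mult[OF convergent_prod_qprod convergent_prod_qprod])
    (auto simp: assms power2_eq_square algebra_simps power_mult_distrib)

lemma J_eq_qprod: "J k q = qprod (q ^ k) (q ^ k)"
  unfolding J_def qprod_def by (simp add: power_add power_mult)

text \<open>Folding the indices n and -1 - n together makes the two-sided sum an ordinary series, to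
  which Tannery's theorem applies.\<close>

lemma tannery_int:
  fixes f :: "'b \<Rightarrow> int \<Rightarrow> complex"
  assumes "\<And>k. ((\<lambda>x. f x k) \<longlongrightarrow> g k) fl"
    and "eventually (\<lambda>x. \<forall>k. norm (f x k) \<le> M k) fl"
    and "M summable_on UNIV" "fl \<noteq> bot"
  shows "((\<lambda>x. infsum (f x) UNIV) \<longlongrightarrow> infsum g UNIV) fl"
proof -
  define pr where "pr h n = h (int n) + h (- 1 - int n)" for h :: "int \<Rightarrow> complex" and n
  have split: "infsum h UNIV = suminf (pr h)" if "h abs_summable_on UNIV" for h
  proof -
    have s: "h summable_on A" for A
      using abs_summable_summable[OF that] summable_on_subset_banach by blast
    have 1: "(h has_sum infsum h {0..}) {0..}" "(h has_sum infsum h {..-1}) {..-1}"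
      using s by auto
    have "((\<lambda>n. h (int n)) has_sum infsum h {0..}) UNIV"
      using 1(1) has_sum_reindex_bij_witness[of UNIV nat int "{0..}" h "\<lambda>n. h (int n)"] by auto
    moreover have "((\<lambda>n. h (- 1 - int n)) has_sum infsum h {..-1}) UNIV"
      using 1(2) has_sum_reindex_bij_witness[of UNIV "\<lambda>i. nat (- 1 - i)" "\<lambda>n. - 1 - int n" "{..-1}" h
          "\<lambda>n. h (- 1 - int n)"] by auto
    ultimately have "(pr h has_sum infsum h {0..} + infsum h {..-1}) UNIV"
      unfolding pr_def by (rule has_sum_add)
    from has_sum_imp_sums[OF this] have "suminf (pr h) = infsum h {0..} + infsum h {..-1}"
      by (simp add: sums_iff)
    also have "\<dots> = infsum h ({0..} \<union> {..-1})"
      by (rule infsum_Un_disjoint[symmetric]) (use s in auto)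
    also have "{0..} \<union> {..-1} = (UNIV :: int set)" by auto
    finally show ?thesis by simp
  qed
  have M0: "0 \<le> M k" for k
  proof -
    obtain x where "\<forall>k. norm (f x k) \<le> M k"
      using assms(2,4) eventually_happens by blast
    then show ?thesis using norm_ge_zero order_trans by blast
  qed
  have M: "summable (\<lambda>n. M (int n) + M (- 1 - int n))"
  proof -
    have s: "M summable_on A" for A using assms(3) summable_on_subset_banach by blast
    have "(\<lambda>n. M (int n)) summable_on UNIV \<longleftrightarrow> M summable_on {0..}"
      by (rule summable_on_reindex_bij_witness[of _ nat int]) auto
    moreover have "(\<lambda>n. M (- 1 - int n)) summable_on UNIV \<longleftrightarrow> M summable_on {..-1}"
      by (rule summable_on_reindex_bij_witness[of _ "\<lambda>i. nat (- 1 - i)" "\<lambda>n. - 1 - int n"]) auto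
    ultimately have "(\<lambda>n. M (int n) + M (- 1 - int n)) summable_on UNIV"
      using s by (intro summable_on_add) auto
    then show ?thesis by (rule summable_on_imp_summable)
  qed
  have gM: "norm (g k) \<le> M k" for k
    by (rule tendsto_upperbound[OF tendsto_norm[OF assms(1)] _ assms(4)])
      (use assms(2) in \<open>auto elim: eventually_mono\<close>)
  have ev: "eventually (\<lambda>x. infsum (f x) UNIV = suminf (pr (f x))) fl"
    using assms(2)
  proof eventually_elim
    case (elim x)
    then have "f x abs_summable_on UNIV"
      by (intro summable_on_comparison_test[OF assms(3)]) auto
    then show ?case by (rule split)
  qed
  have "g abs_summable_on UNIV"
    by (rule summable_on_comparison_test[OF assms(3)]) (use gM in auto)
  then have eq: "infsum g UNIV = suminf (pr g)" by (rule split)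
  have "((\<lambda>x. \<Sum>n. pr (f x) n) \<longlongrightarrow> suminf (pr g)) fl"
  proof (rule tannerys_theorem[THEN conjunct2, THEN conjunct2, OF _ _ M assms(4)])
    show "((\<lambda>x. pr (f x) n) \<longlongrightarrow> pr g n) fl" for n
      unfolding pr_def by (intro tendsto_add assms)
    have "eventually (\<lambda>x. \<forall>n. norm (pr (f x) n) \<le> M (int n) + M (- 1 - int n)) fl"
      using assms(2) by eventually_elim (auto simp: pr_def intro!: norm_triangle_mono)
    then show "\<forall>\<^sub>F (n, x) in at_top \<times>\<^sub>F fl. norm (pr (f x) n) \<le> M (int n) + M (- 1 - int n)"
      using eventually_prodI[OF eventually_True[of at_top]] by (fastforce elim: eventually_mono)
  qed
  then show ?thesis
    unfolding eq by (subst tendsto_cong[OF ev])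
qed

section \<open>The finite triple product and its limit\<close>

definition tcoeff :: "complex \<Rightarrow> int \<Rightarrow> complex" where
  "tcoeff q k = (-1) powi k * q powi (k * (k - 1) div 2)"

lemma tcoeff_Suc: "q \<noteq> 0 \<Longrightarrow> tcoeff q (k + 1) = - (q powi k * tcoeff q k)"
proof -
  assume q: "q \<noteq> 0"
  have "(k + 1) * (k + 1 - 1) = k * (k - 1) + k * 2" by (simp add: algebra_simps)
  then have "(k + 1) * (k + 1 - 1) div 2 = k * (k - 1) div 2 + k"
    by (metis div_mult_self1 zero_neq_numeral mult.commute add.commute)
  then show ?thesis unfolding tcoeff_def using q
    by (simp add: power_int_add)
qed

lemma tcoeff_pred: "q \<noteq> 0 \<Longrightarrow> tcoeff q (k - 1) = - (q powi (1 - k) * tcoeff q k)"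
  using tcoeff_Suc[of q "k - 1"] by (simp add: power_int_diff field_simps)

lemma tcoeff_reflect: "tcoeff q (1 - k) = - tcoeff q k"
proof -
  have "(1 - k) * (1 - k - 1) = k * (k - 1)" by (simp add: algebra_simps)
  then show ?thesis unfolding tcoeff_def by (simp add: power_int_diff power_int_minus_left)
qed

lemma gauss_bounded_tcoeff: "norm q < 1 \<Longrightarrow> q \<noteq> 0 \<Longrightarrow> gauss_bounded (tcoeff q)"
  using gauss_bounded_powi_triangular[of q] by (simp add: tcoeff_def[abs_def])

definition qfact :: "complex \<Rightarrow> nat \<Rightarrow> complex" where
  "qfact q n = (\<Prod>i<n. 1 - q ^ Suc i)"

lemma qfact_nonzero: "norm q < 1 \<Longrightarrow> qfact q n \<noteq> 0"
proof -
  assume q: "norm q < 1"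
  have "q ^ Suc i \<noteq> 1" for i
    using power_less_one_iff[of "norm q" "Suc i"] q
    by (metis norm_ge_zero norm_one norm_power order_less_irrefl zero_less_Suc)
  then show ?thesis by (auto simp: qfact_def)
qed

lemma qfact_LIMSEQ: "norm q < 1 \<Longrightarrow> qfact q \<longlonglongrightarrow> qprod q q"
  using qprod_LIMSEQ[of q q] by (simp add: qfact_def[abs_def])

text \<open>Extending 1/(q;q)_m by 0 to negative m keeps the recursion \<open>inv_qfact_pred\<close>
  true for every integer, because 1 - q^0 = 0 at m = 0. Boundary cases in k thus never
  arise.\<close>

definition inv_qfact :: "complex \<Rightarrow> int \<Rightarrow> complex" where
  "inv_qfact q m = (if m < 0 then 0 else inverse (qfact q (nat m)))"

lemma inv_qfact_pred:
  assumes "norm q < 1"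
  shows "inv_qfact q (m - 1) = inv_qfact q m * (1 - q powi m)"
proof (cases "m \<le> 0")
  case True
  then show ?thesis by (cases "m = 0") (auto simp: inv_qfact_def)
next
  case False
  then obtain n where m: "m = int (Suc n)" by (metis gr0_implies_Suc linorder_not_le zero_less_imp_eq_int)
  have "qfact q (Suc n) = qfact q n * (1 - q ^ Suc n)" by (simp add: qfact_def)
  moreover have "qfact q (Suc n) \<noteq> 0" by (rule qfact_nonzero[OF assms])
  ultimately have "inverse (qfact q n) = inverse (qfact q (Suc n)) * (1 - q ^ Suc n)"
    by (simp add: inverse_mult_distrib del: power_Suc)
  moreover have "q powi m = q ^ Suc n" unfolding m by (rule power_int_of_nat)
  moreover have "nat m = Suc n" "nat (m - 1) = n" using m by auto
  ultimately show ?thesis using False by (simp add: inv_qfact_def)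
qed

text \<open>The Gaussian binomial coefficient with top 2n+1 and bottom n+k. The odd top matches the
  2n+1 factors of the finite triple product, and the centring makes k -> 1-k its symmetry.\<close>

definition qbin :: "complex \<Rightarrow> nat \<Rightarrow> int \<Rightarrow> complex" where
  "qbin q n k = qfact q (2 * n + 1) * inv_qfact q (int n + k) * inv_qfact q (int n + 1 - k)"

lemma inv_qfact_LIMSEQ:
  assumes "norm q < 1"
  shows "(\<lambda>n. inv_qfact q (int n + k)) \<longlonglongrightarrow> inverse (qprod q q)"
proof -
  have "filterlim (\<lambda>n. nat (int n + k)) at_top sequentially"
    unfolding filterlim_at_top
  proof
    fix Z
    show "\<forall>\<^sub>F n in sequentially. Z \<le> nat (int n + k)"
      using eventually_ge_at_top[of "Z + nat \<bar>k\<bar>"] by eventually_elim linarith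
  qed
  then have "(\<lambda>n. qfact q (nat (int n + k))) \<longlonglongrightarrow> qprod q q"
    by (rule filterlim_compose[OF qfact_LIMSEQ[OF assms]])
  then have "(\<lambda>n. inverse (qfact q (nat (int n + k)))) \<longlonglongrightarrow> inverse (qprod q q)"
    by (rule tendsto_inverse) (rule qprod_nonzero_norm[OF assms assms])
  moreover have "\<forall>\<^sub>F n in sequentially. inv_qfact q (int n + k) = inverse (qfact q (nat (int n + k)))"
    using eventually_ge_at_top[of "nat \<bar>k\<bar>"] by eventually_elim (auto simp: inv_qfact_def)
  ultimately show ?thesis by (subst tendsto_cong)
qed

lemma inv_qfact_bounded:
  assumes "norm q < 1"
  shows "\<exists>K\<ge>0. \<forall>m. norm (inv_qfact q m) \<le> K"
proof -
  have "Bseq (\<lambda>n. inv_qfact q (int n + 0))"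
    using inv_qfact_LIMSEQ[OF assms, of 0] by (intro convergent_imp_Bseq) (auto simp: convergent_def)
  then obtain K where K: "K > 0" "\<And>n. norm (inv_qfact q (int n)) \<le> K"
    by (auto simp: Bseq_def)
  have "norm (inv_qfact q m) \<le> K" for m
    using K(2)[of "nat m"] K(1) by (cases "m < 0") (auto simp: inv_qfact_def)
  then show ?thesis using K by (meson less_imp_le)
qed

lemma qbin_bounded:
  assumes "norm q < 1"
  shows "\<exists>K\<ge>0. \<forall>n k. norm (qbin q n k) \<le> K"
proof -
  obtain K where K: "\<And>m. norm (inv_qfact q m) \<le> K" "0 \<le> K"
    using inv_qfact_bounded[OF assms] by blast
  have "Bseq (qfact q)"
    using qfact_LIMSEQ[OF assms] by (intro convergent_imp_Bseq) (auto simp: convergent_def)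
  then obtain L where L: "L > 0" "\<And>n. norm (qfact q n) \<le> L"
    by (auto simp: Bseq_def)
  have "norm (qbin q n k) \<le> L * K * K" for n k
    unfolding qbin_def norm_mult by (intro mult_mono K L) (use K L in auto)
  then show ?thesis using K L by (intro exI[of _ "L * K * K"]) auto
qed

lemma qbin_LIMSEQ:
  assumes "norm q < 1"
  shows "(\<lambda>n. qbin q n k) \<longlonglongrightarrow> inverse (qprod q q)"
proof -
  have "filterlim (\<lambda>n::nat. 2 * n + 1) at_top sequentially"
    by (intro filterlim_subseq strict_monoI) simp
  from filterlim_compose[OF qfact_LIMSEQ[OF assms] this]
  have 1: "(\<lambda>n. qfact q (2 * n + 1)) \<longlonglongrightarrow> qprod q q" .
  have "(\<lambda>n. qbin q n k) \<longlonglongrightarrow> qprod q q * inverse (qprod q q) * inverse (qprod q q)"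
    unfolding qbin_def
    using inv_qfact_LIMSEQ[OF assms, of "1 - k"]
    by (intro tendsto_mult 1 inv_qfact_LIMSEQ assms) (simp add: algebra_simps)
  then show ?thesis using qprod_nonzero_norm[OF assms assms] by simp
qed

text \<open>The coefficient form of multiplying by (1 - b q^(n+1)) (1 - q^(n+1)/b), which leads from
  n to n+1 in the finite triple product. After removing common factors, all terms are polynomial in
  q, A y and A / y, where A = q^n and y = q^k.\<close>

lemma qbin_Suc:
  assumes "norm q < 1" "q \<noteq> 0"
  shows "tcoeff q k * qbin q (Suc n) k =
    (1 + q ^ (2 * n + 2)) * (tcoeff q k * qbin q n k)
      - q ^ (n + 1) * (tcoeff q (k - 1) * qbin q n (k - 1))
      - q ^ (n + 1) * (tcoeff q (k + 1) * qbin q n (k + 1))"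
proof -
  define A where "A = q ^ n"
  define y where "y = q powi k"
  define u where "u = inv_qfact q (int n + 1 + k)"
  define v where "v = inv_qfact q (int n + 2 - k)"
  define w where "w = qfact q (2 * n + 1)"
  note p = inv_qfact_pred[OF assms(1)]
  have y: "y \<noteq> 0" using assms by (simp add: y_def)
  have pw: "q powi (int n + j + k) = A * q powi j * y" "q powi (int n + j - k) = A * q powi j / y" for j
    using assms by (simp_all add: A_def y_def power_int_add power_int_diff)
  have u1: "inv_qfact q (int n + k) = u * (1 - q * A * y)"
    using p[of "int n + 1 + k"] pw(1)[of 1] by (simp add: u_def algebra_simps)
  have "inv_qfact q (int n + k - 1) = u * (1 - q * A * y) * (1 - A * y)"
    using p[of "int n + k"] pw(1)[of 0] by (simp add: u1)
  then have u2: "inv_qfact q (int n + (k - 1)) = u * (1 - q * A * y) * (1 - A * y)"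
    by (simp add: add_diff_eq)
  have v1: "inv_qfact q (int n + 1 - k) = v * (1 - q\<^sup>2 * A / y)"
    using p[of "int n + 2 - k"] pw(2)[of 2] by (simp add: v_def algebra_simps)
  have "inv_qfact q (int n + 1 - k - 1) = v * (1 - q\<^sup>2 * A / y) * (1 - q * A / y)"
    using p[of "int n + 1 - k"] pw(2)[of 1] by (simp add: v1 mult.commute)
  then have v2: "inv_qfact q (int n + 1 - (k + 1)) = v * (1 - q\<^sup>2 * A / y) * (1 - q * A / y)"
    by (simp add: algebra_simps)
  have u3: "inv_qfact q (int n + (k + 1)) = u" "inv_qfact q (int n + 1 - (k - 1)) = v"
    "inv_qfact q (int (Suc n) + k) = u" "inv_qfact q (int (Suc n) + 1 - k) = v"
    by (simp_all add: u_def v_def algebra_simps)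
  have w1: "qfact q (2 * Suc n + 1) = w * (1 - q\<^sup>2 * A\<^sup>2) * (1 - q ^ 3 * A\<^sup>2)"
    by (simp add: qfact_def w_def A_def power_mult[symmetric] power_add[symmetric] eval_nat_numeral mult_ac)
  have t: "tcoeff q (k - 1) = - (q / y * tcoeff q k)" "tcoeff q (k + 1) = - (y * tcoeff q k)"
    using tcoeff_pred[OF assms(2), of k] tcoeff_Suc[OF assms(2), of k] assms
    by (simp_all add: y_def power_int_diff)
  have "A\<^sup>2 = q ^ (2 * n)"
    by (simp add: A_def mult.commute flip: power_mult)
  then have e: "q ^ (2 * n + 2) = q\<^sup>2 * A\<^sup>2" "q ^ (n + 1) = q * A"
    by (simp_all add: A_def power_add power2_eq_square)
  \<comment> \<open>With z = A y and x = A / y one has z x = A^2, which reduces the claim to the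
    polynomial identity \<open>poly\<close>.\<close>
  have key: "(1 - q\<^sup>2 * A\<^sup>2) * (1 - q ^ 3 * A\<^sup>2) =
      (1 + q\<^sup>2 * A\<^sup>2) * (1 - q * A * y) * (1 - q\<^sup>2 * A / y)
      + q\<^sup>2 * A / y * (1 - q * A * y) * (1 - A * y)
      + q * A * y * (1 - q\<^sup>2 * A / y) * (1 - q * A / y)"
  proof -
    have poly: "(1 - q\<^sup>2 * (z * x)) * (1 - q ^ 3 * (z * x)) =
      (1 + q\<^sup>2 * (z * x)) * (1 - q * z) * (1 - q\<^sup>2 * x)
      + q\<^sup>2 * x * (1 - q * z) * (1 - z) + q * z * (1 - q\<^sup>2 * x) * (1 - q * x)" for z x :: complex
      by (simp add: algebra_simps power2_eq_square power3_eq_cube)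
    have "A\<^sup>2 = (A * y) * (A / y)" using y by (simp add: power2_eq_square)
    then show ?thesis using poly[of "A * y" "A / y"] by (simp add: mult_ac)
  qed
  have "tcoeff q k * qbin q (Suc n) k = tcoeff q k * w * u * v * ((1 - q\<^sup>2 * A\<^sup>2) * (1 - q ^ 3 * A\<^sup>2))"
    unfolding qbin_def u3 w1 by (simp add: mult_ac)
  also have "\<dots> = (1 + q ^ (2 * n + 2)) * (tcoeff q k * qbin q n k)
      - q ^ (n + 1) * (tcoeff q (k - 1) * qbin q n (k - 1))
      - q ^ (n + 1) * (tcoeff q (k + 1) * qbin q n (k + 1))"
    unfolding key qbin_def u1 u2 u3 v1 v2 t e w_def[symmetric] divide_inverse
    by algebra
  finally show ?thesis .
qed

lemma gauss_bounded_qbin: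
  assumes "norm q < 1" "q \<noteq> 0"
  shows "gauss_bounded (\<lambda>k. tcoeff q k * qbin q n k)"
proof -
  obtain K where K: "\<And>n k. norm (qbin q n k) \<le> K" "0 \<le> K"
    using qbin_bounded[OF assms(1)] by blast
  show ?thesis
    using gauss_bounded_mult_bounded[OF gauss_bounded_tcoeff[OF assms], of "qbin q n" K] K by (simp add: mult.commute)
qed

lemma qbin_tannery:
  assumes "norm q < 1" "gauss_bounded f"
  shows "(\<lambda>n. \<Sum>\<^sub>\<infinity>k. qbin q n k * f k) \<longlonglongrightarrow> inverse (qprod q q) * infsum f UNIV"
proof -
  obtain K where K: "\<And>n k. norm (qbin q n k) \<le> K" "0 \<le> K"
    using qbin_bounded[OF assms(1)] by blast
  have "(\<lambda>n. \<Sum>\<^sub>\<infinity>k. qbin q n k * f k) \<longlonglongrightarrow> (\<Sum>\<^sub>\<infinity>k. inverse (qprod q q) * f k)"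
  proof (rule tannery_int[where M = "\<lambda>k. K * norm (f k)"])
    show "(\<lambda>n. qbin q n k * f k) \<longlonglongrightarrow> inverse (qprod q q) * f k" for k
      by (intro tendsto_mult tendsto_const qbin_LIMSEQ assms)
    show "\<forall>\<^sub>F n in sequentially. \<forall>k. norm (qbin q n k * f k) \<le> K * norm (f k)"
      using K by (intro always_eventually allI) (auto simp: norm_mult intro!: mult_right_mono)
    show "(\<lambda>k. K * norm (f k)) summable_on UNIV"
      by (intro summable_on_cmult_right gauss_bounded_abs_summable assms)
  qed simp
  then show ?thesis by (simp add: infsum_cmult_right')
qed

lemma infsum_powi_quotient:
  assumes "gauss_bounded f" "b \<noteq> 0"
  shows "(\<Sum>\<^sub>\<infinity>k. f k * ((b powi k - 1) / (b - 1))) = ((\<Sum>\<^sub>\<infinity>k. f k * b powi k) - infsum f UNIV) * inverse (b - 1)"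
proof -
  have "f k * ((b powi k - 1) / (b - 1)) = (f k * b powi k - f k) * inverse (b - 1)" for k
    by (simp add: divide_inverse algebra_simps)
  then show ?thesis
    using assms by (simp add: infsum_cmult_left' infsum_diff gauss_bounded_summable gauss_bounded_mult_powi)
qed

lemma eventually_at_1_nonzero: "\<forall>\<^sub>F b::complex in at 1. b \<noteq> 0 \<and> b \<noteq> 1"
  unfolding eventually_at by (intro exI[of _ "1 / 2"]) (auto simp: dist_norm)

lemma finite_triple_product:
  assumes "norm q < 1" "q \<noteq> 0" "b \<noteq> 0"
  shows "(\<Sum>\<^sub>\<infinity>k. tcoeff q k * qbin q n k * b powi k) =
    (1 - b) * (\<Prod>i<n. (1 - b * q ^ Suc i) * (1 - q ^ Suc i / b))"
proof (induction n)
  case 0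
  have "tcoeff q k * qbin q 0 k * b powi k = 0" if "k \<notin> {0, 1}" for k
    using that by (auto simp: qbin_def inv_qfact_def)
  then have "(\<Sum>\<^sub>\<infinity>k. tcoeff q k * qbin q 0 k * b powi k) = (\<Sum>\<^sub>\<infinity>k\<in>{0,1}. tcoeff q k * qbin q 0 k * b powi k)"
    by (intro infsum_cong_neutral) auto
  also have "\<dots> = 1 - b"
    using qfact_nonzero[OF assms(1), of 1]
    by (simp add: qbin_def inv_qfact_def tcoeff_def qfact_def)
  finally show ?case by simp
next
  case (Suc n)
  define f where "f k = tcoeff q k * qbin q n k * b powi k" for k
  have sf: "f summable_on UNIV"
    unfolding f_def
    by (intro gauss_bounded_summable gauss_bounded_mult_powi gauss_bounded_qbin assms)
  have "tcoeff q k * qbin q (Suc n) k * b powi k =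
     (1 + q ^ (2 * n + 2)) * f k + - (q ^ (n + 1) * b) * f (k + - 1) + - (q ^ (n + 1) / b) * f (k + 1)" for k
    unfolding qbin_Suc[OF assms(1,2)] f_def
    using assms(3) by (simp add: algebra_simps power_int_diff power_int_add)
  then have "(\<Sum>\<^sub>\<infinity>k. tcoeff q k * qbin q (Suc n) k * b powi k) =
    (\<Sum>\<^sub>\<infinity>k. (1 + q ^ (2 * n + 2)) * f k + - (q ^ (n + 1) * b) * f (k + - 1) + - (q ^ (n + 1) / b) * f (k + 1))"
    by simp
  also have "\<dots> = (1 + q ^ (2 * n + 2)) * infsum f UNIV + - (q ^ (n + 1) * b) * (\<Sum>\<^sub>\<infinity>k. f (k + - 1))
     + - (q ^ (n + 1) / b) * (\<Sum>\<^sub>\<infinity>k. f (k + 1))"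
  proof -
    have "(\<lambda>k. f (k + - 1)) summable_on UNIV" "(\<lambda>k. f (k + 1)) summable_on UNIV"
      using sf by (simp_all only: summable_on_int_shift)
    then show ?thesis using sf
      by (simp only: infsum_add infsum_cmult_right' summable_on_add summable_on_cmult_right)
  qed
  also have "\<dots> = (1 + q ^ (2 * n + 2) - q ^ (n + 1) * b - q ^ (n + 1) / b) * infsum f UNIV"
    unfolding infsum_int_shift by (simp add: algebra_simps)
  also have "1 + q ^ (2 * n + 2) - q ^ (n + 1) * b - q ^ (n + 1) / b = (1 - b * q ^ Suc n) * (1 - q ^ Suc n / b)"
    using assms(3) by (simp add: field_simps power_add power_mult power2_eq_square)
  finally show ?case
    using Suc.IH by (simp add: f_def mult_ac)
qed

definition theta :: "complex \<Rightarrow> complex \<Rightarrow> complex" where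
  "theta b q = (\<Sum>\<^sub>\<infinity>k. tcoeff q k * b powi k)"

theorem jacobi_triple_product:
  assumes "norm q < 1" "q \<noteq> 0" "b \<noteq> 0"
  shows "theta b q = qprod b q * qprod (q / b) q * qprod q q"
proof -
  define f where "f k = tcoeff q k * b powi k" for k
  have "gauss_bounded f"
    unfolding f_def by (intro gauss_bounded_mult_powi gauss_bounded_tcoeff assms)
  from qbin_tannery[OF assms(1) this]
  have 1: "(\<lambda>n. \<Sum>\<^sub>\<infinity>k. qbin q n k * f k) \<longlonglongrightarrow> inverse (qprod q q) * theta b q"
    by (simp add: theta_def f_def[abs_def])
  have fin: "(\<Sum>\<^sub>\<infinity>k. qbin q n k * f k) = (\<Prod>i<Suc n. 1 - b * q ^ i) * (\<Prod>i<n. 1 - (q / b) * q ^ i)" for n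
  proof -
    have "(\<Sum>\<^sub>\<infinity>k. qbin q n k * f k) = (\<Sum>\<^sub>\<infinity>k. tcoeff q k * qbin q n k * b powi k)"
      by (simp add: f_def mult_ac)
    also have "\<dots> = (1 - b) * (\<Prod>i<n. (1 - b * q ^ Suc i) * (1 - q ^ Suc i / b))"
      by (rule finite_triple_product[OF assms])
    also have "\<dots> = ((1 - b) * (\<Prod>i<n. 1 - b * q ^ Suc i)) * (\<Prod>i<n. 1 - q ^ Suc i / b)"
      by (simp add: prod.distrib)
    also have "(1 - b) * (\<Prod>i<n. 1 - b * q ^ Suc i) = (\<Prod>i<Suc n. 1 - b * q ^ i)"
      by (subst prod.lessThan_Suc_shift) simp
    finally show ?thesis by simp
  qed
  have "(\<lambda>n. (\<Prod>i<Suc n. 1 - b * q ^ i) * (\<Prod>i<n. 1 - (q / b) * q ^ i)) \<longlonglongrightarrow> qprod b q * qprod (q / b) q"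
    by (intro tendsto_mult qprod_LIMSEQ assms LIMSEQ_Suc)
  then have "inverse (qprod q q) * theta b q = qprod b q * qprod (q / b) q"
    using 1 LIMSEQ_unique unfolding fin by blast
  then show ?thesis
    using qprod_nonzero_norm[OF assms(1,1)] by (simp add: field_simps)
qed

lemma theta_1: "theta 1 q = 0"
proof -
  have "theta 1 q = (\<Sum>\<^sub>\<infinity>k. tcoeff q (1 - k))"
    unfolding theta_def by (simp add: infsum_int_reflect)
  also have "\<dots> = - theta 1 q"
    by (simp add: tcoeff_reflect theta_def infsum_uminus)
  finally show ?thesis by simp
qed

section \<open>Differentiation at b = 1 and Jacobi's cube identity\<close>

lemma powi_quotient_tendsto:
  "((\<lambda>b::complex. (b powi k - 1) / (b - 1)) \<longlongrightarrow> of_int k) (at 1)"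
proof -
  have "((\<lambda>b::complex. b powi k) has_field_derivative of_int k * 1 powi (k - 1)) (at 1)"
    unfolding has_field_derivative_def
    using has_derivative_power_int'[of "1::complex" k UNIV] by (simp add: mult.commute[of _ "of_int k"])
  then show ?thesis by (simp add: has_field_derivative_iff)
qed

text \<open>Near 1 both |b| and 1/|b| are at most 2. A geometric sum costs |k| 2^|k|, and a negative
  exponent costs 2^|k| once more; hence the base 4.\<close>

lemma powi_quotient_bound:
  fixes b :: complex
  assumes "norm (b - 1) \<le> 1 / 2" "b \<noteq> 1"
  shows "norm ((b powi k - 1) / (b - 1)) \<le> \<bar>of_int k\<bar> * 4 powi \<bar>k\<bar>"
proof -
  have nb: "norm b \<le> 2" "norm b \<ge> 1 / 2"
    using assms(1) norm_triangle_ineq2[of b 1] norm_triangle_ineq2[of 1 b] by (simp_all add: norm_minus_commute)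
  have *: "norm ((b ^ n - 1) / (b - 1)) \<le> real n * 2 ^ n" for n
  proof -
    have "(b ^ n - 1) / (b - 1) = (\<Sum>i<n. b ^ i)"
      using assms(2) by (simp add: geometric_sum)
    also have "norm \<dots> \<le> (\<Sum>i<n. 2 ^ n)"
    proof (rule sum_norm_le)
      fix i assume "i \<in> {..<n}"
      have "norm (b ^ i) \<le> 2 ^ i" unfolding norm_power by (rule power_mono[OF nb(1)]) simp
      also have "\<dots> \<le> (2::real) ^ n" using \<open>i \<in> {..<n}\<close> by (intro power_increasing) auto
      finally show "norm (b ^ i) \<le> 2 ^ n" .
    qed
    finally show ?thesis by simp
  qed
  show ?thesis
  proof (cases "k \<ge> 0")
    case True
    then obtain n where k: "k = int n" using nonneg_int_cases by blast
    have "real n * 2 ^ n \<le> real n * 4 ^ n" by (intro mult_left_mono power_mono) auto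
    then show ?thesis using *[of n] by (simp add: k)
  next
    case False
    define n where "n = nat (- k)"
    have k: "k = - int n" using False by (simp add: n_def)
    have b0: "b \<noteq> 0" using nb by auto
    have "(b powi k - 1) / (b - 1) = - (inverse b ^ n * ((b ^ n - 1) / (b - 1)))"
      using b0 assms(2) by (simp add: k power_int_minus field_simps)
    also have "norm \<dots> = norm (inverse b) ^ n * norm ((b ^ n - 1) / (b - 1))"
      by (simp only: norm_mult norm_power norm_minus_cancel)
    also have "\<dots> \<le> 2 ^ n * (real n * 2 ^ n)"
    proof (intro mult_mono power_mono *)
      show "norm (inverse b) \<le> 2" using nb b0 by (simp add: norm_inverse norm_divide field_simps)
    qed auto
    also have "\<dots> = real n * 4 ^ n"
      by (simp flip: power_mult_distrib)
    finally show ?thesis by (simp add: k)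
  qed
qed

text \<open>Differentiation of a two-sided series at b = 1 by dominated difference quotients; this
  gives the simple zero of theta at 1 without complex analysis.\<close>

lemma tannery_powi_quotient:
  assumes "gauss_bounded f"
  shows "((\<lambda>b. \<Sum>\<^sub>\<infinity>k. f k * ((b powi k - 1) / (b - 1))) \<longlongrightarrow> (\<Sum>\<^sub>\<infinity>k. f k * of_int k)) (at 1)"
proof (rule tannery_int[where M = "\<lambda>k. norm (f k) * (\<bar>of_int k\<bar> * 4 powi \<bar>k\<bar>)"])
  show "((\<lambda>b. f k * ((b powi k - 1) / (b - 1))) \<longlongrightarrow> f k * of_int k) (at 1)" for k
    by (intro tendsto_mult tendsto_const powi_quotient_tendsto)
  have "\<forall>\<^sub>F b::complex in at 1. norm (b - 1) \<le> 1 / 2 \<and> b \<noteq> 1"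
    unfolding eventually_at by (intro exI[of _ "1 / 2"]) (auto simp: dist_norm)
  then show "\<forall>\<^sub>F b in at 1. \<forall>k. norm (f k * ((b powi k - 1) / (b - 1))) \<le> norm (f k) * (\<bar>of_int k\<bar> * 4 powi \<bar>k\<bar>)"
  proof eventually_elim
    case (elim b)
    then show ?case
      unfolding norm_mult by (intro allI mult_left_mono powi_quotient_bound) auto
  qed
  have a: "(\<lambda>k. of_int k * f k * z powi k) abs_summable_on UNIV" if "z \<noteq> 0" for z
    by (intro gauss_bounded_abs_summable gauss_bounded_mult_powi gauss_bounded_mult_of_int assms that)
  \<comment> \<open>4^|k| is at most 4^k + 4^(-k), so two evaluations of a Gaussian series provide
    the majorant.\<close>
  have "(\<lambda>k. norm (of_int k * f k * 4 powi k) + norm (of_int k * f k * (1 / 4) powi k)) summable_on UNIV"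
    by (intro summable_on_add a) auto
  then show "(\<lambda>k. norm (f k) * (\<bar>of_int k\<bar> * 4 powi \<bar>k\<bar>)) summable_on UNIV"
  proof (rule summable_on_comparison_test)
    fix k :: int
    have "(4::real) powi \<bar>k\<bar> \<le> 4 powi k + (1 / 4) powi k" if "k \<ge> 0" for k :: int
      using that by simp
    moreover have "(4::real) powi \<bar>k\<bar> \<le> 4 powi k + (1 / 4) powi k" if "k < 0" for k :: int
      using that by (simp add: power_int_minus power_int_divide_distrib field_simps)
    ultimately have "(4::real) powi \<bar>k\<bar> \<le> 4 powi k + (1 / 4) powi k"
      by (cases "k \<ge> 0") auto
    then have "norm (f k) * (\<bar>of_int k\<bar> * 4 powi \<bar>k\<bar>) \<le> norm (f k) * (\<bar>of_int k\<bar> * (4 powi k + (1 / 4) powi k))"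
      by (intro mult_left_mono) auto
    then show "norm (f k) * (\<bar>of_int k\<bar> * 4 powi \<bar>k\<bar>) \<le>
        norm (of_int k * f k * 4 powi k) + norm (of_int k * f k * (1 / 4) powi k)"
      by (simp add: norm_mult norm_power_int algebra_simps)
  qed auto
qed simp

text \<open>Dividing the finite triple product by b - 1 and letting b -> 1 gives -(q;q)_n^2, so only
  finite products are differentiated. As n grows, \<open>qbin\<close> tends to 1/(q;q)_inf, which
  supplies the third factor of the cube.\<close>

lemma jacobi_derivative:
  assumes "norm q < 1" "q \<noteq> 0"
  shows "(\<Sum>\<^sub>\<infinity>k. of_int k * tcoeff q k) = - (qprod q q ^ 3)"
proof -
  have fin: "(\<Sum>\<^sub>\<infinity>k. tcoeff q k * qbin q n k * of_int k) = - ((qfact q n)\<^sup>2)" for n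
  proof -
    define f where "f k = tcoeff q k * qbin q n k" for k
    have gf: "gauss_bounded f" unfolding f_def by (rule gauss_bounded_qbin[OF assms])
    have "((\<lambda>b. - (\<Prod>i<n. (1 - b * q ^ Suc i) * (1 - q ^ Suc i / b))) \<longlongrightarrow>
        - (\<Prod>i<n. (1 - 1 * q ^ Suc i) * (1 - q ^ Suc i / 1))) (at 1)"
      by (intro tendsto_intros) auto
    also have "?this \<longleftrightarrow> ((\<lambda>b. \<Sum>\<^sub>\<infinity>k. f k * ((b powi k - 1) / (b - 1))) \<longlongrightarrow>
        - (\<Prod>i<n. (1 - 1 * q ^ Suc i) * (1 - q ^ Suc i / 1))) (at 1)"
    proof (rule tendsto_cong)
      show "\<forall>\<^sub>F b in at 1. - (\<Prod>i<n. (1 - b * q ^ Suc i) * (1 - q ^ Suc i / b)) =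
          (\<Sum>\<^sub>\<infinity>k. f k * ((b powi k - 1) / (b - 1)))"
        using eventually_at_1_nonzero
      proof eventually_elim
        case (elim b)
        have "(\<Sum>\<^sub>\<infinity>k. f k * ((b powi k - 1) / (b - 1))) = ((\<Sum>\<^sub>\<infinity>k. f k * b powi k) - infsum f UNIV) * inverse (b - 1)"
          using infsum_powi_quotient[OF gf] elim by blast
        also have "(\<Sum>\<^sub>\<infinity>k. f k * b powi k) = (1 - b) * (\<Prod>i<n. (1 - b * q ^ Suc i) * (1 - q ^ Suc i / b))"
          unfolding f_def by (rule finite_triple_product) (use assms elim in auto)
        also have "infsum f UNIV = 0"
          using finite_triple_product[OF assms, of 1 n] by (simp add: f_def[abs_def])
        also have "((1 - b) * (\<Prod>i<n. (1 - b * q ^ Suc i) * (1 - q ^ Suc i / b)) - 0) * inverse (b - 1) =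
            ((1 - b) * inverse (b - 1)) * (\<Prod>i<n. (1 - b * q ^ Suc i) * (1 - q ^ Suc i / b))"
          by (simp only: diff_zero mult_ac)
        also have "(1 - b) * inverse (b - 1) = - 1"
          using elim by (simp add: field_simps)
        finally show ?case by simp
      qed
    qed
    finally have "(\<Sum>\<^sub>\<infinity>k. f k * of_int k) = - (\<Prod>i<n. (1 - 1 * q ^ Suc i) * (1 - q ^ Suc i / 1))"
      using tannery_powi_quotient[OF gf] tendsto_unique[OF at_neq_bot] by blast
    then show ?thesis
      by (simp add: f_def qfact_def prod.distrib power2_eq_square)
  qed
  define f where "f k = of_int k * tcoeff q k" for k
  have "gauss_bounded f"
    unfolding f_def by (intro gauss_bounded_mult_of_int gauss_bounded_tcoeff assms)
  from qbin_tannery[OF assms(1) this]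
  have "(\<lambda>n. \<Sum>\<^sub>\<infinity>k. qbin q n k * f k) \<longlonglongrightarrow> inverse (qprod q q) * infsum f UNIV" .
  moreover have "(\<Sum>\<^sub>\<infinity>k. qbin q n k * f k) = - ((qfact q n)\<^sup>2)" for n
    using fin[of n] by (simp add: f_def mult_ac)
  ultimately have "(\<lambda>n. - ((qfact q n)\<^sup>2)) \<longlonglongrightarrow> inverse (qprod q q) * infsum f UNIV"
    by simp
  moreover have "(\<lambda>n. - ((qfact q n)\<^sup>2)) \<longlonglongrightarrow> - ((qprod q q)\<^sup>2)"
    by (intro tendsto_intros qfact_LIMSEQ assms)
  ultimately have "inverse (qprod q q) * infsum f UNIV = - ((qprod q q)\<^sup>2)"
    using LIMSEQ_unique by blast
  then show ?thesis
    using qprod_nonzero_norm[OF assms(1,1)] by (simp add: f_def[abs_def] field_simps power3_eq_cube power2_eq_square)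
qed

lemma theta_quotient_tendsto:
  assumes "norm q < 1" "q \<noteq> 0"
  shows "((\<lambda>b. theta b q / (1 - b)) \<longlongrightarrow> ((qprod q q) ^ 3)) (at 1)"
proof -
  have g: "gauss_bounded (tcoeff q)" by (rule gauss_bounded_tcoeff[OF assms])
  have "((\<lambda>b. - (\<Sum>\<^sub>\<infinity>k. tcoeff q k * ((b powi k - 1) / (b - 1)))) \<longlongrightarrow> - (\<Sum>\<^sub>\<infinity>k. tcoeff q k * of_int k)) (at 1)"
    by (intro tendsto_minus tannery_powi_quotient g)
  also have "?this \<longleftrightarrow> ((\<lambda>b. theta b q / (1 - b)) \<longlongrightarrow> - (\<Sum>\<^sub>\<infinity>k. tcoeff q k * of_int k)) (at 1)"
  proof (rule tendsto_cong)
    show "\<forall>\<^sub>F b in at 1. - (\<Sum>\<^sub>\<infinity>k. tcoeff q k * ((b powi k - 1) / (b - 1))) = theta b q / (1 - b)"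
      using eventually_at_1_nonzero
    proof eventually_elim
      case (elim b)
      have "(\<Sum>\<^sub>\<infinity>k. tcoeff q k * ((b powi k - 1) / (b - 1))) = (theta b q - theta 1 q) * inverse (b - 1)"
        using infsum_powi_quotient[OF g] elim by (simp add: theta_def)
      then show ?case using elim by (simp add: theta_1 field_simps)
    qed
  qed
  finally show ?thesis
    using jacobi_derivative[OF assms] by (simp add: mult.commute)
qed

subsection \<open>Kronecker's identity\<close>

lemma gauss_bounded_theta:
  assumes "norm q < 1" "q \<noteq> 0" "b \<noteq> 0"
  shows "gauss_bounded (\<lambda>k. tcoeff q k * b powi k)"
  by (intro gauss_bounded_mult_powi gauss_bounded_tcoeff assms)

lemma theta_mult_q:
  assumes "q \<noteq> 0" "b \<noteq> 0"
  shows "theta (b * q) q = - theta b q / b"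
proof -
  have "theta (b * q) q = (\<Sum>\<^sub>\<infinity>k. - inverse b * (tcoeff q (k + 1) * b powi (k + 1)))"
    unfolding theta_def using assms
    by (intro infsum_cong) (simp add: tcoeff_Suc power_int_mult_distrib power_int_add)
  also have "\<dots> = - inverse b * theta b q"
    unfolding theta_def by (simp only: infsum_cmult_right' infsum_int_shift[of "\<lambda>k. tcoeff q k * b powi k"])
  finally show ?thesis by (simp add: divide_inverse mult.commute)
qed

lemma theta_q_powi:
  assumes "q \<noteq> 0"
  shows "theta (q powi j) q = 0"
proof (induction j rule: int_induct[where k = 0])
  case base
  show ?case by (simp add: theta_1)
next
  case (step1 i)
  then show ?case
    using theta_mult_q[of q "q powi i"] assms by (simp add: power_int_add)
next
  case (step2 i)
  then show ?case
    using theta_mult_q[of q "q powi (i - 1)"] assms by (simp add: power_int_diff)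
qed

text \<open>For n = -m the term 1/(1 - b q^n) is q^m/(q^m - b), so the second family controls the
  negative half. Both families converge, to 1 and to -1/b, and are therefore bounded.\<close>

lemma pole_bound:
  fixes b q :: complex
  assumes "norm q < 1" "q \<noteq> 0" "b \<noteq> 0" "\<And>n. b * q powi n \<noteq> 1"
  shows "\<exists>K\<ge>0. \<forall>n::nat. norm (1 / (1 - b * q ^ n)) \<le> K \<and> norm (1 / (q ^ n - b)) \<le> K"
proof -
  have 1: "(\<lambda>n. 1 / (1 - b * q ^ n)) \<longlonglongrightarrow> 1 / (1 - b * 0)"
    using assms by (intro tendsto_intros LIMSEQ_power_zero) auto
  have 2: "(\<lambda>n. 1 / (q ^ n - b)) \<longlonglongrightarrow> 1 / (0 - b)"
    using assms by (intro tendsto_intros LIMSEQ_power_zero) auto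
  have "Bseq (\<lambda>n. 1 / (1 - b * q ^ n))" "Bseq (\<lambda>n. 1 / (q ^ n - b))"
    using 1 2 by (auto intro!: convergent_imp_Bseq simp: convergent_def)
  then obtain K L where "K > 0" "\<And>n. norm (1 / (1 - b * q ^ n)) \<le> K"
    "L > 0" "\<And>n. norm (1 / (q ^ n - b)) \<le> L"
    by (auto simp: Bseq_def)
  then show ?thesis
    by (intro exI[of _ "max K L"]) (auto simp: le_max_iff_disj)
qed

lemma pole_powi_minus:
  fixes b q :: complex
  assumes "q \<noteq> 0"
  shows "1 / (1 - b * q powi (- int n)) = q ^ n * (1 / (q ^ n - b))"
  using assms by (simp add: power_int_minus field_simps)

lemma pole_bounded_int:
  fixes b q :: complex
  assumes "norm q < 1" "q \<noteq> 0" "b \<noteq> 0" "\<And>n. b * q powi n \<noteq> 1"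
  shows "\<exists>K\<ge>0. \<forall>n. norm (1 / (1 - b * q powi n)) \<le> K"
proof -
  obtain K where K: "K \<ge> 0" "\<And>n::nat. norm (1 / (1 - b * q ^ n)) \<le> K" "\<And>n::nat. norm (1 / (q ^ n - b)) \<le> K"
    using pole_bound[OF assms] by blast
  have "norm (1 / (1 - b * q powi n)) \<le> K" for n
  proof (cases "n \<ge> 0")
    case True
    then show ?thesis using K(2)[of "nat n"] by (simp add: power_int_def)
  next
    case False
    define m where "m = nat (- n)"
    have n: "n = - int m" using False by (simp add: m_def)
    have "norm (1 / (1 - b * q powi n)) = norm q ^ m * norm (1 / (q ^ m - b))"
      unfolding n pole_powi_minus[OF assms(2)] norm_mult norm_power ..
    also have "\<dots> \<le> 1 * K"
      using assms(1) K by (intro mult_mono power_le_one) auto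
    finally show ?thesis by simp
  qed
  then show ?thesis using K by blast
qed

text \<open>An Appell-Lerch sum in unnormalised form: no theta function is divided out.\<close>

definition appell :: "complex \<Rightarrow> complex \<Rightarrow> complex \<Rightarrow> complex" where
  "appell z b q = (\<Sum>\<^sub>\<infinity>s. tcoeff q s * z powi s / (1 - b * q powi s))"

lemma gauss_bounded_pole:
  assumes "norm q < 1" "q \<noteq> 0" "b \<noteq> 0" "\<And>n. b * q powi n \<noteq> 1" "gauss_bounded f"
  shows "gauss_bounded (\<lambda>s. f s / (1 - b * q powi s))"
proof -
  obtain K where "\<And>n. norm (1 / (1 - b * q powi n)) \<le> K"
    using pole_bounded_int[OF assms(1-4)] by blast
  from gauss_bounded_mult_bounded[OF assms(5), of "\<lambda>n. 1 / (1 - b * q powi n)", OF this]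
  show ?thesis by simp
qed

lemma appell_mult_q:
  assumes "norm q < 1" "q \<noteq> 0" "b \<noteq> 0" "\<And>n. b * q powi n \<noteq> 1" "z \<noteq> 0"
  shows "appell z b q = b * appell (z * q) b q + theta z q"
proof -
  have s: "(\<lambda>s. tcoeff q s * y powi s / (1 - b * q powi s)) summable_on UNIV" if "y \<noteq> 0" for y
    by (intro gauss_bounded_summable gauss_bounded_pole gauss_bounded_theta assms that)
  have "appell z b q - b * appell (z * q) b q =
     (\<Sum>\<^sub>\<infinity>s. tcoeff q s * z powi s / (1 - b * q powi s) - b * (tcoeff q s * (z * q) powi s / (1 - b * q powi s)))"
    unfolding appell_def
    by (subst infsum_diff[OF s summable_on_cmult_right[OF s]]) (use assms in \<open>simp_all only: infsum_cmult_right' mult_eq_0_iff simp_thms\<close>)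
  also have "\<dots> = theta z q"
    unfolding theta_def
  proof (rule infsum_cong)
    fix s
    have "1 - b * q powi s \<noteq> 0" using assms(4)[of s] by simp
    then show "tcoeff q s * z powi s / (1 - b * q powi s) - b * (tcoeff q s * (z * q) powi s / (1 - b * q powi s))
        = tcoeff q s * z powi s"
      by (simp add: power_int_mult_distrib divide_simps) (simp add: algebra_simps)
  qed
  finally show ?thesis by (simp add: algebra_simps)
qed

text \<open>At powers of q the theta term in \<open>appell_mult_q\<close> vanishes, so moving the
  argument by a factor q only multiplies the sum by a power of b.\<close>

lemma appell_q_powi:
  assumes "norm q < 1" "q \<noteq> 0" "b \<noteq> 0" "\<And>n. b * q powi n \<noteq> 1"
  shows "appell (q powi (1 - j)) b q = b powi j * appell q b q"
proof (induction j rule: int_induct[where k = 0])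
  case base
  show ?case by simp
next
  case (step1 i)
  have e: "q powi - i * q = q powi (1 - i)" "1 - (i + 1) = - i"
    using assms(2) by (simp_all add: power_int_add power_int_minus power_int_diff field_simps)
  have "appell (q powi (- i)) b q = b * appell (q powi (1 - i)) b q"
    using appell_mult_q[OF assms, of "q powi (- i)"] theta_q_powi[OF assms(2)] assms(2) e by simp
  then show ?case using step1.IH assms e by (simp add: power_int_add)
next
  case (step2 i)
  have e: "q powi (1 - i) * q = q powi (1 - (i - 1))"
    using assms(2) by (simp add: power_int_add power_int_minus power_int_diff field_simps power2_eq_square)
  have "appell (q powi (1 - i)) b q = b * appell (q powi (1 - (i - 1))) b q"
    using appell_mult_q[OF assms, of "q powi (1 - i)"] theta_q_powi[OF assms(2)] assms(2) e by simp
  then show ?case using step2.IH assms by (simp add: power_int_diff field_simps)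
qed

lemma tcoeff_diff:
  assumes "q \<noteq> 0"
  shows "tcoeff q (N - s) = tcoeff q N * (tcoeff q s * (q powi (1 - N)) powi s)"
proof -
  have "2 * ((N - s) * (N - s - 1) div 2) = (N - s) * (N - s - 1)"
    "2 * (N * (N - 1) div 2) = N * (N - 1)" "2 * (s * (s - 1) div 2) = s * (s - 1)"
    by (auto intro!: dvd_mult_div_cancel)
  then have "2 * ((N - s) * (N - s - 1) div 2) = 2 * (N * (N - 1) div 2 + s * (s - 1) div 2 + (1 - N) * s)"
    by (simp add: algebra_simps)
  then have e: "(N - s) * (N - s - 1) div 2 = N * (N - 1) div 2 + s * (s - 1) div 2 + (1 - N) * s"
    by (rule mult_left_cancel[THEN iffD1, rotated]) simp
  have sg: "(-1) powi (N - s) = (-1) powi N * ((-1) powi s :: complex)"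
    by (simp add: power_int_diff power_int_minus_left)
  show ?thesis
    unfolding tcoeff_def e sg using assms
    by (simp add: power_int_add power_int_mult[symmetric])
qed

definition kronecker_sum :: "complex \<Rightarrow> complex \<Rightarrow> complex \<Rightarrow> complex" where
  "kronecker_sum a b q = (\<Sum>\<^sub>\<infinity>n. a powi n / (1 - b * q powi n))"

lemma abs_summable_on_int_geometric:
  fixes a :: complex
  assumes "\<And>n::nat. norm (f (int n)) \<le> C * r ^ n" "\<And>n::nat. norm (f (- int n)) \<le> C * s ^ n"
    and "0 \<le> r" "r < 1" "0 \<le> s" "s < 1"
  shows "(f :: int \<Rightarrow> complex) abs_summable_on UNIV"
proof (rule abs_summable_on_intI)
  show "summable (\<lambda>n. norm (f (int n)))"
    by (rule summable_comparison_test'[of "\<lambda>n. C * r ^ n"]) (use assms in \<open>auto intro!: summable_mult\<close>)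
  show "summable (\<lambda>n. norm (f (- int n)))"
    by (rule summable_comparison_test'[of "\<lambda>n. C * s ^ n"]) (use assms in \<open>auto intro!: summable_mult\<close>)
qed

lemma kronecker_abs_summable:
  fixes a b q :: complex
  assumes "norm q < 1" "q \<noteq> 0" "b \<noteq> 0" "\<And>n. b * q powi n \<noteq> 1" "norm q < norm a" "norm a < 1"
  shows "(\<lambda>n. a powi n / (1 - b * q powi n)) abs_summable_on UNIV"
proof -
  obtain K where K: "K \<ge> 0" "\<And>n::nat. norm (1 / (1 - b * q ^ n)) \<le> K" "\<And>n::nat. norm (1 / (q ^ n - b)) \<le> K"
    using pole_bound[OF assms(1-4)] by blast
  have a: "a \<noteq> 0" using assms by auto
  show ?thesis
  proof (rule abs_summable_on_int_geometric[where C = K and r = "norm a" and s = "norm (q / a)"])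
    fix n :: nat
    have "norm (a powi int n / (1 - b * q powi int n)) = norm a ^ n * norm (1 / (1 - b * q ^ n))"
      by (simp add: norm_divide norm_power)
    also have "\<dots> \<le> norm a ^ n * K" using K by (intro mult_left_mono) auto
    finally show "norm (a powi int n / (1 - b * q powi int n)) \<le> K * norm a ^ n" by (simp add: mult.commute)
    have "a powi (- int n) / (1 - b * q powi (- int n)) = a powi (- int n) * (1 / (1 - b * q powi (- int n)))"
      by simp
    also have "\<dots> = (q / a) ^ n * (1 / (q ^ n - b))"
      unfolding pole_powi_minus[OF assms(2)] using a by (simp add: power_int_minus power_divide field_simps)
    also have "norm \<dots> = norm (q / a) ^ n * norm (1 / (q ^ n - b))"
      by (simp only: norm_mult norm_power)
    also have "\<dots> \<le> norm (q / a) ^ n * K" using K by (intro mult_left_mono) auto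
    finally show "norm (a powi (- int n) / (1 - b * q powi (- int n))) \<le> K * norm (q / a) ^ n"
      by (simp add: mult.commute)
  qed (use assms a in \<open>auto simp: norm_divide\<close>)
qed

text \<open>Comparison of coefficients of a^n: by \<open>tcoeff_diff\<close> the convolution is
  \<open>tcoeff q n\<close> times an Appell sum at q^(1-n), hence b^n times the sum at q. Only the
  constant \<open>appell q b q\<close> is left to identify.\<close>

lemma theta_mult_kronecker:
  assumes "norm q < 1" "q \<noteq> 0" "b \<noteq> 0" "\<And>n. b * q powi n \<noteq> 1" "norm q < norm a" "norm a < 1"
  shows "theta a q * kronecker_sum a b q = appell q b q * theta (a * b) q"
proof -
  have a: "a \<noteq> 0" using assms by auto
  have "theta a q * kronecker_sum a b q =
      (\<Sum>\<^sub>\<infinity>n. tcoeff q n * a powi n) * (\<Sum>\<^sub>\<infinity>n. 1 / (1 - b * q powi n) * a powi n)"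
    by (simp add: theta_def kronecker_sum_def)
  also have "\<dots> = (\<Sum>\<^sub>\<infinity>n. conv (tcoeff q) (\<lambda>n. 1 / (1 - b * q powi n)) n * a powi n)"
    by (rule infsum_conv_powi[symmetric, OF a])
      (use kronecker_abs_summable[OF assms] gauss_bounded_abs_summable[OF gauss_bounded_theta[OF assms(1,2) a]] in simp_all)
  also have "conv (tcoeff q) (\<lambda>n. 1 / (1 - b * q powi n)) = (\<lambda>n. tcoeff q n * b powi n * appell q b q)"
  proof
    fix n
    have "conv (tcoeff q) (\<lambda>n. 1 / (1 - b * q powi n)) n = conv (\<lambda>n. 1 / (1 - b * q powi n)) (tcoeff q) n"
      by (rule conv_commute)
    also have "\<dots> = (\<Sum>\<^sub>\<infinity>s. tcoeff q n * (tcoeff q s * (q powi (1 - n)) powi s / (1 - b * q powi s)))"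
      unfolding conv_def tcoeff_diff[OF assms(2)] by simp
    also have "\<dots> = tcoeff q n * appell (q powi (1 - n)) b q"
      by (simp only: infsum_cmult_right' appell_def)
    finally show "conv (tcoeff q) (\<lambda>n. 1 / (1 - b * q powi n)) n = tcoeff q n * b powi n * appell q b q"
      by (simp add: appell_q_powi[OF assms(1-4)] mult_ac)
  qed
  also have "(\<Sum>\<^sub>\<infinity>n. tcoeff q n * b powi n * appell q b q * a powi n) =
      (\<Sum>\<^sub>\<infinity>n. appell q b q * (tcoeff q n * (a * b) powi n))"
    by (simp add: power_int_mult_distrib mult_ac)
  finally show ?thesis by (simp only: infsum_cmult_right' theta_def)
qed

text \<open>The pole at a = 1 comes from the terms n >= 0, whose coefficients tend to 1. Subtracting
  their geometric series leaves coefficients \<open>h\<close> of order |q|^|n|, whose sum stays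
  bounded as a -> 1 from the left.\<close>

lemma kronecker_sum_residue:
  assumes "norm q < 1" "q \<noteq> 0" "b \<noteq> 0" "\<And>n. b * q powi n \<noteq> 1"
  shows "((\<lambda>x. (1 - of_real x) * kronecker_sum (of_real x) b q) \<longlongrightarrow> 1) (at_left 1)"
proof -
  obtain K where K: "K \<ge> 0" "\<And>n::nat. norm (1 / (1 - b * q ^ n)) \<le> K" "\<And>n::nat. norm (1 / (q ^ n - b)) \<le> K"
    using pole_bound[OF assms(1-4)] by blast
  define C where "C = max (norm b * K) K + 1"
  have C: "norm b * K \<le> C" "K \<le> C" "1 \<le> C" using K by (auto simp: C_def max_def mult_nonneg_nonneg)
  define h where "h n = 1 / (1 - b * q powi n) - (if n \<ge> 0 then 1 else 0)" for n :: int
  have h1: "norm (h (int n)) \<le> C * norm q ^ n" for n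
  proof -
    have "1 - b * q ^ n \<noteq> 0" using assms(4)[of "int n"] by simp
    then have "h (int n) = b * q ^ n * (1 / (1 - b * q ^ n))" by (simp add: h_def field_simps)
    also have "norm \<dots> = (norm b * norm (1 / (1 - b * q ^ n))) * norm q ^ n"
      by (simp only: norm_mult norm_power mult_ac)
    also have "\<dots> \<le> (norm b * K) * norm q ^ n"
      by (intro mult_right_mono mult_left_mono K) auto
    also have "\<dots> \<le> C * norm q ^ n" by (intro mult_right_mono C) auto
    finally show ?thesis .
  qed
  have h2: "norm (h (- int n)) \<le> C * norm q ^ n" for n
  proof (cases "n = 0")
    case True then show ?thesis using h1[of 0] by simp
  next
    case False
    then have "h (- int n) = q ^ n * (1 / (q ^ n - b))"
      by (simp add: h_def pole_powi_minus[OF assms(2), of b n, simplified])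
    also have "norm \<dots> = norm (1 / (q ^ n - b)) * norm q ^ n"
      by (simp only: norm_mult norm_power mult_ac)
    also have "\<dots> \<le> C * norm q ^ n" using K(3)[of n] C(2) by (intro mult_right_mono) auto
    finally show ?thesis .
  qed
  \<comment> \<open>Some r strictly between |q| and 1: for r < x < 1 the terms are at most C
    (|q|/r)^|n|, a majorant independent of x.\<close>
  define r where "r = (1 + norm q) / 2"
  have r: "norm q < r" "r < 1" "0 < r"
    using assms(1) norm_ge_zero[of q] unfolding r_def by (simp_all add: add_pos_nonneg)
  define M where "M n = C * norm q ^ nat \<bar>n\<bar> * (1 / r) ^ nat \<bar>n\<bar>" for n :: int
  have Ms: "M summable_on UNIV"
  proof -
    have "(\<lambda>n. complex_of_real (M n)) abs_summable_on UNIV"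
      by (rule abs_summable_on_int_geometric[where C = C and r = "norm q / r" and s = "norm q / r"])
        (use r C in \<open>auto simp: M_def norm_mult norm_divide norm_power power_divide\<close>)
    moreover have "norm (complex_of_real (M n)) = M n" for n
      using C r by (simp add: M_def norm_mult norm_divide norm_power)
    ultimately show ?thesis by simp
  qed
  have hM: "norm (h n * of_real x powi n) \<le> M n" if "x \<in> {r<..<1}" for x n
  proof -
    have x: "0 < x" "r < x" "x < 1" using that r by auto
    have "norm (of_real x powi n :: complex) \<le> (1 / r) ^ nat \<bar>n\<bar>"
    proof (cases "n \<ge> 0")
      case True
      have "x ^ nat n \<le> 1" using x by (intro power_le_one) auto
      also have "1 \<le> (1 / r) ^ nat n" using r by (intro one_le_power) auto
      finally show ?thesis using True x by (simp add: power_int_def norm_power)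
    next
      case False
      have "(1 / x) ^ nat (- n) \<le> (1 / r) ^ nat (- n)"
        using x r by (intro power_mono divide_left_mono) auto
      then show ?thesis using False x by (simp add: power_int_def norm_power norm_inverse divide_inverse)
    qed
    moreover have "norm (h n) \<le> C * norm q ^ nat \<bar>n\<bar>"
      using h1[of "nat n"] h2[of "nat (- n)"] by (cases "n \<ge> 0") auto
    ultimately show ?thesis unfolding norm_mult M_def
      using C by (intro mult_mono) auto
  qed
  have eq: "(1 - of_real x) * kronecker_sum (of_real x) b q = 1 + (1 - of_real x) * (\<Sum>\<^sub>\<infinity>n. h n * of_real x powi n)"
    if x: "x \<in> {r<..<1}" for x
  proof -
    define a where "a = complex_of_real x"
    have a: "norm a < 1" "a \<noteq> 0" "a \<noteq> 1" using x r by (auto simp: a_def)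
    have hs: "(\<lambda>n. h n * a powi n) summable_on UNIV"
      by (rule abs_summable_summable, rule summable_on_comparison_test[OF Ms])
        (use hM[OF x] in \<open>simp_all add: a_def\<close>)
    have g: "((\<lambda>n. a ^ n) has_sum 1 / (1 - a)) UNIV"
    proof (rule norm_summable_imp_has_sum)
      show "summable (\<lambda>n. norm (a ^ n))" using a by (simp add: norm_power summable_geometric)
      show "(\<lambda>n. a ^ n) sums (1 / (1 - a))" by (rule geometric_sums[OF a(1)])
    qed
    also have "?this \<longleftrightarrow> ((\<lambda>n::int. if n \<ge> 0 then a powi n else 0) has_sum 1 / (1 - a)) {0..}"
      by (rule has_sum_reindex_bij_witness[of _ nat int]) (auto simp: power_int_def)
    also have "\<dots> \<longleftrightarrow> ((\<lambda>n::int. if n \<ge> 0 then a powi n else 0) has_sum 1 / (1 - a)) UNIV"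
      by (rule has_sum_cong_neutral) auto
    finally have g: "((\<lambda>n::int. if n \<ge> 0 then a powi n else 0) has_sum 1 / (1 - a)) UNIV" .
    have "kronecker_sum a b q = (\<Sum>\<^sub>\<infinity>n. h n * a powi n + (if n \<ge> 0 then a powi n else 0))"
      unfolding kronecker_sum_def h_def by (intro infsum_cong) (simp add: algebra_simps)
    also have "\<dots> = (\<Sum>\<^sub>\<infinity>n. h n * a powi n) + 1 / (1 - a)"
      using infsum_add[OF hs, of "\<lambda>n. if n \<ge> 0 then a powi n else 0"] g infsumI[OF g]
      by (auto simp: summable_on_def)
    finally show ?thesis using a unfolding a_def[symmetric] by (simp add: field_simps)
  qed
  have ev: "\<forall>\<^sub>F x in at_left 1. x \<in> {r<..<1}"
    using r by (simp add: eventually_at_left_field) (use r(2) in blast)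
  have "((\<lambda>x. (1 - of_real x) * (\<Sum>\<^sub>\<infinity>n. h n * of_real x powi n)) \<longlongrightarrow> 0) (at_left (1::real))"
  proof (rule Lim_null_comparison)
    show "\<forall>\<^sub>F x in at_left 1. norm ((1 - of_real x) * (\<Sum>\<^sub>\<infinity>n. h n * of_real x powi n)) \<le> (1 - x) * infsum M UNIV"
      using ev
    proof eventually_elim
      case (elim x)
      have "norm (\<Sum>\<^sub>\<infinity>n. h n * of_real x powi n) \<le> (\<Sum>\<^sub>\<infinity>n. norm (h n * of_real x powi n))"
        by (rule norm_infsum_bound, rule summable_on_comparison_test[OF Ms]) (use hM[OF elim] in auto)
      also have "\<dots> \<le> infsum M UNIV"
        by (rule infsum_mono[OF summable_on_comparison_test[OF Ms] Ms]) (use hM[OF elim] in auto)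
      finally have "norm (\<Sum>\<^sub>\<infinity>n. h n * of_real x powi n) \<le> infsum M UNIV" .
      moreover have "norm (1 - of_real x :: complex) = 1 - x"
        using elim by (metis abs_of_nonneg diff_ge_0_iff_ge greaterThanLessThan_iff less_imp_le norm_of_real of_real_1 of_real_diff)
      ultimately show ?case unfolding norm_mult using elim by (intro mult_mono) auto
    qed
    have "((\<lambda>x. (1 - x) * infsum M UNIV) \<longlongrightarrow> (1 - 1) * infsum M UNIV) (at_left (1::real))"
      by (intro tendsto_intros)
    then show "((\<lambda>x. (1 - x) * infsum M UNIV) \<longlongrightarrow> 0) (at_left (1::real))" by simp
  qed
  then have "((\<lambda>x. 1 + (1 - of_real x) * (\<Sum>\<^sub>\<infinity>n. h n * of_real x powi n)) \<longlongrightarrow> 1 + 0) (at_left (1::real))"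
    by (intro tendsto_add tendsto_const)
  then have "((\<lambda>x. 1 + (1 - of_real x) * (\<Sum>\<^sub>\<infinity>n. h n * of_real x powi n)) \<longlongrightarrow> 1) (at_left (1::real))"
    by simp
  then show ?thesis
    by (rule Lim_transform_eventually) (use ev eq in \<open>auto elim!: eventually_mono\<close>)
qed

text \<open>Let a -> 1 in \<open>theta_mult_kronecker\<close>: the simple zero of
  \<open>theta a q\<close> meets the simple pole of the Kronecker sum, and Jacobi's cube identity
  gives the limit.\<close>

theorem appell_mult_theta:
  assumes "norm q < 1" "q \<noteq> 0" "b \<noteq> 0" "\<And>n. b * q powi n \<noteq> 1"
  shows "appell q b q * theta b q = qprod q q ^ 3"
proof -
  have c: "filterlim complex_of_real (at 1) (at_left 1)"
    unfolding filterlim_at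
    by (auto intro!: tendsto_eq_intros simp: eventually_at_filter)
  have 1: "((\<lambda>x. theta (of_real x) q / (1 - of_real x)) \<longlongrightarrow> qprod q q ^ 3) (at_left (1::real))"
    using filterlim_compose[OF theta_quotient_tendsto[OF assms(1,2)] c] .
  have lim: "((\<lambda>x. (theta (of_real x) q / (1 - of_real x)) * ((1 - of_real x) * kronecker_sum (of_real x) b q))
      \<longlongrightarrow> (qprod q q ^ 3) * 1) (at_left (1::real))"
    by (rule tendsto_mult[OF 1 kronecker_sum_residue[OF assms]])
  have "\<forall>\<^sub>F x in at_left (1::real). (theta (of_real x) q / (1 - of_real x)) * ((1 - of_real x) * kronecker_sum (of_real x) b q)
      = appell q b q * theta (of_real x * b) q"
  proof -
    have "\<forall>\<^sub>F x in at_left (1::real). x \<in> {norm q<..<1}"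
      using assms(1) by (simp add: eventually_at_left_field) (use assms(1) in blast)
    then show ?thesis
    proof eventually_elim
      case (elim x)
      then have "norm (complex_of_real x) = x" using norm_ge_zero[of q] by (simp, linarith)
      then show ?case
        using theta_mult_kronecker[OF assms, of "of_real x"] elim by auto
    qed
  qed
  from Lim_transform_eventually[OF lim this]
  have 2: "((\<lambda>x. appell q b q * theta (of_real x * b) q) \<longlongrightarrow> qprod q q ^ 3) (at_left (1::real))" by simp
  have 3: "((\<lambda>x. theta (of_real x * b) q) \<longlongrightarrow> theta b q) (at_left (1::real))"
  proof -
    have g: "gauss_bounded (\<lambda>k. tcoeff q k * b powi k)"
      by (rule gauss_bounded_theta[OF assms(1-3)])
    have "((\<lambda>z. (\<Sum>\<^sub>\<infinity>k. tcoeff q k * b powi k * ((z powi k - 1) / (z - 1))) * (z - 1)) \<longlongrightarrow>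
        (\<Sum>\<^sub>\<infinity>k. tcoeff q k * b powi k * of_int k) * (1 - 1)) (at 1)"
      by (intro tendsto_mult tannery_powi_quotient g tendsto_diff tendsto_ident_at tendsto_const)
    moreover have "\<forall>\<^sub>F z in at 1. (\<Sum>\<^sub>\<infinity>k. tcoeff q k * b powi k * ((z powi k - 1) / (z - 1))) * (z - 1) = theta (z * b) q - theta b q"
      using eventually_at_1_nonzero
    proof eventually_elim
      case (elim z)
      have "(\<Sum>\<^sub>\<infinity>k. tcoeff q k * b powi k * z powi k) = theta (z * b) q"
        unfolding theta_def power_int_mult_distrib by (simp add: mult_ac)
      then show ?case
        using infsum_powi_quotient[OF g, of z] elim by (simp add: theta_def)
    qed
    ultimately have "((\<lambda>z. theta (z * b) q - theta b q) \<longlongrightarrow> 0) (at 1)"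
      using Lim_transform_eventually by fastforce
    then have "((\<lambda>z. theta (z * b) q) \<longlongrightarrow> theta b q) (at 1)"
      by (simp add: LIM_zero_iff)
    from filterlim_compose[OF this c] show ?thesis .
  qed
  have "((\<lambda>x. appell q b q * theta (of_real x * b) q) \<longlongrightarrow> appell q b q * theta b q) (at_left (1::real))"
    by (intro tendsto_mult tendsto_const 3)
  then show ?thesis
    using tendsto_unique[OF _ _ 2] trivial_limit_at_left_real by blast
qed

theorem kronecker:
  assumes "norm q < 1" "q \<noteq> 0" "b \<noteq> 0" "\<And>n. b * q powi n \<noteq> 1" "norm q < norm a" "norm a < 1"
  shows "theta a q * theta b q * kronecker_sum a b q = qprod q q ^ 3 * theta (a * b) q"
proof -
  have "theta a q * theta b q * kronecker_sum a b q = (theta a q * kronecker_sum a b q) * theta b q"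
    by (simp add: mult_ac)
  also have "\<dots> = (appell q b q * theta b q) * theta (a * b) q"
    unfolding theta_mult_kronecker[OF assms] by (simp add: mult_ac)
  finally show ?thesis unfolding appell_mult_theta[OF assms(1-4)] .
qed

subsection \<open>Lambert coefficients\<close>

lemma power_powi: "(q ^ m) powi k = q powi (int m * k)" for q :: complex
  by (simp add: power_int_mult)

lemma powi_neq_1:
  fixes q :: complex
  assumes "norm q < 1" "q \<noteq> 0" "k \<noteq> 0"
  shows "norm (q powi k) \<noteq> 1"
proof (cases "k > 0")
  case True
  then have "norm (q powi k) < 1"
    using assms(1) by (simp add: power_int_def norm_power power_less_one_iff)
  then show ?thesis by simp
next
  case False
  then have "norm (q powi (- k)) < 1"
    using assms by (simp add: power_int_def norm_power power_less_one_iff)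
  then show ?thesis using assms by (auto simp: power_int_minus norm_inverse)
qed

lemma one_plus_powi_nonzero:
  fixes q :: complex
  assumes "norm q < 1" "q \<noteq> 0" "k \<noteq> 0"
  shows "1 + q powi k \<noteq> 0"
proof
  assume "1 + q powi k = 0"
  then have "q powi k = - 1" by (simp add: add_eq_0_iff)
  then show False using powi_neq_1[OF assms] by simp
qed

lemma minus_power_powi_neq_1:
  fixes q :: complex
  assumes "norm q < 1" "q \<noteq> 0" "\<And>n. int m * n + int a \<noteq> 0"
  shows "- (q ^ a) * (q ^ m) powi n \<noteq> 1"
proof
  assume "- (q ^ a) * (q ^ m) powi n = 1"
  then have "norm (- (q ^ a) * (q ^ m) powi n) = 1" by simp
  then have "norm (q powi (int m * n + int a)) = 1"
    using assms(2) by (simp add: power_powi power_int_add norm_mult mult.commute)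
  then show False using powi_neq_1[OF assms] by blast
qed

lemma infsum_int_multiples:
  fixes f :: "int \<Rightarrow> complex"
  assumes "m \<noteq> 0" "\<And>n. \<not> m dvd n \<Longrightarrow> f n = 0"
  shows "infsum f UNIV = (\<Sum>\<^sub>\<infinity>k. f (m * k))"
proof -
  have "infsum f UNIV = infsum f {n. m dvd n}"
    by (rule infsum_cong_neutral) (use assms(2) in auto)
  also have "\<dots> = (\<Sum>\<^sub>\<infinity>k. f (m * k))"
    by (rule infsum_reindex_bij_witness[of _ "\<lambda>k. m * k" "\<lambda>n. n div m"]) (use assms(1) in auto)
  finally show ?thesis .
qed

lemma infsum_int_mod3:
  fixes f :: "int \<Rightarrow> complex"
  assumes "f summable_on UNIV"
  shows "infsum f UNIV = (\<Sum>\<^sub>\<infinity>k. f (3 * k)) + (\<Sum>\<^sub>\<infinity>k. f (3 * k - 1)) + (\<Sum>\<^sub>\<infinity>k. f (3 * k - 2))"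
proof -
  have s: "f summable_on A" for A using assms summable_on_subset_banach by blast
  have r: "infsum f {n. n mod 3 = (- j) mod 3} = (\<Sum>\<^sub>\<infinity>k. f (3 * k - j))" if "j \<in> {0, 1, 2}" for j
  proof (rule infsum_reindex_bij_witness[of _ "\<lambda>k. 3 * k - j" "\<lambda>n. (n + j) div 3"])
    fix n assume "n \<in> {n. n mod 3 = (- j) mod 3}"
    then have "n mod 3 = (- j) mod 3" by simp
    then show e: "3 * ((n + j) div 3) - j = n"
      using that by (auto; presburger)
    show "f (3 * ((n + j) div 3) - j) = f n" unfolding e ..
  next
    fix k
    show "3 * k - j \<in> {n. n mod 3 = (- j) mod 3}"
      using that by (auto; presburger)
  qed auto
  have "infsum f UNIV = infsum f ({n. n mod 3 = (- 0) mod 3} \<union> {n. n mod 3 = (- 1) mod 3} \<union> {n. n mod 3 = (- 2) mod 3})"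
    by (rule arg_cong[of _ _ "infsum f"]) (auto; presburger)
  also have "\<dots> = infsum f {n. n mod 3 = (- 0) mod 3} + infsum f {n. n mod 3 = (- 1) mod 3} + infsum f {n. n mod 3 = (- 2) mod 3}"
    by (subst infsum_Un_disjoint; (rule s)?; auto)+
  also have "\<dots> = (\<Sum>\<^sub>\<infinity>k. f (3 * k - 0)) + (\<Sum>\<^sub>\<infinity>k. f (3 * k - 1)) + (\<Sum>\<^sub>\<infinity>k. f (3 * k - 2))"
    by (subst (1 2 3) r) auto
  finally show ?thesis by simp
qed

lemma gauss_bounded_add:
  assumes "gauss_bounded f" "gauss_bounded g"
  shows "gauss_bounded (\<lambda>n. f n + g n)"
proof -
  obtain r z C where f: "0 \<le> r" "r < 1" "0 \<le> z" "0 \<le> C"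
    "\<And>s. norm (f s) \<le> C * r ^ nat (s\<^sup>2) * z ^ nat \<bar>s\<bar>"
    using assms(1) unfolding gauss_bounded_def by auto
  obtain r' z' C' where g: "0 \<le> r'" "r' < 1" "0 \<le> z'" "0 \<le> C'"
    "\<And>s. norm (g s) \<le> C' * r' ^ nat (s\<^sup>2) * z' ^ nat \<bar>s\<bar>"
    using assms(2) unfolding gauss_bounded_def by auto
  have "norm (f s + g s) \<le> (C + C') * (max r r') ^ nat (s\<^sup>2) * (max z z') ^ nat \<bar>s\<bar>" for s
  proof -
    have "norm (f s + g s) \<le> norm (f s) + norm (g s)" by (rule norm_triangle_ineq)
    also have "\<dots> \<le> C * r ^ nat (s\<^sup>2) * z ^ nat \<bar>s\<bar> + C' * r' ^ nat (s\<^sup>2) * z' ^ nat \<bar>s\<bar>"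
      by (intro add_mono f g)
    also have "\<dots> \<le> C * (max r r') ^ nat (s\<^sup>2) * (max z z') ^ nat \<bar>s\<bar> + C' * (max r r') ^ nat (s\<^sup>2) * (max z z') ^ nat \<bar>s\<bar>"
      by (intro add_mono mult_mono power_mono mult_nonneg_nonneg zero_le_power) (use f g in auto)
    finally show ?thesis by (simp add: algebra_simps)
  qed
  then show ?thesis unfolding gauss_bounded_def using f g
    by (intro exI[of _ "max r r'"] exI[of _ "max z z'"] exI[of _ "C + C'"]) auto
qed

lemma gauss_bounded_cmult: "gauss_bounded f \<Longrightarrow> gauss_bounded (\<lambda>n. c * f n)"
  by (rule gauss_bounded_mult_bounded[where K = "norm c"]) auto

section \<open>The coefficient sequences of theta and of its multiple-of-3 part\<close>

definition th :: "complex \<Rightarrow> int \<Rightarrow> complex" where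
  "th q n = (-1) powi n * q powi (n\<^sup>2)"

definition th9 :: "complex \<Rightarrow> int \<Rightarrow> complex" where
  "th9 q n = (if 3 dvd n then th q n else 0)"

lemma th_Suc: "q \<noteq> 0 \<Longrightarrow> th q (n + 1) = - (q powi (2 * n + 1) * th q n)"
  unfolding th_def by (simp add: power_int_add power2_eq_square algebra_simps)

text \<open>A step of 3 preserves divisibility by 3, so this recursion, unlike
  \<open>th_Suc\<close>, passes to \<open>th9\<close>. That is why the comparison of the two
  sequences runs in steps of 3.\<close>

lemma th_add3:
  assumes "q \<noteq> 0"
  shows "th q (n + 3) = - (q powi (6 * n + 9) * th q n)"
proof -
  have "(n + 3)\<^sup>2 = n\<^sup>2 + (6 * n + 9)" by (simp add: power2_eq_square algebra_simps)
  then show ?thesis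
    unfolding th_def using assms by (simp only: power_int_add) (simp add: power_int_add)
qed

lemma th9_add3: "q \<noteq> 0 \<Longrightarrow> th9 q (n + 3) = - (q powi (6 * n + 9) * th9 q n)"
  by (simp add: th9_def th_add3)

lemma th_minus: "th q (- n) = th q n"
  by (simp add: th_def power_int_minus_left)

lemma th9_minus: "th9 q (- n) = th9 q n"
  by (simp add: th9_def th_minus)

lemma gauss_bounded_th:
  assumes "norm q < 1" "q \<noteq> 0"
  shows "gauss_bounded (\<lambda>n. th q (n + j))"
proof -
  have "gauss_bounded (\<lambda>n. th q j * (th q n * (q powi (2 * j)) powi n))"
    by (intro gauss_bounded_cmult gauss_bounded_mult_powi)
      (use gauss_bounded_powi_square[OF assms(1)] assms in \<open>simp_all add: th_def[abs_def]\<close>)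
  also have "(\<lambda>n. th q j * (th q n * (q powi (2 * j)) powi n)) = (\<lambda>n. th q (n + j))"
  proof
    fix n
    have "(n + j)\<^sup>2 = j\<^sup>2 + n\<^sup>2 + 2 * j * n" by (simp add: power2_eq_square algebra_simps)
    then show "th q j * (th q n * (q powi (2 * j)) powi n) = th q (n + j)"
      using assms by (simp add: th_def power_int_add flip: power_int_mult)
  qed
  finally show ?thesis .
qed

lemma gauss_bounded_th9:
  assumes "norm q < 1" "q \<noteq> 0"
  shows "gauss_bounded (\<lambda>n. th9 q (n + j))"
proof -
  have "gauss_bounded (\<lambda>n. (if 3 dvd n + j then 1 else 0) * th q (n + j))"
    by (rule gauss_bounded_mult_bounded[where K = 1, OF gauss_bounded_th[OF assms]]) auto
  also have "(\<lambda>n. (if 3 dvd n + j then 1 else 0) * th q (n + j)) = (\<lambda>n. th9 q (n + j))"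
    by (auto simp: th9_def fun_eq_iff)
  finally show ?thesis .
qed

text \<open>The factor \<open>1 - q^(2n-1) + q^(4n-2)\<close> that turns the denominator \<open>1 + q^(2n-1)\<close> into
  \<open>1 + q^(6n-3)\<close> acts on \<open>th\<close> as a combination of shifts, because \<open>q^(2n+1) th(n) = - th(n+1)\<close>.
  In this form it also makes sense for \<open>th9\<close>.\<close>

definition lift3 :: "complex \<Rightarrow> (int \<Rightarrow> complex) \<Rightarrow> int \<Rightarrow> complex" where
  "lift3 q f n = f n + q powi (-2) * f (n + 1) + q powi (-6) * f (n + 2)"

definition lambert :: "complex \<Rightarrow> (int \<Rightarrow> complex) \<Rightarrow> int \<Rightarrow> complex" where
  "lambert q f n = lift3 q f n / (1 + q powi (6 * n - 3))"

lemma lambert_th: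
  assumes "norm q < 1" "q \<noteq> 0"
  shows "lambert q (th q) n = th q n / (1 + q powi (2 * n - 1))"
proof -
  define x where "x = q powi (2 * n - 1)"
  have n2: "n + 1 + 1 = n + 2" "2 * (n + 1) + 1 = 2 * n + 3" by simp_all
  have "th q (n + 1 + 1) = - (q powi (2 * (n + 1) + 1) * th q (n + 1))" by (rule th_Suc[OF assms(2)])
  then have t2: "th q (n + 2) = q powi (2 * n + 3) * q powi (2 * n + 1) * th q n"
    unfolding n2 th_Suc[OF assms(2)] by simp
  have e: "q powi (-2) * q powi (2 * n + 1) = x" "q powi (-6) * (q powi (2 * n + 3) * q powi (2 * n + 1)) = x * x"
    "q powi (6 * n - 3) = x * x * x"
    unfolding x_def using assms(2) by (simp_all flip: power_int_add) 
  have "lift3 q (th q) n = th q n - (q powi (-2) * q powi (2 * n + 1)) * th q n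
      + (q powi (-6) * (q powi (2 * n + 3) * q powi (2 * n + 1))) * th q n"
    unfolding lift3_def t2 th_Suc[OF assms(2)] by (simp add: mult_ac)
  then have l: "lift3 q (th q) n = th q n * (1 - x + x * x)" unfolding e by (simp add: algebra_simps)
  have odd: "2 * n - 1 \<noteq> 0" "6 * n - 3 \<noteq> 0" by presburger+
  have nz: "1 + x \<noteq> 0" "1 + x * x * x \<noteq> 0"
    using odd one_plus_powi_nonzero[OF assms, of "2 * n - 1"] one_plus_powi_nonzero[OF assms, of "6 * n - 3"]
    unfolding e(3) x_def[symmetric] by blast+
  have "(1 - x + x * x) * (1 + x) = 1 + x * x * x" by (simp add: algebra_simps)
  then have "th q n * (1 - x + x * x) * (1 + x) = th q n * (1 + x * x * x)" by (simp only: mult.assoc)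
  then show ?thesis
    unfolding lambert_def l e(3) x_def[symmetric] by (rule iffD2[OF frac_eq_eq[OF nz(2,1)]])
qed

text \<open>Of three consecutive indices exactly one is a multiple of 3, so \<open>lift3\<close>
  keeps a single term. The remaining class 3k - 2 = 1 - 3(1 - k) is reached through
  \<open>lambert_reflect\<close>.\<close>

lemma lambert_th9:
  assumes "q \<noteq> 0"
  shows "lambert q (th9 q) (3 * k) = th q (3 * k) / (1 + q powi (18 * k - 3))"
    and "lambert q (th9 q) (3 * k - 1) = q powi (-2) * th q (3 * k) / (1 + q powi (18 * k - 9))"
proof -
  have "\<not> 3 dvd (3 * k + 1)" "\<not> 3 dvd (3 * k + 2)" "\<not> 3 dvd (3 * k - 1)" by presburger+
  then show "lambert q (th9 q) (3 * k) = th q (3 * k) / (1 + q powi (18 * k - 3))"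
    "lambert q (th9 q) (3 * k - 1) = q powi (-2) * th q (3 * k) / (1 + q powi (18 * k - 9))"
    by (simp_all add: lambert_def lift3_def th9_def add.commute)
qed

lemma gauss_bounded_pole_plus:
  fixes q :: complex
  assumes "norm q < 1" "q \<noteq> 0" "gauss_bounded f" "0 < m" "\<And>n. int m * n + j \<noteq> 0"
  shows "gauss_bounded (\<lambda>n. f n / (1 + q powi (int m * n + j)))"
proof -
  have "gauss_bounded (\<lambda>n. f n / (1 - (- (q powi j)) * (q ^ m) powi n))"
  proof (rule gauss_bounded_pole[OF _ _ _ _ assms(3)])
    show "norm (q ^ m) < 1" using assms by (simp add: norm_power power_less_one_iff)
    show "- (q powi j) * (q ^ m) powi n \<noteq> 1" for n
    proof
      assume "- (q powi j) * (q ^ m) powi n = 1"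
      then have "norm (- (q powi j) * (q ^ m) powi n) = 1" by simp
      then have "norm (q powi (int m * n + j)) = 1"
        using assms(2) by (simp add: power_powi power_int_add norm_mult mult.commute)
      then show False using powi_neq_1[OF assms(1,2,5)] by simp
    qed
  qed (use assms in auto)
  then show ?thesis using assms(2) by (simp add: power_powi power_int_add mult.commute)
qed

text \<open>The common properties of \<open>th\<close> and \<open>th9\<close>, so that the Lambert
  lemmas serve both. Decay is asked for every shift because \<open>lift3\<close> combines shifted
  copies.\<close>

definition theta_type :: "complex \<Rightarrow> (int \<Rightarrow> complex) \<Rightarrow> bool" where
  "theta_type q g \<longleftrightarrow> (\<forall>j. gauss_bounded (\<lambda>n. g (n + j))) \<and> (\<forall>n. g (- n) = g n) \<and> (\<forall>n. g (n + 3) = - (q powi (6 * n + 9) * g n))"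

lemma theta_type_th: "norm q < 1 \<Longrightarrow> q \<noteq> 0 \<Longrightarrow> theta_type q (th q)"
  by (simp add: theta_type_def gauss_bounded_th th_minus th_add3)

lemma theta_type_th9: "norm q < 1 \<Longrightarrow> q \<noteq> 0 \<Longrightarrow> theta_type q (th9 q)"
  by (simp add: theta_type_def gauss_bounded_th9 th9_minus th9_add3)

lemma theta_type_shift:
  assumes "theta_type q g" "q \<noteq> 0"
  shows "g (n + 1) = - (q powi (6 * n - 3) * g (n - 2))" "g (n + 2) = - (q powi (6 * n + 3) * g (n - 1))"
    "g n = - (q powi (6 * n - 9) * g (n - 3))"
proof -
  have *: "g (m + 3) = - (q powi (6 * m + 9) * g m)" for m using assms by (simp add: theta_type_def)
  show "g (n + 1) = - (q powi (6 * n - 3) * g (n - 2))" using *[of "n - 2"] by (simp add: algebra_simps)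
  show "g (n + 2) = - (q powi (6 * n + 3) * g (n - 1))" using *[of "n - 1"] by (simp add: algebra_simps)
  show "g n = - (q powi (6 * n - 9) * g (n - 3))" using *[of "n - 3"] by (simp add: algebra_simps)
qed

text \<open>Expanding the fraction at 1 - n by q^(6n-3) restores the denominator at n. By evenness
  and the three-step recursion the values f(n-1), f(n-2), f(n-3) turn into f(n+2), f(n+1), f(n),
  each with sign -1.\<close>

lemma lambert_reflect:
  assumes "norm q < 1" "q \<noteq> 0" "theta_type q f"
  shows "lambert q f (1 - n) = - lambert q f n"
proof -
  have sym: "f (- m) = f m" for m using assms(3) by (simp add: theta_type_def)
  have "lift3 q f (1 - n) = f (n - 1) + q powi (-2) * f (n - 2) + q powi (-6) * f (n - 3)"
    using sym[of "n - 1"] sym[of "n - 2"] sym[of "n - 3"] by (simp add: lift3_def algebra_simps)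
  moreover have "q powi (6 * n - 3) * f (n - 1) = - (q powi (-6) * f (n + 2))"
    unfolding theta_type_shift(2)[OF assms(3,2)] using assms(2) by (simp flip: power_int_add mult.assoc)
  moreover have "q powi (6 * n - 3) * (q powi (-2) * f (n - 2)) = - (q powi (-2) * f (n + 1))"
    unfolding theta_type_shift(1)[OF assms(3,2)] by (simp add: mult_ac)
  moreover have "q powi (6 * n - 3) * (q powi (-6) * f (n - 3)) = - f n"
    unfolding theta_type_shift(3)[OF assms(3,2), of n] using assms(2) by (simp flip: power_int_add mult.assoc)
  ultimately have 1: "q powi (6 * n - 3) * lift3 q f (1 - n) = - lift3 q f n"
    by (simp add: distrib_left lift3_def)
  have 2: "q powi (6 * n - 3) * (1 + q powi (6 * (1 - n) - 3)) = 1 + q powi (6 * n - 3)"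
    using assms(2) by (simp add: distrib_left flip: power_int_add)
  have "lambert q f (1 - n) = (q powi (6 * n - 3) * lift3 q f (1 - n)) / (q powi (6 * n - 3) * (1 + q powi (6 * (1 - n) - 3)))"
    using assms(2) by (simp add: lambert_def)
  then show ?thesis unfolding 1 2 by (simp add: lambert_def)
qed

lemma theta_type_gauss: "theta_type q g \<Longrightarrow> gauss_bounded (\<lambda>n. g (n + j))" "theta_type q g \<Longrightarrow> gauss_bounded g"
  unfolding theta_type_def by blast (metis (no_types, lifting) add.right_neutral ext)

lemma gauss_bounded_lift3:
  assumes "theta_type q g"
  shows "gauss_bounded (lift3 q g)"
  unfolding lift3_def[abs_def] by (intro gauss_bounded_add gauss_bounded_cmult theta_type_gauss[OF assms])

lemma gauss_bounded_lambert:
  assumes "norm q < 1" "q \<noteq> 0" "theta_type q g"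
  shows "gauss_bounded (lambert q g)"
proof -
  have "int 6 * n + (- 3) \<noteq> 0" for n :: int by presburger
  from gauss_bounded_pole_plus[OF assms(1,2) gauss_bounded_lift3[OF assms(3)] _ this]
  show ?thesis by (simp add: lambert_def[abs_def])
qed

lemma conv_lift3:
  assumes "gauss_bounded g" "theta_type q f"
  shows "conv g (lift3 q f) n = conv g f n + q powi (-2) * conv g f (n + 1) + q powi (-6) * conv g f (n + 2)"
proof -
  have s: "(\<lambda>i. g i * f (m - i)) summable_on UNIV" for m
    by (intro conv_summable gauss_bounded_abs_summable assms theta_type_gauss(2)[OF assms(2)])
  have "conv g (lift3 q f) n = (\<Sum>\<^sub>\<infinity>i. g i * f (n - i) + q powi (-2) * (g i * f (n + 1 - i)) + q powi (-6) * (g i * f (n + 2 - i)))"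
    unfolding conv_def lift3_def by (simp add: algebra_simps)
  also have "\<dots> = conv g f n + q powi (-2) * conv g f (n + 1) + q powi (-6) * conv g f (n + 2)"
    unfolding conv_def
    by (simp only: infsum_add infsum_cmult_right' summable_on_add summable_on_cmult_right s)
  finally show ?thesis .
qed

text \<open>After a shift of the summation index by 3, the recursion of g turns q^(6n+6) g(i) into
  -q^(6(n-i)-3) g(i+3), and the denominator of \<open>lambert\<close> cancels. By
  \<open>conv_lift3\<close> the remainder depends only on \<open>conv g f\<close>.\<close>

lemma conv_lambert_add3:
  assumes "norm q < 1" "q \<noteq> 0" "theta_type q g" "theta_type q f"
  shows "conv g (lambert q f) (n + 3) - q powi (6 * n + 6) * conv g (lambert q f) n = conv g (lift3 q f) (n + 3)"
proof -
  have s: "(\<lambda>i. g i * lambert q f (m - i)) summable_on UNIV" for m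
    by (intro conv_summable gauss_bounded_abs_summable gauss_bounded_lambert theta_type_gauss(2)[OF assms(3)] assms)
  have sh: "(\<lambda>i. g (i + 3) * lambert q f (n - i)) summable_on UNIV"
    using s[of "n + 3"] summable_on_int_shift[of "\<lambda>i. g i * lambert q f (n + 3 - i)" 3] by simp
  have "conv g (lambert q f) (n + 3) = (\<Sum>\<^sub>\<infinity>i. g (i + 3) * lambert q f (n - i))"
    using infsum_int_shift[of "\<lambda>i. g i * lambert q f (n + 3 - i)" 3] by (simp add: conv_def)
  then have "conv g (lambert q f) (n + 3) - q powi (6 * n + 6) * conv g (lambert q f) n =
      (\<Sum>\<^sub>\<infinity>i. g (i + 3) * lambert q f (n - i)) - (\<Sum>\<^sub>\<infinity>i. q powi (6 * n + 6) * (g i * lambert q f (n - i)))"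
    by (simp only: conv_def infsum_cmult_right')
  also have "\<dots> = (\<Sum>\<^sub>\<infinity>i. g (i + 3) * lambert q f (n - i) - q powi (6 * n + 6) * (g i * lambert q f (n - i)))"
    by (rule infsum_diff[symmetric]) (intro sh summable_on_cmult_right s)+
  also have "\<dots> = (\<Sum>\<^sub>\<infinity>i. g (i + 3) * lift3 q f (n - i))"
  proof (rule infsum_cong)
    fix i
    have nz: "1 + q powi (6 * (n - i) - 3) \<noteq> 0"
      by (rule one_plus_powi_nonzero[OF assms(1,2)]) presburger
    have "q powi (6 * n + 6) * g i = - (q powi (6 * (n - i) - 3) * g (i + 3))"
      using assms(2,3) by (simp add: theta_type_def flip: power_int_add mult.assoc)
    then have "g (i + 3) * lambert q f (n - i) - q powi (6 * n + 6) * (g i * lambert q f (n - i)) =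
        g (i + 3) * lambert q f (n - i) - - (q powi (6 * (n - i) - 3) * g (i + 3)) * lambert q f (n - i)"
      by (simp only: mult.assoc[symmetric])
    also have "\<dots> = g (i + 3) * (lambert q f (n - i) * (1 + q powi (6 * (n - i) - 3)))"
      by algebra
    also have "lambert q f (n - i) * (1 + q powi (6 * (n - i) - 3)) = lift3 q f (n - i)"
      using nz by (simp add: lambert_def)
    finally show "g (i + 3) * lambert q f (n - i) - q powi (6 * n + 6) * (g i * lambert q f (n - i)) =
        g (i + 3) * lift3 q f (n - i)" .
  qed
  also have "\<dots> = conv g (lift3 q f) (n + 3)"
    using infsum_int_shift[of "\<lambda>i. g i * lift3 q f (n + 3 - i)" 3] by (simp add: conv_def)
  finally show ?thesis .
qed

lemma conv_reflect:
  assumes "\<And>n. g (- n) = g n" "\<And>n. f (1 - n) = - f n"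
  shows "conv g f (1 - n) = - conv g f n"
proof -
  have e: "f (1 - n - i) = - f (n - - i)" for i
    using assms(2)[of "n + i"] by (simp add: algebra_simps)
  have "conv g f (1 - n) = (\<Sum>\<^sub>\<infinity>i. - (g (- i) * f (n - - i)))"
    unfolding conv_def e assms(1) by simp
  also have "\<dots> = - conv g f n"
    unfolding conv_def infsum_uminus using infsum_int_reflect[of "\<lambda>i. g i * f (n - i)" 0] by simp
  finally show ?thesis .
qed

definition hdiff :: "complex \<Rightarrow> int \<Rightarrow> complex" where
  "hdiff q n = conv (th9 q) (lambert q (th q)) n - conv (th q) (lambert q (th9 q)) n"

text \<open>The inhomogeneous terms of the two recursions are the same combination of shifts of the
  symmetric convolution of \<open>th\<close> and \<open>th9\<close>, so they cancel. This is the
  point of pairing each sequence with the Lambert coefficients of the other.\<close>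

lemma hdiff_add3:
  assumes "norm q < 1" "q \<noteq> 0"
  shows "hdiff q (n + 3) = q powi (6 * n + 6) * hdiff q n"
proof -
  note g = theta_type_th[OF assms] theta_type_th9[OF assms]
  have "conv (th9 q) (lift3 q (th q)) (n + 3) = conv (th q) (lift3 q (th9 q)) (n + 3)"
    unfolding conv_lift3[OF theta_type_gauss(2)[OF g(2)] g(1)] conv_lift3[OF theta_type_gauss(2)[OF g(1)] g(2)]
    by (simp only: conv_commute[of "th9 q" "th q"])
  then have "conv (th9 q) (lambert q (th q)) (n + 3) - q powi (6 * n + 6) * conv (th9 q) (lambert q (th q)) n =
      conv (th q) (lambert q (th9 q)) (n + 3) - q powi (6 * n + 6) * conv (th q) (lambert q (th9 q)) n"
    unfolding conv_lambert_add3[OF assms g(2,1)] conv_lambert_add3[OF assms g(1,2)] .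
  then show ?thesis by (simp add: hdiff_def algebra_simps)
qed

lemma hdiff_reflect:
  assumes "norm q < 1" "q \<noteq> 0"
  shows "hdiff q (1 - n) = - hdiff q n"
  unfolding hdiff_def
  by (subst (1 2) conv_reflect)
    (simp_all add: th_minus th9_minus lambert_reflect[OF assms] theta_type_th[OF assms] theta_type_th9[OF assms])

text \<open>\<open>wcoeff q\<close> are the coefficients of the theta product
  \<open>theta (q^6 Y^2) (q^12) * theta Y (q^6)\<close> in \<open>Y\<close>.\<close>

definition even_part :: "complex \<Rightarrow> int \<Rightarrow> complex" where
  "even_part q n = (if even n then (-1) powi (n div 2) * q powi (6 * (n div 2)\<^sup>2) else 0)"

definition wcoeff :: "complex \<Rightarrow> int \<Rightarrow> complex" where
  "wcoeff q = conv (even_part q) (tcoeff (q ^ 6))"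

lemma even_part_add2:
  assumes "q \<noteq> 0"
  shows "even_part q (n + 2) = - (q powi (6 * n + 6) * even_part q n)"
proof (cases "even n")
  case True
  then obtain i where n: "n = 2 * i" by blast
  have "(2 * i + 2) div 2 = i + 1" by simp
  moreover have "6 * (i + 1)\<^sup>2 = 6 * i\<^sup>2 + (6 * (2 * i) + 6)" by (simp add: power2_eq_square algebra_simps)
  ultimately show ?thesis using assms by (simp add: n even_part_def power_int_add)
qed (simp add: even_part_def)

lemma even_part_minus: "even_part q (- n) = even_part q n"
proof (cases "even n")
  case True
  then obtain i where n: "n = 2 * i" by blast
  have "- (2 * i) div 2 = - i" by simp
  then show ?thesis by (simp add: n even_part_def power_int_minus_left)
qed (simp add: even_part_def)

text \<open>The shift by 3 is divided into 2 for \<open>even_part\<close> and 1 for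
  \<open>tcoeff\<close>. Their factors -q^(6i+6) and -q^(6(n-i)) multiply to q^(6n+6), independently
  of i; the two theta functions are chosen for this.\<close>

lemma wcoeff_add3:
  assumes "q \<noteq> 0"
  shows "wcoeff q (n + 3) = q powi (6 * n + 6) * wcoeff q n"
proof -
  have q6: "q ^ 6 \<noteq> 0" using assms by simp
  have "wcoeff q (n + 3) = (\<Sum>\<^sub>\<infinity>i. even_part q (i + 2) * tcoeff (q ^ 6) (n - i + 1))"
    using infsum_int_shift[of "\<lambda>i. even_part q i * tcoeff (q ^ 6) (n + 3 - i)" 2]
    by (simp add: wcoeff_def conv_def algebra_simps)
  also have "\<dots> = (\<Sum>\<^sub>\<infinity>i. q powi (6 * n + 6) * (even_part q i * tcoeff (q ^ 6) (n - i)))"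
  proof (rule infsum_cong)
    fix i
    have e: "6 * i + 6 + 6 * (n - i) = 6 * n + 6" by simp
    have "q powi (6 * i + 6) * q powi (6 * (n - i)) = q powi (6 * i + 6 + 6 * (n - i))"
      by (rule power_int_add[symmetric]) (use assms in simp)
    then have "q powi (6 * i + 6) * q powi (6 * (n - i)) = q powi (6 * n + 6)"
      unfolding e .
    then show "even_part q (i + 2) * tcoeff (q ^ 6) (n - i + 1) = q powi (6 * n + 6) * (even_part q i * tcoeff (q ^ 6) (n - i))"
      unfolding even_part_add2[OF assms] tcoeff_Suc[OF q6] power_powi by (simp add: mult_ac)
  qed
  finally show ?thesis by (simp only: infsum_cmult_right' wcoeff_def conv_def)
qed

lemma wcoeff_reflect: "wcoeff q (1 - n) = - wcoeff q n"
  unfolding wcoeff_def by (rule conv_reflect) (simp_all add: even_part_minus tcoeff_reflect)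

text \<open>The reflection gives h(0) = -h(1). At n = -1 the recursion has exponent 0, so h(2) =
  h(-1) = -h(2). Hence h(1) determines all values.\<close>

lemma antisymmetric_recursion_unique:
  fixes h w :: "int \<Rightarrow> complex"
  assumes "q \<noteq> 0" "\<And>n. h (n + 3) = q powi (6 * n + 6) * h n" "\<And>n. h (1 - n) = - h n" "h 1 = 0"
  shows "h n = 0"
proof -
  have h0: "h 0 = 0" using assms(3)[of 0] assms(4) by simp
  have "h 2 = h (- 1)" using assms(2)[of "- 1"] by simp
  moreover have "h (- 1) = - h 2" using assms(3)[of 2] by simp
  ultimately have h2: "h 2 = 0" by simp
  have iff: "h (n + 3) = 0 \<longleftrightarrow> h n = 0" for n using assms(1) by (simp add: assms(2))
  have "h (r + 3 * m) = 0 \<longleftrightarrow> h r = 0" for r m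
  proof (induction m rule: int_induct[where k = 0])
    case (step1 i) then show ?case using iff[of "r + 3 * i"] by (simp add: algebra_simps)
  next
    case (step2 i) then show ?case using iff[of "r + 3 * (i - 1)"] by (simp add: algebra_simps)
  qed simp
  from this[of "n mod 3" "n div 3"] have "h n = 0 \<longleftrightarrow> h (n mod 3) = 0" by simp
  moreover have "n mod 3 = 0 \<or> n mod 3 = 1 \<or> n mod 3 = 2" by presburger
  ultimately show ?thesis using h0 h2 assms(4) by auto
qed

text \<open>The cross combination of the two sequences inherits the recursion and the reflection,
  and vanishes at n = 1 by construction.\<close>

lemma hdiff_wcoeff:
  assumes "norm q < 1" "q \<noteq> 0"
  shows "hdiff q n * wcoeff q 1 = wcoeff q n * hdiff q 1"
proof -
  have "hdiff q n * wcoeff q 1 - wcoeff q n * hdiff q 1 = 0"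
    by (rule antisymmetric_recursion_unique[where h = "\<lambda>n. hdiff q n * wcoeff q 1 - wcoeff q n * hdiff q 1", OF assms(2)])
      (simp_all add: hdiff_add3[OF assms] wcoeff_add3[OF assms(2)] hdiff_reflect[OF assms] wcoeff_reflect algebra_simps)
  then show ?thesis by simp
qed

subsection \<open>Product evaluations\<close>

lemma norm_power_less_1: "norm q < 1 \<Longrightarrow> 0 < k \<Longrightarrow> norm (q ^ k) < 1" for q :: complex
  by (simp add: norm_power power_less_one_iff)

lemma J_nonzero: "norm q < 1 \<Longrightarrow> 0 < k \<Longrightarrow> J k q \<noteq> 0"
  unfolding J_eq_qprod by (intro qprod_nonzero_norm norm_power_less_1)

lemma tcoeff_even_power:
  "tcoeff (q ^ (2 * m)) n = (-1) powi n * q powi (int m * (n\<^sup>2 - n))"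
proof -
  have "int (2 * m) * (n * (n - 1) div 2) = int m * (2 * (n * (n - 1) div 2))" by (simp only: of_nat_mult mult_ac of_nat_numeral)
  also have "2 * (n * (n - 1) div 2) = n\<^sup>2 - n" by (simp add: power2_eq_square algebra_simps)
  finally show ?thesis by (simp only: tcoeff_def power_powi)
qed

lemma infsum_th_powi:
  assumes "q \<noteq> 0" "z \<noteq> 0"
  shows "(\<Sum>\<^sub>\<infinity>n. th q n * z powi n) = theta (q * z) (q\<^sup>2)"
  unfolding theta_def
proof (rule infsum_cong)
  fix n
  show "th q n * z powi n = tcoeff (q\<^sup>2) n * (q * z) powi n"
    using tcoeff_even_power[of q 1 n] assms by (simp add: th_def power_int_mult_distrib power_int_diff)
qed

lemma infsum_th: "q \<noteq> 0 \<Longrightarrow> infsum (th q) UNIV = theta q (q\<^sup>2)"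
  using infsum_th_powi[of q 1] by simp

lemma infsum_th9_powi:
  assumes "q \<noteq> 0"
  shows "(\<Sum>\<^sub>\<infinity>n. th9 q n * q powi n) = theta (q ^ 12) (q ^ 18)"
proof -
  have "(\<Sum>\<^sub>\<infinity>n. th9 q n * q powi n) = (\<Sum>\<^sub>\<infinity>k. th9 q (3 * k) * q powi (3 * k))"
    by (rule infsum_int_multiples) (auto simp: th9_def)
  also have "\<dots> = theta (q ^ 12) (q ^ 18)"
    unfolding theta_def
  proof (rule infsum_cong)
    fix k
    have "(-1) powi (3 * k) = ((-1) powi k :: complex)" by (simp add: power_int_minus_left)
    moreover have "q powi ((3 * k)\<^sup>2) * q powi (3 * k) = q powi (9 * (k\<^sup>2 - k)) * q powi (12 * k)"
      using assms by (simp add: power2_eq_square algebra_simps flip: power_int_add)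
    ultimately show "th9 q (3 * k) * q powi (3 * k) = tcoeff (q ^ 18) k * (q ^ 12) powi k"
      using tcoeff_even_power[of q 9 k] by (simp add: th9_def th_def power_powi)
  qed
  finally show ?thesis .
qed

lemma infsum_even_part_powi:
  assumes "q \<noteq> 0" "z \<noteq> 0"
  shows "(\<Sum>\<^sub>\<infinity>n. even_part q n * z powi n) = theta (q ^ 6 * z\<^sup>2) (q ^ 12)"
proof -
  have "(\<Sum>\<^sub>\<infinity>n. even_part q n * z powi n) = (\<Sum>\<^sub>\<infinity>k. even_part q (2 * k) * z powi (2 * k))"
    by (rule infsum_int_multiples) (auto simp: even_part_def)
  also have "\<dots> = theta (q ^ 6 * z\<^sup>2) (q ^ 12)"
    unfolding theta_def
  proof (rule infsum_cong)
    fix k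
    have "q powi (6 * k\<^sup>2) = q powi (6 * (k\<^sup>2 - k)) * q powi (6 * k)"
      using assms by (simp add: algebra_simps flip: power_int_add)
    then show "even_part q (2 * k) * z powi (2 * k) = tcoeff (q ^ 12) k * (q ^ 6 * z\<^sup>2) powi k"
      using tcoeff_even_power[of q 6 k] by (simp add: even_part_def power_int_mult_distrib power_powi)
  qed
  finally show ?thesis .
qed

lemma gauss_bounded_even_part:
  assumes "norm q < 1"
  shows "gauss_bounded (even_part q)"
proof -
  have "norm (even_part q s) \<le> 1 * norm q ^ nat (s\<^sup>2) * 1 ^ nat \<bar>s\<bar>" for s
  proof (cases "even s")
    case True
    then obtain i where s: "s = 2 * i" by blast
    have "nat (s\<^sup>2) \<le> nat (6 * i\<^sup>2)" by (rule nat_mono) (simp add: s power2_eq_square)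
    then have "norm q ^ nat (6 * i\<^sup>2) \<le> norm q ^ nat (s\<^sup>2)"
      using assms by (intro power_decreasing) auto
    then show ?thesis
      by (simp add: even_part_def s norm_mult norm_power_int power_int_def[of _ "6 * i\<^sup>2"] norm_power)
  qed (simp add: even_part_def)
  then show ?thesis unfolding gauss_bounded_def using assms
    by (intro exI[of _ "norm q"] exI[of _ 1] exI[of _ 1]) auto
qed

lemma infsum_antisymmetric:
  fixes f :: "int \<Rightarrow> complex"
  assumes "\<And>n. f (1 - n) = - f n"
  shows "infsum f UNIV = 0"
proof -
  have "infsum f UNIV = (\<Sum>\<^sub>\<infinity>n. f (1 - n))" by (rule infsum_int_reflect[symmetric])
  also have "\<dots> = - infsum f UNIV" unfolding assms by (rule infsum_uminus)
  finally show ?thesis by simp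
qed

lemma infsum_conv_gauss:
  assumes "gauss_bounded f" "gauss_bounded g" "z \<noteq> 0"
  shows "(\<lambda>n. conv f g n * z powi n) summable_on UNIV"
    and "(\<Sum>\<^sub>\<infinity>n. conv f g n * z powi n) = (\<Sum>\<^sub>\<infinity>n. f n * z powi n) * (\<Sum>\<^sub>\<infinity>n. g n * z powi n)"
    and "(\<lambda>n. of_int n * conv f g n) summable_on UNIV"
    and "(\<Sum>\<^sub>\<infinity>n. of_int n * conv f g n) =
      (\<Sum>\<^sub>\<infinity>n. of_int n * f n) * infsum g UNIV + infsum f UNIV * (\<Sum>\<^sub>\<infinity>n. of_int n * g n)"
proof -
  note a = gauss_bounded_abs_summable[OF gauss_bounded_mult_powi[OF assms(1,3)]]
    gauss_bounded_abs_summable[OF gauss_bounded_mult_powi[OF assms(2,3)]]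
  note b = assms(1,2)[THEN gauss_bounded_abs_summable]
    assms(1,2)[THEN gauss_bounded_mult_of_int, THEN gauss_bounded_abs_summable]
  show "(\<Sum>\<^sub>\<infinity>n. conv f g n * z powi n) = (\<Sum>\<^sub>\<infinity>n. f n * z powi n) * (\<Sum>\<^sub>\<infinity>n. g n * z powi n)"
    by (rule infsum_conv_powi[OF assms(3) a])
  show "(\<lambda>n. conv f g n * z powi n) summable_on UNIV"
    using abs_summable_summable[OF conv_abs_summable[OF a]] by (simp add: conv_powi[OF assms(3), abs_def])
  show "(\<Sum>\<^sub>\<infinity>n. of_int n * conv f g n) =
      (\<Sum>\<^sub>\<infinity>n. of_int n * f n) * infsum g UNIV + infsum f UNIV * (\<Sum>\<^sub>\<infinity>n. of_int n * g n)"
    by (rule infsum_conv_weight[OF b])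
  show "(\<lambda>n. of_int n * conv f g n) summable_on UNIV"
    unfolding conv_weight[OF b]
    by (intro summable_on_add; rule abs_summable_summable; rule conv_abs_summable; fact b)
qed

definition hderiv :: "complex \<Rightarrow> complex" where
  "hderiv q = (\<Sum>\<^sub>\<infinity>n. of_int n * hdiff q n)"

text \<open>Both Lambert series vanish at Y = 1 by antisymmetry, so the product rule keeps only the
  terms with their derivatives.\<close>

lemma hderiv_eq:
  assumes "norm q < 1" "q \<noteq> 0"
  shows "hderiv q = infsum (th9 q) UNIV * (\<Sum>\<^sub>\<infinity>n. of_int n * lambert q (th q) n)
    - infsum (th q) UNIV * (\<Sum>\<^sub>\<infinity>n. of_int n * lambert q (th9 q) n)"
proof -
  note g = theta_type_th[OF assms] theta_type_th9[OF assms]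
  note l = g[THEN gauss_bounded_lambert[OF assms]]
  note g' = g[THEN theta_type_gauss(2)]
  have z: "infsum (lambert q (th q)) UNIV = 0" "infsum (lambert q (th9 q)) UNIV = 0"
    by (intro infsum_antisymmetric lambert_reflect assms g)+
  have "hderiv q = (\<Sum>\<^sub>\<infinity>n. of_int n * conv (th9 q) (lambert q (th q)) n)
      - (\<Sum>\<^sub>\<infinity>n. of_int n * conv (th q) (lambert q (th9 q)) n)"
    unfolding hderiv_def hdiff_def right_diff_distrib
    by (rule infsum_diff) (intro infsum_conv_gauss(3)[where z = 1] g' l one_neq_zero)+
  then show ?thesis
    by (simp add: infsum_conv_gauss(4)[OF g'(2) l(1) one_neq_zero] infsum_conv_gauss(4)[OF g'(1) l(2) one_neq_zero] z)
qed

text \<open>At Y = q the argument of the Appell sum equals its base q^2, which is the case that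
  \<open>appell_mult_theta\<close> evaluates.\<close>

lemma infsum_lambert_th_powi:
  assumes "norm q < 1" "q \<noteq> 0"
  shows "(\<Sum>\<^sub>\<infinity>n. lambert q (th q) n * q powi n) = appell (q\<^sup>2) (- inverse q) (q\<^sup>2)"
  unfolding appell_def lambert_th[OF assms]
proof (rule infsum_cong)
  fix n
  have "th q n * q powi n = tcoeff (q\<^sup>2) n * (q\<^sup>2) powi n"
  proof -
    have "q powi (n\<^sup>2) * q powi n = q powi (n\<^sup>2 - n) * q powi (2 * n)"
    proof -
      have "q powi (2 * n) = q powi n * q powi n"
        unfolding mult_2 by (rule power_int_add) (use assms(2) in simp)
      moreover have "q powi ((n\<^sup>2 - n) + n) = q powi (n\<^sup>2 - n) * q powi n"
        by (rule power_int_add) (use assms(2) in simp)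
      ultimately show ?thesis by simp
    qed
    then show ?thesis
      using tcoeff_even_power[of q 1 n] by (simp add: th_def power_powi[of q 2, simplified])
  qed
  moreover have "q powi (2 * n - 1) = inverse q * (q\<^sup>2) powi n"
    using assms(2) by (simp add: power_int_diff power_powi[of q 2, simplified] divide_inverse mult.commute)
  ultimately show "th q n / (1 + q powi (2 * n - 1)) * q powi n =
      tcoeff (q\<^sup>2) n * (q\<^sup>2) powi n / (1 - - inverse q * (q\<^sup>2) powi n)"
    by simp
qed

text \<open>The theta series takes the value theta(q^2; q^2) = 0 at Y = q, which removes the unknown
  Lambert series of \<open>th9\<close>.\<close>

lemma hdiff_at_q:
  assumes "norm q < 1" "q \<noteq> 0"
  shows "(\<Sum>\<^sub>\<infinity>n. hdiff q n * q powi n) = theta (q ^ 12) (q ^ 18) * appell (q\<^sup>2) (- inverse q) (q\<^sup>2)"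
proof -
  note g = theta_type_th[OF assms] theta_type_th9[OF assms]
  note l = g[THEN gauss_bounded_lambert[OF assms]]
  note g' = g[THEN theta_type_gauss(2)]
  have "(\<Sum>\<^sub>\<infinity>n. hdiff q n * q powi n) = (\<Sum>\<^sub>\<infinity>n. conv (th9 q) (lambert q (th q)) n * q powi n)
      - (\<Sum>\<^sub>\<infinity>n. conv (th q) (lambert q (th9 q)) n * q powi n)"
    unfolding hdiff_def left_diff_distrib
    by (rule infsum_diff) (intro infsum_conv_gauss(1) g' l assms)+
  also have "(\<Sum>\<^sub>\<infinity>n. conv (th q) (lambert q (th9 q)) n * q powi n) = 0"
    unfolding infsum_conv_gauss(2)[OF g'(1) l(2) assms(2)] infsum_th_powi[OF assms(2,2)]
    using theta_q_powi[of "q\<^sup>2" 1] assms(2) by (simp add: power2_eq_square)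
  finally show ?thesis
    by (simp add: infsum_conv_gauss(2)[OF g'(2) l(1) assms(2)] infsum_th9_powi assms infsum_lambert_th_powi)
qed

lemma wcoeff_at:
  assumes "norm q < 1" "q \<noteq> 0" "z \<noteq> 0"
  shows "(\<Sum>\<^sub>\<infinity>n. wcoeff q n * z powi n) = theta (q ^ 6 * z\<^sup>2) (q ^ 12) * theta z (q ^ 6)"
  unfolding wcoeff_def
  by (subst infsum_conv_gauss(2))
    (use assms norm_power_less_1[of q 6] in \<open>auto intro!: gauss_bounded_even_part gauss_bounded_tcoeff
       simp: infsum_even_part_powi theta_def\<close>)

lemma wcoeff_deriv:
  assumes "norm q < 1" "q \<noteq> 0"
  shows "(\<Sum>\<^sub>\<infinity>n. of_int n * wcoeff q n) = - (theta (q ^ 6) (q ^ 12) * J 6 q ^ 3)"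
proof -
  have q6: "norm (q ^ 6) < 1" "q ^ 6 \<noteq> 0" using assms norm_power_less_1[of q 6] by auto
  have t: "infsum (tcoeff (q ^ 6)) UNIV = 0"
    by (rule infsum_antisymmetric) (rule tcoeff_reflect)
  have e: "infsum (even_part q) UNIV = theta (q ^ 6) (q ^ 12)"
    using infsum_even_part_powi[OF assms(2), of 1] by simp
  show ?thesis
    unfolding wcoeff_def
      infsum_conv_gauss(4)[OF gauss_bounded_even_part[OF assms(1)] gauss_bounded_tcoeff[OF q6] one_neq_zero]
      jacobi_derivative[OF q6] t e J_eq_qprod by simp
qed

lemma theta_nonzero:
  assumes "norm q < 1" "q \<noteq> 0" "norm q < norm b" "norm b < 1"
  shows "theta b q \<noteq> 0"
proof -
  have "b \<noteq> 0" "norm (q / b) < 1" using assms by (auto simp: norm_divide divide_less_eq)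
  then show ?thesis using assms
    by (simp add: jacobi_triple_product qprod_nonzero_norm)
qed

lemma norm_power_strict_decreasing:
  fixes q :: complex
  shows "norm q < 1 \<Longrightarrow> q \<noteq> 0 \<Longrightarrow> m < n \<Longrightarrow> norm (q ^ n) < norm (q ^ m)"
  by (simp add: norm_power power_strict_decreasing)

lemma theta_power_nonzero:
  assumes "norm q < 1" "q \<noteq> 0" "0 < i" "i < m"
  shows "theta (q ^ i) (q ^ m) \<noteq> 0"
  using norm_power_strict_decreasing[OF assms(1,2,4)] assms
  by (intro theta_nonzero norm_power_less_1) auto

text \<open>\<open>hdiff\<close> and \<open>wcoeff\<close> are proportional, so the ratio of the
  derivative at Y = 1 to the value at Y = q agrees for both. For \<open>wcoeff\<close> both numbers
  are explicit products.\<close>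

lemma hderiv_theta:
  assumes "norm q < 1" "q \<noteq> 0"
  shows "hderiv q * (theta (q ^ 8) (q ^ 12) * theta q (q ^ 6)) =
    - (theta (q ^ 12) (q ^ 18) * appell (q\<^sup>2) (- inverse q) (q\<^sup>2) * (theta (q ^ 6) (q ^ 12) * J 6 q ^ 3))"
proof -
  have W: "(\<Sum>\<^sub>\<infinity>n. wcoeff q n * q powi n) = theta (q ^ 8) (q ^ 12) * theta q (q ^ 6)"
    using wcoeff_at[OF assms assms(2)] by (simp flip: power_add)
  have "theta (q ^ 8) (q ^ 12) \<noteq> 0" "theta q (q ^ 6) \<noteq> 0"
    using theta_power_nonzero[OF assms, of 8 12] theta_power_nonzero[OF assms, of 1 6] by simp_all
  then have "(\<Sum>\<^sub>\<infinity>n. wcoeff q n * q powi n) \<noteq> 0" unfolding W by simp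
  \<comment> \<open>If \<open>wcoeff q 1\<close> were 0, all coefficients would vanish,
    contradicting the nonzero value at Y = q.\<close>
  then have w1: "wcoeff q 1 \<noteq> 0"
    using antisymmetric_recursion_unique[OF assms(2) wcoeff_add3[OF assms(2)] wcoeff_reflect] by auto
  have h: "hdiff q n = wcoeff q n * (hdiff q 1 / wcoeff q 1)" for n
    using hdiff_wcoeff[OF assms, of n] w1 by (simp add: field_simps)
  have h1: "hdiff q n * q powi n = (wcoeff q n * q powi n) * (hdiff q 1 / wcoeff q 1)" for n
    unfolding h[of n] by (simp only: mult_ac)
  have h2: "of_int n * hdiff q n = (of_int n * wcoeff q n) * (hdiff q 1 / wcoeff q 1)" for n
    unfolding h[of n] by (simp only: mult_ac)
  have 1: "(\<Sum>\<^sub>\<infinity>n. hdiff q n * q powi n) = (\<Sum>\<^sub>\<infinity>n. wcoeff q n * q powi n) * (hdiff q 1 / wcoeff q 1)"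
    unfolding h1 by (rule infsum_cmult_left')
  have 2: "hderiv q = (\<Sum>\<^sub>\<infinity>n. of_int n * wcoeff q n) * (hdiff q 1 / wcoeff q 1)"
    unfolding hderiv_def h2 by (rule infsum_cmult_left')
  have "hderiv q * (\<Sum>\<^sub>\<infinity>n. wcoeff q n * q powi n) = (\<Sum>\<^sub>\<infinity>n. of_int n * wcoeff q n) * (\<Sum>\<^sub>\<infinity>n. hdiff q n * q powi n)"
    unfolding 1 2 by simp
  then show ?thesis unfolding W wcoeff_deriv[OF assms] hdiff_at_q[OF assms] by simp
qed

text \<open>Ramanujan's phi(q), the sum of q^(n^2) over all integers n.\<close>

definition phi :: "complex \<Rightarrow> complex" where
  "phi q = theta (- q) (q\<^sup>2)"

lemma appell_phi:
  assumes "norm q < 1" "q \<noteq> 0"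
  shows "appell (q\<^sup>2) (- inverse q) (q\<^sup>2) * phi q = q * J 2 q ^ 3"
proof -
  have q2: "norm (q\<^sup>2) < 1" "q\<^sup>2 \<noteq> 0" using assms norm_power_less_1[of q 2] by auto
  have "- inverse q * (q\<^sup>2) powi n \<noteq> 1" for n
  proof
    assume *: "- inverse q * (q\<^sup>2) powi n = 1"
    have "inverse q * (q\<^sup>2) powi n = q powi (2 * n - 1)"
      using assms(2) by (simp add: power_int_diff power_powi[of q 2, simplified] divide_inverse mult.commute)
    with * have "norm (q powi (2 * n - 1)) = 1" by (metis mult_minus_left norm_minus_cancel norm_one)
    moreover have "2 * n - 1 \<noteq> 0" by presburger
    ultimately show False using powi_neq_1[OF assms] by blast
  qed
  from appell_mult_theta[OF q2 _ this]
  have 1: "appell (q\<^sup>2) (- inverse q) (q\<^sup>2) * theta (- inverse q) (q\<^sup>2) = J 2 q ^ 3"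
    using assms(2) by (simp add: J_eq_qprod)
  have e: "- inverse q * q\<^sup>2 = - q" using assms(2) by (simp add: power2_eq_square)
  have "phi q = q * theta (- inverse q) (q\<^sup>2)"
    using theta_mult_q[OF q2(2), of "- inverse q"] assms(2) unfolding e phi_def
    by (simp add: field_simps)
  then show ?thesis using 1 by (simp add: mult_ac)
qed

section \<open>Theta values as quotients of the products \<open>J\<close>\<close>

lemma qprod_powers_split:
  assumes "norm q < 1" "0 < m" "0 < k"
  shows "qprod (c * q ^ j) (q ^ m) = (\<Prod>i<k. qprod (c * q ^ (j + m * i)) (q ^ (m * k)))"
  using qprod_split[OF norm_power_less_1[OF assms(1,2)] assms(3), of "c * q ^ j"]
  by (simp only: power_mult[symmetric] mult.assoc power_add[symmetric])

lemma theta_powers: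
  assumes "norm q < 1" "q \<noteq> 0" "c \<noteq> 0" "i \<le> m" "0 < m"
  shows "theta (c * q ^ i) (q ^ m) = qprod (c * q ^ i) (q ^ m) * qprod (inverse c * q ^ (m - i)) (q ^ m) * J m q"
  using jacobi_triple_product[OF norm_power_less_1[OF assms(1,5)], of "c * q ^ i"] assms
  by (simp add: J_eq_qprod power_diff field_simps)

lemma J_split2:
  assumes "norm q < 1" "0 < m"
  shows "J m q = qprod (q ^ m) (q ^ (2 * m)) * J (2 * m) q"
  using qprod_powers_split[OF assms, of 2 1 m]
  by (simp add: J_eq_qprod eval_nat_numeral mult.commute add.commute)

lemma J_split3:
  assumes "norm q < 1" "0 < m"
  shows "J m q = qprod (q ^ m) (q ^ (3 * m)) * qprod (q ^ (2 * m)) (q ^ (3 * m)) * J (3 * m) q"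
  using qprod_powers_split[OF assms, of 3 1 m]
  by (simp add: J_eq_qprod eval_nat_numeral algebra_simps)

lemma qprod_minus_J:
  assumes "norm q < 1" "0 < m"
  shows "qprod (- (q ^ m)) (q ^ m) * J m q = J (2 * m) q"
  using qprod_mult_uminus[OF norm_power_less_1[OF assms], of "q ^ m"]
  by (simp add: J_eq_qprod power_mult[symmetric] mult.commute)

lemma theta_J_square:
  assumes "norm q < 1" "q \<noteq> 0" "0 < m"
  shows "theta (q ^ m) (q ^ (2 * m)) * J (2 * m) q = J m q ^ 2"
  using theta_powers[OF assms(1,2), of 1 m "2 * m"] J_split2[OF assms(1,3)] assms(3)
  by (simp add: power2_eq_square mult_ac mult_2)

text \<open>The exponents congruent to m and 2m modulo 3m, together with the multiples of 3m,
  exhaust the multiples of m: the pentagonal number theorem.\<close>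

lemma theta_two_thirds:
  assumes "norm q < 1" "q \<noteq> 0" "0 < m"
  shows "theta (q ^ (2 * m)) (q ^ (3 * m)) = J m q"
  using theta_powers[OF assms(1,2), of 1 "2 * m" "3 * m"] J_split3[OF assms(1,3)] assms(3)
  by (simp add: mult_ac)

text \<open>Since \<open>theta q (q\<^sup>2)\<close> is phi(-q), this is phi(q) phi(-q) =
  phi(-q^2)^2 with the right side written as a quotient of \<open>J\<close>.\<close>

lemma phi_mult_theta:
  assumes "norm q < 1" "q \<noteq> 0"
  shows "phi q * theta q (q\<^sup>2) * J 4 q ^ 2 = J 2 q ^ 4"
proof -
  have t: "phi q = qprod (- q) (q\<^sup>2) ^ 2 * J 2 q" "theta q (q\<^sup>2) = qprod q (q\<^sup>2) ^ 2 * J 2 q"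
    using theta_powers[OF assms, of "- 1" 1 2] theta_powers[OF assms, of 1 1 2]
    by (simp_all add: phi_def power2_eq_square)
  have m: "qprod q (q\<^sup>2) * qprod (- q) (q\<^sup>2) = qprod (q\<^sup>2) (q ^ 4)"
    using qprod_mult_uminus[OF norm_power_less_1[OF assms(1), of 2], of q] by simp
  have j: "J 2 q = qprod (q\<^sup>2) (q ^ 4) * J 4 q" using J_split2[OF assms(1), of 2] by simp
  have "phi q * theta q (q\<^sup>2) * J 4 q ^ 2 = (qprod q (q\<^sup>2) * qprod (- q) (q\<^sup>2) * J 4 q) ^ 2 * J 2 q ^ 2"
    unfolding t by (simp add: power_mult_distrib mult_ac power2_eq_square)
  also have "\<dots> = J 2 q ^ 4" unfolding m j[symmetric] by (simp flip: power_add)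
  finally show ?thesis .
qed

lemma theta_minus_q4:
  assumes "norm q < 1" "q \<noteq> 0"
  shows "theta (- (q ^ 4)) (q ^ 6) * J 12 q * J 2 q = J 4 q * J 6 q ^ 2"
proof -
  have t: "theta (- (q ^ 4)) (q ^ 6) = qprod (- (q ^ 4)) (q ^ 6) * qprod (- (q\<^sup>2)) (q ^ 6) * J 6 q"
    using theta_powers[OF assms, of "- 1" 4 6] by simp
  have s: "qprod (- (q\<^sup>2)) (q\<^sup>2) = qprod (- (q\<^sup>2)) (q ^ 6) * qprod (- (q ^ 4)) (q ^ 6) * qprod (- (q ^ 6)) (q ^ 6)"
    using qprod_powers_split[OF assms(1), of 2 3 "- 1" 2] by (simp add: eval_nat_numeral)
  have "J 12 q = qprod (- (q ^ 6)) (q ^ 6) * J 6 q" "J 4 q = qprod (- (q\<^sup>2)) (q\<^sup>2) * J 2 q"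
    using qprod_minus_J[OF assms(1), of 6] qprod_minus_J[OF assms(1), of 2] by simp_all
  then show ?thesis unfolding t s by (simp add: power2_eq_square mult_ac)
qed

lemma kronecker_q3:
  assumes "norm q < 1" "q \<noteq> 0"
  shows "theta q (q ^ 6) * phi (q ^ 3) * kronecker_sum q (- (q ^ 3)) (q ^ 6) = J 6 q ^ 3 * theta (- (q ^ 4)) (q ^ 6)"
proof -
  have "int 6 * n + int 3 \<noteq> 0" for n :: int by presburger
  note ne = minus_power_powi_neq_1[OF assms this]
  from kronecker[OF norm_power_less_1[OF assms(1)] _ _ ne, of q]
  show ?thesis
    using norm_power_strict_decreasing[OF assms, of 1 6] assms by (simp add: phi_def J_eq_qprod flip: power_mult power_Suc)
qed

text \<open>\<open>hderiv_theta\<close> yields a pure product. Kronecker's identity with a = q, b =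
  -q^3 and base q^6 is applied in reverse, to trade this product for a Lambert series that separates
  modulo 3, with the value of theta at Y = 1 as a factor to be cancelled later.\<close>

theorem hderiv_kronecker:
  assumes "norm q < 1" "q \<noteq> 0"
  shows "- hderiv q = q * J 6 q * phi (q ^ 3) * kronecker_sum q (- (q ^ 3)) (q ^ 6) * infsum (th q) UNIV"
proof -
  define T where "T = theta q (q ^ 6)"
  have T: "T \<noteq> 0" using theta_power_nonzero[OF assms, of 1 6] by (simp add: T_def)
  define a where "a = appell (q\<^sup>2) (- inverse q) (q\<^sup>2)"
  define K where "K = kronecker_sum q (- (q ^ 3)) (q ^ 6)"
  define S where "S = theta q (q\<^sup>2)"
  define X where "X = theta (q ^ 6) (q ^ 12)"
  define Y where "Y = theta (- (q ^ 4)) (q ^ 6)"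
  have nz: "J 2 q \<noteq> 0" "J 4 q \<noteq> 0" "J 6 q \<noteq> 0" "J 12 q \<noteq> 0" by (simp_all add: J_nonzero assms(1))
  have t: "theta (q ^ 8) (q ^ 12) = J 4 q" "theta (q ^ 12) (q ^ 18) = J 6 q"
    using theta_two_thirds[OF assms, of 4] theta_two_thirds[OF assms, of 6] by simp_all
  have 1: "hderiv q * (J 4 q * T) = - (J 6 q * a * (X * J 6 q ^ 3))"
    using hderiv_theta[OF assms] unfolding t T_def a_def X_def .
  have 2: "a * phi q = q * J 2 q ^ 3" using appell_phi[OF assms] by (simp add: a_def)
  have 3: "X * J 12 q = J 6 q ^ 2" using theta_J_square[OF assms, of 6] by (simp add: X_def)
  have 4: "phi q * S * J 4 q ^ 2 = J 2 q ^ 4" using phi_mult_theta[OF assms] by (simp add: S_def)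
  have 5: "Y * J 12 q * J 2 q = J 4 q * J 6 q ^ 2" using theta_minus_q4[OF assms] by (simp add: Y_def)
  have 6: "T * phi (q ^ 3) * K = J 6 q ^ 3 * Y" using kronecker_q3[OF assms] by (simp add: T_def K_def Y_def)
  have phi: "phi q \<noteq> 0" using 4 nz by auto
  \<comment> \<open>Both sides are multiplied by one nonzero product, which clears denominators and
    groups the factors so that the evaluations 2 to 6 can be substituted.\<close>
  have "- hderiv q * (J 4 q * T) * (phi q * J 12 q * J 4 q) = J 6 q ^ 4 * (a * phi q) * (X * J 12 q) * J 4 q"
    using 1 by (simp add: algebra_simps eval_nat_numeral)
  also have "\<dots> = q * J 6 q ^ 6 * J 2 q ^ 3 * J 4 q"
    unfolding 2 3 by (simp add: algebra_simps eval_nat_numeral)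
  finally have L: "- hderiv q * (J 4 q * T) * (phi q * J 12 q * J 4 q) = q * J 6 q ^ 6 * J 2 q ^ 3 * J 4 q" .
  have "(q * J 6 q * phi (q ^ 3) * K * S) * (J 4 q * T) * (phi q * J 12 q * J 4 q) * J 2 q =
      q * J 6 q * (T * phi (q ^ 3) * K) * (phi q * S * J 4 q ^ 2) * J 12 q * J 2 q"
    by (simp add: algebra_simps eval_nat_numeral)
  also have "\<dots> = q * J 6 q ^ 4 * J 2 q ^ 4 * (Y * J 12 q * J 2 q)"
    unfolding 4 6 by (simp add: algebra_simps eval_nat_numeral)
  also have "\<dots> = (q * J 6 q ^ 6 * J 2 q ^ 3 * J 4 q) * J 2 q"
    unfolding 5 by (simp add: algebra_simps eval_nat_numeral)
  also have "\<dots> = - hderiv q * (J 4 q * T) * (phi q * J 12 q * J 4 q) * J 2 q" unfolding L ..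
  finally have "(q * J 6 q * phi (q ^ 3) * K * S) * ((J 4 q * T) * (phi q * J 12 q * J 4 q) * J 2 q) =
     - hderiv q * ((J 4 q * T) * (phi q * J 12 q * J 4 q) * J 2 q)" by (simp only: mult.assoc)
  then have "q * J 6 q * phi (q ^ 3) * K * S = - hderiv q"
    using nz T phi by (simp only: mult_right_cancel mult_eq_0_iff simp_thms)
  then show ?thesis using infsum_th[OF assms(2)] by (simp add: K_def S_def)
qed

text \<open>Here a b = -q^6, so the theta function on the right of Kronecker's identity is
  theta(-q^6; q^6) = 2 J_12^2 / J_6. Its 2 comes from the first factor 1 - (-1) of a product and is
  the 2 of the theorem.\<close>

lemma kronecker_q5:
  assumes "norm q < 1" "q \<noteq> 0"
  shows "J 2 q * phi q * kronecker_sum q (- (q ^ 5)) (q ^ 6) = 2 * J 12 q * J 6 q * J 2 q ^ 5 / (J 4 q * J 1 q ^ 2)"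
proof -
  have "int 6 * n + int 5 \<noteq> 0" for n :: int by presburger
  note ne = minus_power_powi_neq_1[OF assms this]
  define K where "K = kronecker_sum q (- (q ^ 5)) (q ^ 6)"
  define A where "A = qprod (q\<^sup>2) (q ^ 12) * qprod (q ^ 10) (q ^ 12)"
  have nz: "J 1 q \<noteq> 0" "J 2 q \<noteq> 0" "J 4 q \<noteq> 0" "J 6 q \<noteq> 0" "J 12 q \<noteq> 0" by (simp_all add: J_nonzero assms(1))
  have k: "theta q (q ^ 6) * theta (- (q ^ 5)) (q ^ 6) * K = J 6 q ^ 3 * theta (- (q ^ 6)) (q ^ 6)"
    using kronecker[OF norm_power_less_1[OF assms(1)] _ _ ne, of q]
      norm_power_strict_decreasing[OF assms, of 1 6] assms by (simp add: K_def J_eq_qprod flip: power_Suc)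
  \<comment> \<open>Pairing q with -q and q^5 with -q^5 squares the base. The resulting residues 2
    and 10 modulo 12 form \<open>A\<close>, which satisfies J_2 J_12 = A J_4 J_6.\<close>
  have "theta q (q ^ 6) * theta (- (q ^ 5)) (q ^ 6) =
      (qprod q (q ^ 6) * qprod (- q) (q ^ 6)) * (qprod (q ^ 5) (q ^ 6) * qprod (- (q ^ 5)) (q ^ 6)) * J 6 q ^ 2"
    using theta_powers[OF assms, of 1 1 6] theta_powers[OF assms, of "- 1" 5 6] by (simp add: power2_eq_square mult_ac)
  also have "\<dots> = A * J 6 q ^ 2"
    using qprod_mult_uminus[OF norm_power_less_1[OF assms(1)], of 6] by (simp add: A_def flip: power_mult)
  finally have k1: "theta q (q ^ 6) * theta (- (q ^ 5)) (q ^ 6) = A * J 6 q ^ 2" .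
  have "qprod (- 1) (q ^ 6) = 2 * qprod (- (q ^ 6)) (q ^ 6)"
    using qprod_head[OF norm_power_less_1[OF assms(1)], of 6 "- 1"] by simp
  then have "theta (- (q ^ 6)) (q ^ 6) = 2 * qprod (- (q ^ 6)) (q ^ 6) ^ 2 * J 6 q"
    using theta_powers[OF assms, of "- 1" 6 6] by (simp add: power2_eq_square)
  then have k2: "theta (- (q ^ 6)) (q ^ 6) * J 6 q = 2 * J 12 q ^ 2"
    using qprod_minus_J[OF assms(1), of 6, symmetric] by (simp add: power2_eq_square mult_ac)
  have j2: "J 2 q = qprod (q\<^sup>2) (q ^ 12) * qprod (q ^ 4) (q ^ 12) * qprod (q ^ 6) (q ^ 12) * qprod (q ^ 8) (q ^ 12)
      * qprod (q ^ 10) (q ^ 12) * J 12 q"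
    using qprod_powers_split[OF assms(1), of 2 6 1 2] by (simp add: J_eq_qprod eval_nat_numeral)
  have j4: "J 4 q = qprod (q ^ 4) (q ^ 12) * qprod (q ^ 8) (q ^ 12) * J 12 q"
    using J_split3[OF assms(1), of 4] by simp
  have j6: "J 6 q = qprod (q ^ 6) (q ^ 12) * J 12 q"
    using J_split2[OF assms(1), of 6] by simp
  have j: "J 2 q * J 12 q = A * J 4 q * J 6 q" unfolding j2 j4 j6 A_def by (simp add: mult_ac)
  have p1: "theta q (q\<^sup>2) * J 2 q = J 1 q ^ 2" using theta_J_square[OF assms, of 1] by simp
  have p: "phi q * J 1 q ^ 2 * J 4 q ^ 2 = J 2 q ^ 5"
    using phi_mult_theta[OF assms] unfolding p1[symmetric] by (simp add: algebra_simps eval_nat_numeral)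
  have "A \<noteq> 0" using j nz by auto
  have "A * J 6 q ^ 2 * K * J 6 q = J 6 q ^ 3 * (theta (- (q ^ 6)) (q ^ 6) * J 6 q)"
    using k unfolding k1 by (simp add: mult_ac)
  then have "J 6 q ^ 3 * (A * K) = J 6 q ^ 3 * (2 * J 12 q ^ 2)"
    unfolding k2 by (simp add: algebra_simps eval_nat_numeral)
  then have AK: "A * K = 2 * J 12 q ^ 2" using nz by simp
  have "J 12 q * (J 2 q * K) = (A * K) * J 4 q * J 6 q" using j by (simp add: algebra_simps)
  then have "J 12 q * (J 2 q * K) = J 12 q * (2 * J 12 q * J 4 q * J 6 q)"
    unfolding AK by (simp add: algebra_simps power2_eq_square)
  then have K: "J 2 q * K = 2 * J 12 q * J 4 q * J 6 q" using nz by simp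
  have "J 2 q * phi q * K * (J 4 q * J 1 q ^ 2) = (J 2 q * K) * (phi q * J 1 q ^ 2 * J 4 q ^ 2) / J 4 q"
    using nz by (simp add: field_simps power2_eq_square)
  also have "\<dots> = 2 * J 12 q * J 6 q * J 2 q ^ 5" unfolding K p using nz by simp
  finally show ?thesis using nz by (simp add: K_def field_simps)
qed

subsection \<open>Class number sums as a cone sum\<close>

text \<open>With P = 2n+1+2j, Q = 2n+1-2j and R = 2r+1, the condition |j| <= n says that P and Q are
  positive, and \<open>cexp r n j\<close> is the N with PQ + QR + RP = 4N - 1.\<close>

definition cone :: "(nat \<times> int) set" where
  "cone = {(n, j). \<bar>j\<bar> \<le> int n}"

definition cexp :: "nat \<Rightarrow> nat \<Rightarrow> int \<Rightarrow> int" where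
  "cexp r n j = (int n)\<^sup>2 + (2 * int n + 1) * (int r + 1) - j\<^sup>2"

text \<open>On the cone j^2 <= n^2 tames the indefinite form. The bound is linear in r, n and |j| so
  that a product of three geometric series dominates the cone sum.\<close>

lemma cexp_ge:
  assumes "\<bar>j\<bar> \<le> int n"
  shows "int r + int n + \<bar>j\<bar> + 1 \<le> cexp r n j"
proof -
  have "\<bar>j\<bar>\<^sup>2 \<le> (int n)\<^sup>2" using assms by (intro power_mono) auto
  then have "j\<^sup>2 \<le> (int n)\<^sup>2" by simp
  moreover have "0 \<le> int n * int r" by simp
  moreover have "cexp r n j = (int n)\<^sup>2 + 2 * (int n * int r) + 2 * int n + int r + 1 - j\<^sup>2"
    by (simp add: cexp_def algebra_simps)
  ultimately show ?thesis using assms by linarith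
qed

lemma cone_abs_summable:
  fixes q :: complex
  assumes "norm q < 1"
  shows "(\<lambda>(r, n, j). q powi cexp r n j) abs_summable_on (UNIV \<times> cone)"
proof -
  have g: "(\<lambda>n::nat. q ^ n) abs_summable_on UNIV"
    using assms by (intro norm_summable_imp_summable_on) (simp add: norm_power)
  have h: "(\<lambda>j::int. q ^ nat \<bar>j\<bar>) abs_summable_on UNIV"
    by (rule abs_summable_on_int_geometric[where C = 1 and r = "norm q" and s = "norm q"])
      (use assms in \<open>auto simp: norm_power\<close>)
  have "(\<lambda>(r, p). q ^ r * (case p of (n, j) \<Rightarrow> q ^ n * q ^ nat \<bar>j\<bar>)) abs_summable_on (UNIV \<times> (UNIV \<times> UNIV))"
    by (rule abs_summable_prod2[OF g abs_summable_prod2[OF g h]])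
  then have "(\<lambda>(r, p). q ^ r * (case p of (n, j) \<Rightarrow> q ^ n * q ^ nat \<bar>j\<bar>)) abs_summable_on (UNIV \<times> cone)"
    by (rule summable_on_subset_banach) auto
  then show ?thesis
  proof (rule summable_on_comparison_test)
    fix x :: "nat \<times> nat \<times> int"
    assume x: "x \<in> UNIV \<times> cone"
    obtain r n j where xe: "x = (r, n, j)" by (cases x)
    have e: "int r + int n + \<bar>j\<bar> + 1 \<le> cexp r n j"
      using x by (intro cexp_ge) (auto simp: xe cone_def)
    then have c0: "0 \<le> cexp r n j" and le: "r + n + nat \<bar>j\<bar> \<le> nat (cexp r n j)" by linarith+
    have "norm (q powi cexp r n j) = norm q ^ nat (cexp r n j)"
      using c0 by (simp add: power_int_def norm_power)
    also have "\<dots> \<le> norm q ^ (r + n + nat \<bar>j\<bar>)"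
      using le assms by (intro power_decreasing) auto
    finally show "norm (case x of (r, n, j) \<Rightarrow> q powi cexp r n j) \<le>
        norm (case x of (r, p) \<Rightarrow> q ^ r * (case p of (n, j) \<Rightarrow> q ^ n * q ^ nat \<bar>j\<bar>))"
      by (simp add: xe norm_mult norm_power power_add mult_ac)
  qed auto
qed

section \<open>Telescoping along rays and Kronecker's relation\<close>

definition ray_sum :: "complex \<Rightarrow> nat \<Rightarrow> complex" where
  "ray_sum q r = (\<Sum>\<^sub>\<infinity>(n, j)\<in>cone. q powi cexp r n j)"

definition cone_sum :: "complex \<Rightarrow> complex" where
  "cone_sum q = (\<Sum>\<^sub>\<infinity>(r, n, j)\<in>UNIV \<times> cone. q powi cexp r n j)"

lemma cone_sum_eq:
  assumes "norm q < 1"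
  shows "cone_sum q = infsum (ray_sum q) UNIV"
  unfolding cone_sum_def ray_sum_def
  using infsum_Sigma'_banach[of "\<lambda>r (n, j). q powi cexp r n j" UNIV "\<lambda>_. cone"]
    abs_summable_summable[OF cone_abs_summable[OF assms]]
  by (simp add: case_prod_unfold)

lemma ray_abs_summable:
  fixes q :: complex
  assumes "norm q < 1"
  shows "(\<lambda>(n, j). q powi cexp r n j) abs_summable_on cone"
  using iffD1[OF Infinite_Sum.abs_summable_on_Sigma_iff cone_abs_summable[OF assms]]
  by (auto simp: case_prod_unfold)

lemma ray_sum_abs_summable:
  assumes "norm q < 1"
  shows "ray_sum q abs_summable_on UNIV"
proof -
  have "(\<lambda>r. \<Sum>\<^sub>\<infinity>p\<in>cone. norm (case (r, p) of (r, n, j) \<Rightarrow> q powi cexp r n j)) abs_summable_on UNIV"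
    using iffD1[OF Infinite_Sum.abs_summable_on_Sigma_iff cone_abs_summable[OF assms]] by blast
  then show ?thesis
  proof (rule summable_on_comparison_test)
    fix r :: nat
    have "norm (ray_sum q r) \<le> (\<Sum>\<^sub>\<infinity>p\<in>cone. norm (case (r, p) of (r, n, j) \<Rightarrow> q powi cexp r n j))"
      unfolding ray_sum_def using norm_infsum_bound[OF ray_abs_summable[OF assms, of r]]
      by (simp add: case_prod_unfold)
    then show "norm (ray_sum q r) \<le> norm (\<Sum>\<^sub>\<infinity>p\<in>cone. norm (case (r, p) of (r, n, j) \<Rightarrow> q powi cexp r n j))"
      by simp
  qed auto
qed

definition sigma_sum :: "complex \<Rightarrow> nat \<Rightarrow> complex" where
  "sigma_sum q n = (\<Sum>j\<in>{- int n..int n}. q powi (- (j\<^sup>2)))"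

lemma sigma_sum_Suc: "sigma_sum q (Suc n) = sigma_sum q n + 2 * q powi (- ((int n + 1)\<^sup>2))"
proof -
  have "{- int (Suc n)..int (Suc n)} = insert (- (int n + 1)) (insert (int n + 1) {- int n..int n})" by auto
  moreover have "(- (int n + 1))\<^sup>2 = (int n + 1)\<^sup>2" by (rule power2_minus)
  ultimately show ?thesis by (simp add: sigma_sum_def del: minus_add_distrib)
qed

lemma infsum_nat_Suc:
  fixes f :: "nat \<Rightarrow> complex"
  assumes "f summable_on UNIV"
  shows "infsum f UNIV = f 0 + (\<Sum>\<^sub>\<infinity>n. f (Suc n))" and "(\<lambda>n. f (Suc n)) summable_on UNIV"
proof -
  have s: "f summable_on A" for A using assms summable_on_subset_banach by blast
  have "(UNIV::nat set) = insert 0 (range Suc)" by (rule UNIV_nat_eq)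
  then have U: "(UNIV::nat set) = {0} \<union> range Suc" by (simp only: insert_is_Un[of 0 "range Suc", symmetric])
  have "infsum f UNIV = infsum f {0} + infsum f (range Suc)"
    by (subst U, rule infsum_Un_disjoint[OF s s]) auto
  also have "infsum f (range Suc) = (\<Sum>\<^sub>\<infinity>n. f (Suc n))"
    by (subst infsum_reindex) (auto simp: o_def)
  finally show "infsum f UNIV = f 0 + (\<Sum>\<^sub>\<infinity>n. f (Suc n))" by simp
  show "(\<lambda>n. f (Suc n)) summable_on UNIV"
    using s[of "range Suc"] by (subst (asm) summable_on_reindex) (auto simp: o_def)
qed

lemma infsum_geometric:
  fixes x c :: complex
  assumes "norm x < 1"
  shows "(\<Sum>\<^sub>\<infinity>n::nat. c * x ^ n) = c / (1 - x)"
proof -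
  have "((\<lambda>n. x ^ n) has_sum 1 / (1 - x)) UNIV"
  proof (rule norm_summable_imp_has_sum)
    show "summable (\<lambda>n. norm (x ^ n))" using assms by (simp add: norm_power summable_geometric)
    show "(\<lambda>n. x ^ n) sums (1 / (1 - x))" by (rule geometric_sums[OF assms])
  qed
  from infsumI[OF this] show ?thesis by (simp add: infsum_cmult_right')
qed

definition rho :: "complex \<Rightarrow> int \<Rightarrow> complex" where
  "rho q k = q powi k * (1 + q powi (2 * k)) / (1 - q powi (2 * k))"

lemma ray_sum_eq:
  assumes "norm q < 1" "q \<noteq> 0"
  defines "a \<equiv> \<lambda>r n. q powi ((int n)\<^sup>2 + (2 * int n + 1) * (int r + 1)) * sigma_sum q n"
  shows "ray_sum q r = (\<Sum>\<^sub>\<infinity>n. a r n)" "(\<lambda>n. a r n) summable_on UNIV"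
proof -
  have c: "cone = Sigma UNIV (\<lambda>n. {- int n..int n})" by (auto simp: cone_def)
  have s: "(\<lambda>(n, j). q powi cexp r n j) summable_on Sigma UNIV (\<lambda>n. {- int n..int n})"
    using abs_summable_summable[OF ray_abs_summable[OF assms(1), of r]] by (simp add: c)
  have e: "(\<Sum>\<^sub>\<infinity>j\<in>{- int n..int n}. q powi cexp r n j) = a r n" for n
    unfolding a_def sigma_sum_def sum_distrib_left cexp_def
    using assms(2) by (simp add: power_int_diff power_int_minus divide_inverse)
  show "ray_sum q r = (\<Sum>\<^sub>\<infinity>n. a r n)"
    unfolding ray_sum_def c using infsum_Sigma'_banach[OF s] by (simp add: e)
  show "(\<lambda>n. a r n) summable_on UNIV"
    using summable_on_Sigma_banach[OF s] by (simp add: e)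
qed

text \<open>For fixed j the exponents at (r, n+1) and (r+1, n) differ by 2(r+1), so the parts with
  |j| <= n cancel. There remain the point n = 0 and the two ends j = n+1 and j = -(n+1), which give
  a geometric series in q^(2(r+1)).\<close>

lemma ray_sum_Suc:
  assumes "norm q < 1" "q \<noteq> 0"
  shows "ray_sum q r - q powi (2 * (int r + 1)) * ray_sum q (Suc r) = rho q (int r + 1)"
proof -
  define a where "a r n = q powi ((int n)\<^sup>2 + (2 * int n + 1) * (int r + 1)) * sigma_sum q n" for r n
  note R = ray_sum_eq[OF assms, folded a_def]
  define k where "k = int r + 1"
  define x where "x = q ^ (2 * (r + 1))"
  have "int (2 * (r + 1)) = 2 * k" by (simp add: k_def)
  then have x: "norm x < 1" "x = q powi (2 * k)"
    using norm_power_less_1[OF assms(1), of "2 * (r + 1)"] power_int_of_nat[of q "2 * (r + 1)"]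
    by (simp_all add: x_def)
  have step: "a r (Suc n) - q powi (2 * k) * a (Suc r) n = 2 * q powi (3 * k) * x ^ n" for n
  proof -
    have e: "2 * k + ((int n)\<^sup>2 + (2 * int n + 1) * (int (Suc r) + 1)) = (int (Suc n))\<^sup>2 + (2 * int (Suc n) + 1) * (int r + 1)"
      by (simp add: k_def power2_eq_square algebra_simps)
    have "q powi (2 * k) * a (Suc r) n = q powi ((int (Suc n))\<^sup>2 + (2 * int (Suc n) + 1) * (int r + 1)) * sigma_sum q n"
      unfolding a_def e[symmetric] using assms(2) by (simp add: power_int_add[of q "2 * k"])
    then have "a r (Suc n) - q powi (2 * k) * a (Suc r) n =
        2 * (q powi ((int (Suc n))\<^sup>2 + (2 * int (Suc n) + 1) * (int r + 1)) * q powi (- ((int n + 1)\<^sup>2)))"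
      by (simp only: a_def sigma_sum_Suc) (simp add: algebra_simps)
    also have "q powi ((int (Suc n))\<^sup>2 + (2 * int (Suc n) + 1) * (int r + 1)) * q powi (- ((int n + 1)\<^sup>2)) =
        q powi (3 * k + 2 * k * int n)"
      using assms(2) by (simp add: k_def algebra_simps flip: power_int_add)
    also have "\<dots> = q powi (3 * k) * x ^ n"
      using assms(2) by (simp add: power_int_add power_int_mult x(2))
    finally show ?thesis by simp
  qed
  have "ray_sum q r - q powi (2 * k) * ray_sum q (Suc r) =
      a r 0 + ((\<Sum>\<^sub>\<infinity>n. a r (Suc n)) - (\<Sum>\<^sub>\<infinity>n. q powi (2 * k) * a (Suc r) n))"
    unfolding R(1) infsum_nat_Suc(1)[OF R(2)[of r]] by (simp add: infsum_cmult_right')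
  also have "(\<Sum>\<^sub>\<infinity>n. a r (Suc n)) - (\<Sum>\<^sub>\<infinity>n. q powi (2 * k) * a (Suc r) n) =
      (\<Sum>\<^sub>\<infinity>n. a r (Suc n) - q powi (2 * k) * a (Suc r) n)"
    by (rule infsum_diff[symmetric]) (intro infsum_nat_Suc(2) R(2) summable_on_cmult_right)+
  also have "\<dots> = 2 * q powi (3 * k) / (1 - x)"
    unfolding step by (rule infsum_geometric[OF x(1)])
  also have "a r 0 = q powi k" by (simp add: a_def sigma_sum_def k_def)
  also have "q powi (3 * k) = q powi k * x"
    unfolding x(2) using assms(2) by (simp flip: power_int_add)
  also have "q powi k + 2 * (q powi k * x) / (1 - x) = q powi k * (1 + x) / (1 - x)"
  proof -
    have "x \<noteq> 1" using x(1) by auto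
    then show ?thesis by (simp add: divide_simps) (simp add: algebra_simps)
  qed
  finally show ?thesis by (simp add: rho_def k_def x(2))
qed

text \<open>\<open>ray_sum q r\<close> collects the triples with \<open>R = 2r + 1\<close>; \<open>tsum\<close> extends it to negative odd \<open>R\<close>
  by \<open>R \<mapsto> - R\<close>, with \<open>R = 2k - 1\<close>. At \<open>k = 0\<close> the denominator of \<open>rho\<close> vanishes and its junk value
  \<open>0\<close> is the one needed in \<open>tsum_step\<close>.\<close>

definition tsum :: "complex \<Rightarrow> int \<Rightarrow> complex" where
  "tsum q k = ray_sum q (if k \<ge> 1 then nat (k - 1) else nat (- k))"

lemma rho_minus:
  assumes "q \<noteq> 0"
  shows "rho q (- k) = - (q powi (- 2 * k) * rho q k)"
proof (cases "q powi (2 * k) = 1")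
  case True
  then have "q powi (- (2 * k)) = 1" by (simp add: power_int_minus)
  with True show ?thesis by (simp add: rho_def)
next
  case False
  define x where "x = q powi k"
  have e: "q powi (2 * k) = x\<^sup>2" "q powi (- k) = inverse x" "q powi (2 * - k) = inverse (x\<^sup>2)" "q powi (- 2 * k) = inverse (x\<^sup>2)"
    unfolding x_def by (simp_all add: power_int_minus mult.commute[of 2] power_int_mult)
  have "x \<noteq> 0" "x\<^sup>2 \<noteq> 1" using assms False e by (simp_all add: x_def)
  then show ?thesis unfolding rho_def e x_def[symmetric] by (simp add: divide_simps) (simp add: algebra_simps eval_nat_numeral)
qed

lemma tsum_step:
  assumes "norm q < 1" "q \<noteq> 0"
  shows "tsum q k - q powi (2 * k) * tsum q (k + 1) = rho q k"
proof -
  consider "k \<ge> 1" | "k = 0" | "k \<le> - 1" by linarith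
  then show ?thesis
  proof cases
    case 1
    define r where "r = nat (k - 1)"
    have k: "k = int r + 1" using 1 by (simp add: r_def)
    have "tsum q k = ray_sum q r" "tsum q (k + 1) = ray_sum q (Suc r)"
      using 1 by (simp_all add: tsum_def r_def Suc_nat_eq_nat_zadd1)
    then show ?thesis using ray_sum_Suc[OF assms, of r] k by simp
  next
    case 2
    then show ?thesis by (simp add: tsum_def rho_def)
  next
    case 3
    define r where "r = nat (- k - 1)"
    have k: "k = - (int r + 1)" "nat (- k) = Suc r" "nat (- (k + 1)) = r" using 3 by (auto simp: r_def)
    have "q powi (2 * k) * q powi (2 * (int r + 1)) = 1"
      using assms(2) by (simp add: k flip: power_int_add)
    then have "tsum q k - q powi (2 * k) * tsum q (k + 1) =
        - (q powi (2 * k) * (ray_sum q r - q powi (2 * (int r + 1)) * ray_sum q (Suc r)))"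
      using 3 k(2,3) by (simp add: tsum_def right_diff_distrib flip: mult.assoc)
    also have "\<dots> = rho q k"
      unfolding ray_sum_Suc[OF assms] using rho_minus[OF assms(2), of "int r + 1"] by (simp add: k(1))
    finally show ?thesis .
  qed
qed

text \<open>The half-lines k >= 1 and k <= 0 each run once through all rays; hence the factor
  2.\<close>

lemma tsum_abs_summable:
  assumes "norm q < 1"
  shows "tsum q abs_summable_on UNIV" and "infsum (tsum q) UNIV = 2 * cone_sum q"
proof -
  have s: "ray_sum q abs_summable_on UNIV" by (rule ray_sum_abs_summable[OF assms])
  have 1: "((\<lambda>k. norm (tsum q k)) summable_on {1..}) \<longleftrightarrow> (\<lambda>r. norm (ray_sum q r)) summable_on UNIV"
    by (rule summable_on_reindex_bij_witness[of _ "\<lambda>r. int r + 1" "\<lambda>k. nat (k - 1)"]) (auto simp: tsum_def)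
  have 2: "((\<lambda>k. norm (tsum q k)) summable_on {..0}) \<longleftrightarrow> (\<lambda>r. norm (ray_sum q r)) summable_on UNIV"
    by (rule summable_on_reindex_bij_witness[of _ "\<lambda>r. - int r" "\<lambda>k. nat (- k)"]) (auto simp: tsum_def)
  have U: "(UNIV :: int set) = {1..} \<union> {..0}" by auto
  show a: "tsum q abs_summable_on UNIV"
    unfolding U by (rule summable_on_union) (use 1 2 s in auto)
  have s': "tsum q summable_on A" for A
    using abs_summable_summable[OF a] summable_on_subset_banach by blast
  have 3: "infsum (tsum q) {1..} = infsum (ray_sum q) UNIV"
    by (rule infsum_reindex_bij_witness[of _ "\<lambda>r. int r + 1" "\<lambda>k. nat (k - 1)"]) (auto simp: tsum_def)
  have 4: "infsum (tsum q) {..0} = infsum (ray_sum q) UNIV"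
    by (rule infsum_reindex_bij_witness[of _ "\<lambda>r. - int r" "\<lambda>k. nat (- k)"]) (auto simp: tsum_def)
  have "infsum (tsum q) UNIV = infsum (tsum q) {1..} + infsum (tsum q) {..0}"
    by (subst U, rule infsum_Un_disjoint[OF s' s']) auto
  then show "infsum (tsum q) UNIV = 2 * cone_sum q"
    unfolding 3 4 cone_sum_eq[OF assms] by simp
qed

lemma th_diff:
  assumes "q \<noteq> 0"
  shows "th q (K - s) = th q K * (th q s * q powi (- 2 * K * s))"
proof -
  have e: "(K - s)\<^sup>2 = K\<^sup>2 + (s\<^sup>2 + (- 2 * K * s))" by (simp add: power2_eq_square algebra_simps)
  have sg: "(-1) powi (K - s) = (-1) powi K * ((-1) powi s :: complex)"
    by (simp add: power_int_diff power_int_minus_left)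
  show ?thesis unfolding th_def by (simp only: e sg power_int_add[OF disjI1[OF assms]] mult_ac)
qed

lemma th_nonzero: "q \<noteq> 0 \<Longrightarrow> th q n \<noteq> 0"
  by (simp add: th_def)

definition vsum :: "complex \<Rightarrow> int \<Rightarrow> complex" where
  "vsum q K = (\<Sum>\<^sub>\<infinity>s. th q s * q powi (- 2 * K * s) * rho q s)"

text \<open>Summation by parts: the factor 1 + q^(2K-1) adds a copy shifted by one index, the
  recursion of \<open>th\<close> turns that copy into -q^(2i) \<open>tsum q (i + 1)\<close> with the
  old theta weight, and \<open>tsum_step\<close> collapses the difference to
  \<open>rho\<close>.\<close>

lemma conv_th_tsum:
  assumes "norm q < 1" "q \<noteq> 0"
  shows "conv (th q) (tsum q) K * (1 + q powi (2 * K - 1)) = th q K * vsum q K"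
    and "(\<lambda>s. th q s * q powi (- 2 * K * s) * rho q s) summable_on UNIV"
proof -
  have s: "(\<lambda>i. tsum q i * th q (m - i)) summable_on UNIV" for m
    by (intro conv_summable tsum_abs_summable gauss_bounded_abs_summable theta_type_gauss(2)[OF theta_type_th] assms)
  have sh: "q powi (2 * K - 1) * (tsum q (i + 1) * th q (K - (i + 1))) = - (q powi (2 * i) * tsum q (i + 1) * th q (K - i))" for i
  proof -
    have "th q (K - i) = - (q powi (2 * (K - (i + 1)) + 1) * th q (K - (i + 1)))"
      using th_Suc[OF assms(2), of "K - (i + 1)"] by (simp add: algebra_simps)
    moreover have "q powi (2 * K - 1) = q powi (2 * i) * q powi (2 * (K - (i + 1)) + 1)"
      using assms(2) by (simp flip: power_int_add)
    ultimately show ?thesis by simp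
  qed
  have s2: "(\<lambda>i. q powi (2 * K - 1) * (tsum q (i + 1) * th q (K - (i + 1)))) summable_on UNIV"
    using summable_on_int_shift[of "\<lambda>i. tsum q i * th q (K - i)" 1] s by (intro summable_on_cmult_right) simp
  have trm: "tsum q i * th q (K - i) + q powi (2 * K - 1) * (tsum q (i + 1) * th q (K - (i + 1))) =
      th q K * (th q i * q powi (- 2 * K * i) * rho q i)" for i
    unfolding sh tsum_step[OF assms, of i, symmetric] th_diff[OF assms(2), of K i] by (simp add: algebra_simps)
  have "(\<lambda>i. th q K * (th q i * q powi (- 2 * K * i) * rho q i)) summable_on UNIV"
    unfolding trm[symmetric] by (intro summable_on_add s s2)
  then show "(\<lambda>s. th q s * q powi (- 2 * K * s) * rho q s) summable_on UNIV"
    using th_nonzero[OF assms(2), of K] by (simp only: summable_on_cmult_right'[of "th q K"] simp_thms)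
  have cc: "conv (th q) (tsum q) K = (\<Sum>\<^sub>\<infinity>i. tsum q i * th q (K - i))"
    by (subst conv_commute) (simp add: conv_def)
  have "conv (th q) (tsum q) K * (1 + q powi (2 * K - 1)) =
      (\<Sum>\<^sub>\<infinity>i. tsum q i * th q (K - i)) + q powi (2 * K - 1) * (\<Sum>\<^sub>\<infinity>i. tsum q (i + 1) * th q (K - (i + 1)))"
    unfolding infsum_int_shift[of "\<lambda>i. tsum q i * th q (K - i)" 1] cc
    by (simp add: algebra_simps)
  also have "\<dots> = (\<Sum>\<^sub>\<infinity>i. tsum q i * th q (K - i) + q powi (2 * K - 1) * (tsum q (i + 1) * th q (K - (i + 1))))"
    unfolding infsum_cmult_right'[symmetric] by (rule infsum_add[symmetric, OF s s2])
  finally show "conv (th q) (tsum q) K * (1 + q powi (2 * K - 1)) = th q K * vsum q K"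
    unfolding trm vsum_def infsum_cmult_right' .
qed

text \<open>Passing to K + 1 multiplies the s-th term by q^(-2s), and q^(-2s) - 1 cancels the
  denominator of \<open>rho\<close>. This leaves theta values at two odd powers of q, which are 0,
  except that at s = 0 the value of \<open>rho\<close> is 0 where the theta series contribute 1 + 1.
  So each step subtracts 2; this defect creates the weight 1 - 2K and thereby the derivative in
  Kronecker's relation.\<close>

lemma vsum_eq:
  assumes "norm q < 1" "q \<noteq> 0"
  shows "vsum q K = 1 - 2 * of_int K"
proof -
  have step: "vsum q (K + 1) = vsum q K - 2" for K
  proof -
    have z: "(\<Sum>\<^sub>\<infinity>s. th q s * (q powi m) powi s) = 0" if odd: "odd m" for m
    proof -
      obtain l0 where "m = 2 * l0 + 1" using odd by (rule oddE)
      then have "m = 2 * (l0 + 1) - 1" by simp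
      then obtain l where m: "m = 2 * l - 1" ..
      have "q * q powi m = (q\<^sup>2) powi l"
        using assms(2) by (simp add: m power_int_diff power_powi[of q 2, simplified])
      then show ?thesis
        using infsum_th_powi[OF assms(2), of "q powi m"] theta_q_powi[of "q\<^sup>2" l] assms(2) by simp
    qed
    have sm: "(\<lambda>s. th q s * (q powi m) powi s) summable_on UNIV" for m
      by (intro gauss_bounded_summable gauss_bounded_mult_powi theta_type_gauss(2)[OF theta_type_th] assms) (use assms in simp)
    have "vsum q (K + 1) - vsum q K = (\<Sum>\<^sub>\<infinity>s. th q s * q powi (- 2 * (K + 1) * s) * rho q s - th q s * q powi (- 2 * K * s) * rho q s)"
      unfolding vsum_def by (rule infsum_diff[symmetric]; rule conv_th_tsum(2)[OF assms])
    also have "\<dots> = (\<Sum>\<^sub>\<infinity>s. (th q s * (q powi (- 2 * K - 1)) powi s + th q s * (q powi (- 2 * K + 1)) powi s) - (if s = 0 then 2 else 0))"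
    proof (rule infsum_cong)
      fix s :: int
      show "th q s * q powi (- 2 * (K + 1) * s) * rho q s - th q s * q powi (- 2 * K * s) * rho q s =
        (th q s * (q powi (- 2 * K - 1)) powi s + th q s * (q powi (- 2 * K + 1)) powi s) - (if s = 0 then 2 else 0)"
      proof (cases "s = 0")
        case True
        then show ?thesis by (simp add: rho_def th_def)
      next
        case False
        define x where "x = q powi s"
        define y where "y = q powi (- 2 * K * s)"
        have x0: "x \<noteq> 0" using assms(2) by (simp add: x_def)
        have x2: "q powi (2 * s) = x\<^sup>2" by (simp add: x_def power_int_mult mult.commute[of 2])
        have "norm (q powi (2 * s)) \<noteq> 1" using powi_neq_1[OF assms, of "2 * s"] False by simp
        then have x1: "1 - x\<^sup>2 \<noteq> 0" unfolding x2 by auto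
        have m: "- 2 * (K + 1) * s = - 2 * K * s - 2 * s" "(- 2 * K - 1) * s = - 2 * K * s - s" "(- 2 * K + 1) * s = - 2 * K * s + s"
          by (simp_all add: algebra_simps)
        have e: "q powi (- 2 * (K + 1) * s) = y / x\<^sup>2" "(q powi (- 2 * K - 1)) powi s = y / x" "(q powi (- 2 * K + 1)) powi s = y * x"
          unfolding power_int_mult[symmetric] m
          unfolding y_def x_def x2[unfolded x_def, symmetric]
            power_int_add[OF disjI1[OF assms(2)]] power_int_diff[OF disjI1[OF assms(2)]] by (rule refl)+
        show ?thesis
          unfolding e rho_def x2 y_def[symmetric] x_def[symmetric] using False x0 x1
          by (simp add: divide_simps) (simp add: algebra_simps power2_eq_square)
      qed
    qed
    also have "\<dots> = (\<Sum>\<^sub>\<infinity>s. th q s * (q powi (- 2 * K - 1)) powi s + th q s * (q powi (- 2 * K + 1)) powi s)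
        - (\<Sum>\<^sub>\<infinity>s::int. if s = 0 then 2 else 0)"
    proof (rule infsum_diff)
      show "(\<lambda>s. th q s * (q powi (- 2 * K - 1)) powi s + th q s * (q powi (- 2 * K + 1)) powi s) summable_on UNIV"
        by (intro summable_on_add sm)
      have "(\<lambda>s::int. if s = 0 then 2 else 0 :: complex) summable_on {0}" by simp
      then show "(\<lambda>s::int. if s = 0 then 2 else 0 :: complex) summable_on UNIV"
        by (rule iffD1[OF summable_on_cong_neutral, rotated -1]) auto
    qed
    also have "(\<Sum>\<^sub>\<infinity>s. th q s * (q powi (- 2 * K - 1)) powi s + th q s * (q powi (- 2 * K + 1)) powi s) = 0"
      by (subst infsum_add[OF sm sm]) (simp add: z)
    also have "(\<Sum>\<^sub>\<infinity>s::int. if s = 0 then 2 else 0 :: complex) = (\<Sum>\<^sub>\<infinity>s\<in>{0::int}. if s = 0 then 2 else 0)"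
      by (rule infsum_cong_neutral) auto
    finally show ?thesis by (simp add: algebra_simps)
  qed
  \<comment> \<open>The reflection s -> -s exchanges K = 0 and K = 1 up to sign. Together with the
    difference -2 this fixes the value 1 at K = 0.\<close>
  have "vsum q 1 = (\<Sum>\<^sub>\<infinity>s. th q (- s) * q powi (- 2 * 1 * (- s)) * rho q (- s))"
    unfolding vsum_def using infsum_int_reflect[of "\<lambda>s. th q s * q powi (- 2 * 1 * s) * rho q s" 0] by simp
  also have "\<dots> = (\<Sum>\<^sub>\<infinity>s. - (th q s * q powi (- 2 * 0 * s) * rho q s))"
    unfolding th_minus rho_minus[OF assms(2)] using assms(2)
    by (intro infsum_cong) (simp add: power_int_minus)
  also have "\<dots> = - vsum q 0" unfolding vsum_def infsum_uminus ..
  finally have v0: "vsum q 0 = 1" using step[of 0] by simp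
  show ?thesis
  proof (induction K rule: int_induct[where k = 0])
    case base then show ?case by (simp add: v0)
  next
    case (step1 i) then show ?case by (simp add: step)
  next
    case (step2 i)
    have "vsum q (i - 1) = vsum q i + 2" using step[of "i - 1"] by simp
    then show ?case unfolding step2.IH by simp
  qed
qed

text \<open>In the weight 1 - 2n the constant contributes 0 because the Lambert coefficients are
  antisymmetric; the 2 cancels against the doubling in \<open>tsum\<close>.\<close>

lemma infsum_th_mult_cone_sum:
  assumes "norm q < 1" "q \<noteq> 0"
  shows "infsum (th q) UNIV * cone_sum q = - (\<Sum>\<^sub>\<infinity>n. of_int n * lambert q (th q) n)"
proof -
  note g = theta_type_th[OF assms]
  have l: "lambert q (th q) summable_on UNIV" "(\<lambda>n. of_int n * lambert q (th q) n) summable_on UNIV"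
    by (intro gauss_bounded_summable gauss_bounded_mult_of_int gauss_bounded_lambert[OF assms g])+
  have "infsum (th q) UNIV * infsum (tsum q) UNIV = infsum (conv (th q) (tsum q)) UNIV"
    by (intro infsum_conv[symmetric] gauss_bounded_abs_summable theta_type_gauss(2)[OF g] tsum_abs_summable assms)
  also have "\<dots> = (\<Sum>\<^sub>\<infinity>n. lambert q (th q) n - 2 * (of_int n * lambert q (th q) n))"
  proof (rule infsum_cong)
    fix n :: int
    have "2 * n - 1 \<noteq> 0" by presburger
    then have "1 + q powi (2 * n - 1) \<noteq> 0" by (rule one_plus_powi_nonzero[OF assms])
    then have "conv (th q) (tsum q) n = (1 - 2 * of_int n) * (th q n / (1 + q powi (2 * n - 1)))"
      using conv_th_tsum(1)[OF assms, of n] unfolding vsum_eq[OF assms] by (simp add: field_simps)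
    then show "conv (th q) (tsum q) n = lambert q (th q) n - 2 * (of_int n * lambert q (th q) n)"
      unfolding lambert_th[OF assms] by (simp only: left_diff_distrib mult_1_left mult.assoc)
  qed
  also have "\<dots> = infsum (lambert q (th q)) UNIV - 2 * (\<Sum>\<^sub>\<infinity>n. of_int n * lambert q (th q) n)"
    by (subst infsum_diff[OF l(1) summable_on_cmult_right[OF l(2)]]) (simp only: infsum_cmult_right')
  also have "infsum (lambert q (th q)) UNIV = 0"
    by (intro infsum_antisymmetric lambert_reflect assms g)
  finally have "infsum (th q) UNIV * (2 * cone_sum q) = 0 - 2 * (\<Sum>\<^sub>\<infinity>n. of_int n * lambert q (th q) n)"
    unfolding tsum_abs_summable(2)[OF assms(1)] .
  then have "2 * (infsum (th q) UNIV * cone_sum q) = 2 * (- (\<Sum>\<^sub>\<infinity>n. of_int n * lambert q (th q) n))"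
    by (simp only: mult.left_commute[of _ 2] mult_minus_right diff_0)
  then show ?thesis by (rule mult_left_cancel[THEN iffD1, rotated]) simp
qed

text \<open>Multiplied by the value S of theta at Y = 1, the left side contains Kronecker's
  relation, which \<open>hderiv_eq\<close> converts to the series for \<open>th9\<close>. The
  correction \<open>hderiv\<close> is itself a multiple of S, so S can be cancelled.\<close>

lemma infsum_th9_mult_cone_sum:
  assumes "norm q < 1" "q \<noteq> 0"
  shows "infsum (th9 q) UNIV * cone_sum q = - (\<Sum>\<^sub>\<infinity>n. of_int n * lambert q (th9 q) n)
    + q * J 6 q * phi (q ^ 3) * kronecker_sum q (- (q ^ 3)) (q ^ 6)"
proof -
  define S where "S = infsum (th q) UNIV"
  have S: "S \<noteq> 0" using theta_power_nonzero[OF assms, of 1 2] by (simp add: S_def infsum_th[OF assms(2)])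
  have "S * (infsum (th9 q) UNIV * cone_sum q) = infsum (th9 q) UNIV * (infsum (th q) UNIV * cone_sum q)"
    by (simp add: S_def)
  also have "\<dots> = - hderiv q - S * (\<Sum>\<^sub>\<infinity>n. of_int n * lambert q (th9 q) n)"
    unfolding infsum_th_mult_cone_sum[OF assms] hderiv_eq[OF assms] by (simp add: S_def)
  also have "\<dots> = S * (- (\<Sum>\<^sub>\<infinity>n. of_int n * lambert q (th9 q) n)
    + q * J 6 q * phi (q ^ 3) * kronecker_sum q (- (q ^ 3)) (q ^ 6))"
    unfolding hderiv_kronecker[OF assms] S_def[symmetric] by (simp add: algebra_simps)
  finally show ?thesis using S by simp
qed

subsection \<open>Binary quadratic forms and odd triples\<close>

lemma bqf_equiv_refl: "bqf_equiv f f"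
  unfolding bqf_equiv_def
  by (rule exI[of _ 1], rule exI[of _ 0], rule exI[of _ 0], rule exI[of _ 1]) simp

lemma bqf_equiv_sym:
  assumes "bqf_equiv f g"
  shows "bqf_equiv g f"
proof -
  obtain p r s t where m: "p * t - r * s = 1" "\<And>x y. bqf_eval g x y = bqf_eval f (p * x + r * y) (s * x + t * y)"
    using assms unfolding bqf_equiv_def by blast
  have "p * (t * x - r * y) + r * (- s * x + p * y) = x" "s * (t * x - r * y) + t * (- s * x + p * y) = y" for x y
    using m(1) by algebra+
  then have "bqf_eval f x y = bqf_eval g (t * x + (- r) * y) (- s * x + p * y)" for x y
    unfolding m(2) by simp
  moreover have "t * p - (- r) * (- s) = 1" using m(1) by (simp add: mult.commute)
  ultimately show ?thesis unfolding bqf_equiv_def by blast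
qed

lemma bqf_equiv_trans:
  assumes "bqf_equiv f g" "bqf_equiv g h"
  shows "bqf_equiv f h"
proof -
  obtain p r s t where m: "p * t - r * s = 1" "\<And>x y. bqf_eval g x y = bqf_eval f (p * x + r * y) (s * x + t * y)"
    using assms(1) unfolding bqf_equiv_def by blast
  obtain p' r' s' t' where m': "p' * t' - r' * s' = 1" "\<And>x y. bqf_eval h x y = bqf_eval g (p' * x + r' * y) (s' * x + t' * y)"
    using assms(2) unfolding bqf_equiv_def by blast
  have "(p * p' + r * s') * (s * r' + t * t') - (p * r' + r * t') * (s * p' + t * s') = 1"
    using m(1) m'(1) by algebra
  moreover have "bqf_eval h x y = bqf_eval f ((p * p' + r * s') * x + (p * r' + r * t') * y) ((s * p' + t * s') * x + (s * r' + t * t') * y)" for x y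
    unfolding m'(2) m(2) by (simp add: algebra_simps)
  ultimately show ?thesis unfolding bqf_equiv_def by blast
qed

lemma bqf_pos_def_equiv:
  assumes "bqf_pos_def f" "bqf_equiv f g"
  shows "bqf_pos_def g"
  unfolding bqf_pos_def_def
proof (intro allI impI)
  fix x y :: int
  assume xy: "(x, y) \<noteq> (0, 0)"
  obtain p r s t where m: "p * t - r * s = 1" "\<And>x y. bqf_eval g x y = bqf_eval f (p * x + r * y) (s * x + t * y)"
    using assms(2) unfolding bqf_equiv_def by blast
  have "x = t * (p * x + r * y) - r * (s * x + t * y)" "y = p * (s * x + t * y) - s * (p * x + r * y)"
    using m(1) by algebra+
  then have "(p * x + r * y, s * x + t * y) \<noteq> (0, 0)" using xy by auto
  then show "bqf_eval g x y > 0" using assms(1) unfolding bqf_pos_def_def m(2) by blast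
qed

definition odd_triples :: "nat \<Rightarrow> (int \<times> int \<times> int) set" where
  "odd_triples M = {(P, Q, R). odd P \<and> odd Q \<and> odd R \<and> 0 < P \<and> 0 < Q \<and> 0 < R \<and> P * Q + Q * R + R * P = int M}"

text \<open>P, Q, R are, up to normalisation, the Selling parameters of the form f with respect to
  the superbase (1,0), (0,1), (-1,-1): 2 f = P (x - y)^2 + Q y^2 + R x^2.\<close>

fun triple_form :: "int \<times> int \<times> int \<Rightarrow> bqf" where
  "triple_form (P, Q, R) = ((P + R) div 2, - P, (P + Q) div 2)"

fun rotate_triple :: "int \<times> int \<times> int \<Rightarrow> int \<times> int \<times> int" where
  "rotate_triple (P, Q, R) = (Q, R, P)"

lemma odd_triples_eval:
  assumes "(P, Q, R) \<in> odd_triples M"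
  shows "2 * bqf_eval (triple_form (P, Q, R)) x y = P * (x - y)\<^sup>2 + Q * y\<^sup>2 + R * x\<^sup>2"
proof -
  have "2 * ((P + R) div 2) = P + R" "2 * ((P + Q) div 2) = P + Q"
    using assms by (auto simp: odd_triples_def)
  moreover have "2 * bqf_eval (triple_form (P, Q, R)) x y =
      (2 * ((P + R) div 2)) * x\<^sup>2 - 2 * P * x * y + (2 * ((P + Q) div 2)) * y\<^sup>2"
    by (simp add: algebra_simps)
  ultimately show ?thesis by (simp add: power2_eq_square algebra_simps)
qed

lemma triple_form_pos_forms:
  assumes "t \<in> odd_triples M"
  shows "triple_form t \<in> pos_forms M"
proof -
  obtain P Q R where t: "t = (P, Q, R)" by (metis prod_cases3)
  have h: "0 < P" "0 < Q" "0 < R" "P * Q + Q * R + R * P = int M" and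
    d: "2 * ((P + R) div 2) = P + R" "2 * ((P + Q) div 2) = P + Q"
    using assms by (auto simp: odd_triples_def t)
  have "bqf_eval (triple_form t) x y > 0" if "(x, y) \<noteq> (0, 0)" for x y
  proof -
    have "0 < P * (x - y)\<^sup>2 + Q * y\<^sup>2 + R * x\<^sup>2"
    proof (cases "x = 0")
      case True
      then have "0 < Q * y\<^sup>2" using that h by simp
      moreover have "0 \<le> P * (x - y)\<^sup>2" "0 \<le> R * x\<^sup>2" using h by simp_all
      ultimately show ?thesis by linarith
    next
      case False
      then have "0 < R * x\<^sup>2" using h by simp
      moreover have "0 \<le> P * (x - y)\<^sup>2" "0 \<le> Q * y\<^sup>2" using h by simp_all
      ultimately show ?thesis by linarith
    qed
    then show ?thesis using odd_triples_eval[OF assms[unfolded t], of x y] unfolding t by linarith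
  qed
  moreover have "bqf_disc (triple_form t) = - int M"
  proof -
    have "bqf_disc (triple_form t) = P\<^sup>2 - (2 * ((P + R) div 2)) * (2 * ((P + Q) div 2))"
      by (simp add: t)
    then show ?thesis unfolding d h(4)[symmetric] by (simp add: power2_eq_square algebra_simps)
  qed
  ultimately show ?thesis by (simp add: pos_forms_def bqf_pos_def_def)
qed

lemma rotate_odd_triples: "t \<in> odd_triples M \<Longrightarrow> rotate_triple t \<in> odd_triples M"
  by (cases t) (auto simp: odd_triples_def algebra_simps)

text \<open>The substitution (x, y) -> (y, y - x) has determinant 1 and permutes the superbase
  cyclically, up to a common sign.\<close>

lemma rotate_equiv:
  assumes "t \<in> odd_triples M"
  shows "bqf_equiv (triple_form t) (triple_form (rotate_triple t))"
proof -
  obtain P Q R where t: "t = (P, Q, R)" by (metis prod_cases3)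
  have "2 * bqf_eval (triple_form (rotate_triple t)) x y = 2 * bqf_eval (triple_form t) (0 * x + 1 * y) ((- 1) * x + 1 * y)" for x y
    using odd_triples_eval[of P Q R M] odd_triples_eval[of Q R P M] rotate_odd_triples[OF assms] assms
    by (simp add: t) (simp add: power2_eq_square algebra_simps)
  then have "bqf_eval (triple_form (rotate_triple t)) x y = bqf_eval (triple_form t) (0 * x + 1 * y) ((- 1) * x + 1 * y)" for x y
    by (metis mult_cancel_left zero_neq_numeral)
  moreover have "0 * 1 - 1 * (- 1) = (1::int)" by simp
  ultimately show ?thesis unfolding bqf_equiv_def by blast
qed

text \<open>Strictly obtuse superbases minimise the sum of the three values of the form.\<close>

lemma square_sum_ge_2:
  fixes a b :: int
  assumes "(a, b) \<noteq> (0, 0)"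
  shows "a\<^sup>2 + b\<^sup>2 + (a + b)\<^sup>2 \<ge> 2"
proof -
  define X where "X = a\<^sup>2 + a * b + b\<^sup>2"
  have e: "a\<^sup>2 + b\<^sup>2 + (a + b)\<^sup>2 = 2 * X" by (simp add: X_def power2_eq_square algebra_simps)
  have "0 < a\<^sup>2 + b\<^sup>2" using assms by (auto simp: sum_power2_gt_zero_iff)
  then have "0 < a\<^sup>2 + b\<^sup>2 + (a + b)\<^sup>2" by (rule add_pos_nonneg) simp
  then show ?thesis unfolding e by simp
qed

text \<open>The six minimal vectors of the hexagonal form a^2 + a b + b^2, of which the left side is
  the double.\<close>

lemma square_sum_eq_2:
  fixes a b :: int
  assumes "a\<^sup>2 + b\<^sup>2 + (a + b)\<^sup>2 = 2"
  shows "(a, b) \<in> {(1, 0), (-1, 0), (0, 1), (0, -1), (1, -1), (-1, 1)}"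
proof -
  have "0 \<le> b\<^sup>2" "0 \<le> a\<^sup>2" "0 \<le> (a + b)\<^sup>2" by simp_all
  then have "a\<^sup>2 \<le> 2" "b\<^sup>2 \<le> 2" using assms by linarith+
  have small: "x \<in> {-1, 0, 1}" if "x\<^sup>2 \<le> 2" for x :: int
  proof (rule ccontr)
    assume "x \<notin> {-1, 0, 1}"
    then have "2 \<le> \<bar>x\<bar>" by auto
    then have "2\<^sup>2 \<le> \<bar>x\<bar>\<^sup>2" by (intro power_mono) auto
    with that show False by simp
  qed
  show ?thesis using small[OF \<open>a\<^sup>2 \<le> 2\<close>] small[OF \<open>b\<^sup>2 \<le> 2\<close>] assms by auto
qed

lemma equiv_triple_values:
  assumes "(P, Q, R) \<in> odd_triples M" "(P', Q', R') \<in> odd_triples M"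
    and "\<And>x y. bqf_eval (triple_form (P', Q', R')) x y = bqf_eval (triple_form (P, Q, R)) (p * x + r * y) (s * x + t * y)"
  shows "P' + R' = P * (p - s)\<^sup>2 + Q * s\<^sup>2 + R * p\<^sup>2"
    and "P' + Q' = P * (r - t)\<^sup>2 + Q * t\<^sup>2 + R * r\<^sup>2"
    and "Q' + R' = P * ((p - s) + (r - t))\<^sup>2 + Q * (s + t)\<^sup>2 + R * (p + r)\<^sup>2"
proof -
  have e: "P' * (x - y)\<^sup>2 + Q' * y\<^sup>2 + R' * x\<^sup>2 =
      P * ((p * x + r * y) - (s * x + t * y))\<^sup>2 + Q * (s * x + t * y)\<^sup>2 + R * (p * x + r * y)\<^sup>2" for x y
    using odd_triples_eval[OF assms(1), of "p * x + r * y" "s * x + t * y"] odd_triples_eval[OF assms(2), of x y] assms(3)[of x y]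
    by linarith
  show "P' + R' = P * (p - s)\<^sup>2 + Q * s\<^sup>2 + R * p\<^sup>2" using e[of 1 0] by simp
  show "P' + Q' = P * (r - t)\<^sup>2 + Q * t\<^sup>2 + R * r\<^sup>2" using e[of 0 1] by simp
  show "Q' + R' = P * ((p - s) + (r - t))\<^sup>2 + Q * (s + t)\<^sup>2 + R * (p + r)\<^sup>2" using e[of 1 1] by (simp add: algebra_simps)
qed

text \<open>The values at (1,0), (0,1) and (1,1) add up to twice the sum of the parameters of the
  second form and to a weighted sum of three hexagonal norms. These norms are at least 2 because the
  rows of an invertible matrix and their difference are nonzero.\<close>

lemma equiv_triple_sum:
  assumes "(P, Q, R) \<in> odd_triples M" "(P', Q', R') \<in> odd_triples M" "p * t - r * s = 1"
    and "\<And>x y. bqf_eval (triple_form (P', Q', R')) x y = bqf_eval (triple_form (P, Q, R)) (p * x + r * y) (s * x + t * y)"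
  defines "N \<equiv> \<lambda>a b :: int. a\<^sup>2 + b\<^sup>2 + (a + b)\<^sup>2"
  shows "2 * (P' + Q' + R') = P * N (p - s) (r - t) + Q * N s t + R * N p r"
    and "N (p - s) (r - t) \<ge> 2" "N s t \<ge> 2" "N p r \<ge> 2"
proof -
  show "2 * (P' + Q' + R') = P * N (p - s) (r - t) + Q * N s t + R * N p r"
    unfolding N_def distrib_left using equiv_triple_values[OF assms(1,2,4)] by linarith
  have "(p, r) \<noteq> (0, 0)" "(s, t) \<noteq> (0, 0)" using assms(3) by auto
  moreover have "(p - s, r - t) \<noteq> (0, 0)" using assms(3) by (auto simp: algebra_simps)
  ultimately show "N (p - s) (r - t) \<ge> 2" "N s t \<ge> 2" "N p r \<ge> 2"
    unfolding N_def by (intro square_sum_ge_2; simp)+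
qed

lemma equiv_triple_sum_le:
  assumes "(P, Q, R) \<in> odd_triples M" "(P', Q', R') \<in> odd_triples M"
    "bqf_equiv (triple_form (P, Q, R)) (triple_form (P', Q', R'))"
  shows "P + Q + R \<le> P' + Q' + R'"
proof -
  obtain p r s t where m: "p * t - r * s = 1"
    "\<And>x y. bqf_eval (triple_form (P', Q', R')) x y = bqf_eval (triple_form (P, Q, R)) (p * x + r * y) (s * x + t * y)"
    using assms(3) unfolding bqf_equiv_def by blast
  note e = equiv_triple_sum[OF assms(1,2) m]
  have pos: "0 \<le> P" "0 \<le> Q" "0 \<le> R" using assms(1) by (auto simp: odd_triples_def)
  define A B C where "A = (p - s)\<^sup>2 + (r - t)\<^sup>2 + (p - s + (r - t))\<^sup>2" "B = s\<^sup>2 + t\<^sup>2 + (s + t)\<^sup>2"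
    "C = p\<^sup>2 + r\<^sup>2 + (p + r)\<^sup>2"
  have "2 * (P' + Q' + R') = P * A + Q * B + R * C" "2 \<le> A" "2 \<le> B" "2 \<le> C"
    using e unfolding A_B_C_def by simp_all
  moreover from this have "P * 2 \<le> P * A" "Q * 2 \<le> Q * B" "R * 2 \<le> R * C"
    using pos by (auto intro: mult_left_mono)
  ultimately have "P * 2 + Q * 2 + R * 2 \<le> 2 * (P' + Q' + R')"
    by (metis add_mono)
  then show ?thesis by simp
qed

text \<open>Minimality in both directions gives equal sums. As P, Q, R are strictly positive, all
  three hexagonal norms are then 2, so both rows of the matrix are minimal vectors; determinant 1
  leaves only the rotations, up to sign.\<close>

lemma equiv_triple_rotations:
  assumes "t1 \<in> odd_triples M" "t2 \<in> odd_triples M" "bqf_equiv (triple_form t1) (triple_form t2)"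
  shows "t2 \<in> {t1, rotate_triple t1, rotate_triple (rotate_triple t1)}"
proof -
  obtain P Q R P' Q' R' where tt: "t1 = (P, Q, R)" "t2 = (P', Q', R')" by (metis prod_cases3)
  note a = assms[unfolded tt]
  obtain p r s t where m: "p * t - r * s = 1"
    "\<And>x y. bqf_eval (triple_form (P', Q', R')) x y = bqf_eval (triple_form (P, Q, R)) (p * x + r * y) (s * x + t * y)"
    using a(3) unfolding bqf_equiv_def by blast
  note e = equiv_triple_sum[OF a(1,2) m]
  note v = equiv_triple_values[OF a(1,2) m(2)]
  have pos: "0 < P" "0 < Q" "0 < R" using a(1) by (auto simp: odd_triples_def)
  have eq: "P + Q + R = P' + Q' + R'"
    using equiv_triple_sum_le[OF a] equiv_triple_sum_le[OF a(2,1) bqf_equiv_sym[OF a(3)]] by linarith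
  define A B C where "A = (p - s)\<^sup>2 + (r - t)\<^sup>2 + (p - s + (r - t))\<^sup>2" "B = s\<^sup>2 + t\<^sup>2 + (s + t)\<^sup>2"
    "C = p\<^sup>2 + r\<^sup>2 + (p + r)\<^sup>2"
  have "P * (A - 2) + Q * (B - 2) + R * (C - 2) = 0"
    using e(1) eq by (simp add: A_B_C_def algebra_simps)
  moreover have "0 \<le> P * (A - 2)" "0 \<le> Q * (B - 2)" "0 \<le> R * (C - 2)"
    using e(2-4) pos by (simp_all add: A_B_C_def)
  ultimately have "P * (A - 2) = 0" "Q * (B - 2) = 0" "R * (C - 2) = 0" by linarith+
  then have "A = 2" "B = 2" "C = 2" using pos by auto
  then have d: "(p - s)\<^sup>2 + (r - t)\<^sup>2 + (p - s + (r - t))\<^sup>2 = 2"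
    and st: "(s, t) \<in> {(1, 0), (-1, 0), (0, 1), (0, -1), (1, -1), (-1, 1)}"
    and pr: "(p, r) \<in> {(1, 0), (-1, 0), (0, 1), (0, -1), (1, -1), (-1, 1)}"
    unfolding A_B_C_def using square_sum_eq_2[of s t] square_sum_eq_2[of p r] by simp_all
  define f1 f2 f3 where "f1 = P * (p - s)\<^sup>2 + Q * s\<^sup>2 + R * p\<^sup>2" "f2 = P * (r - t)\<^sup>2 + Q * t\<^sup>2 + R * r\<^sup>2"
    "f3 = P * ((p - s) + (r - t))\<^sup>2 + Q * (s + t)\<^sup>2 + R * (p + r)\<^sup>2"
  have w: "2 * P' = f1 + f2 - f3" "2 * Q' = f2 + f3 - f1" "2 * R' = f1 + f3 - f2"
    using v unfolding f1_f2_f3_def[symmetric] by linarith+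
  have "(f1 + f2 - f3, f2 + f3 - f1, f1 + f3 - f2) \<in> {(2 * P, 2 * Q, 2 * R), (2 * Q, 2 * R, 2 * P), (2 * R, 2 * P, 2 * Q)}"
    using pr st d m(1) unfolding f1_f2_f3_def by (elim insertE emptyE Pair_inject; hypsubst; simp)
  then show ?thesis unfolding w[symmetric] tt by auto
qed

text \<open>Descent on 2a + b + 2c = f(1,0) + f(0,1) + f(1,1), positive for a positive definite
  form. If one of -b, 2c + b, 2a + b is negative, a change of superbase lowers it. Since the
  discriminant is odd, so is b; none of the three is 0 and the final superbase is strictly
  obtuse.\<close>

lemma reduce_form:
  assumes "f \<in> pos_forms M" "odd M"
  shows "\<exists>t\<in>odd_triples M. bqf_equiv f (triple_form t)"
proof -
  have "\<forall>f. f \<in> pos_forms M \<and> (case f of (a, b, c) \<Rightarrow> nat (2 * a + b + 2 * c)) = k \<longrightarrow>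
      (\<exists>t\<in>odd_triples M. bqf_equiv f (triple_form t))" for k
  proof (induction k rule: less_induct)
    case (less k)
    show ?case
    proof (intro allI impI)
      fix f assume f: "f \<in> pos_forms M \<and> (case f of (a, b, c) \<Rightarrow> nat (2 * a + b + 2 * c)) = k"
      obtain a b c where abc: "f = (a, b, c)" by (metis prod_cases3)
      have pd: "bqf_pos_def f" and disc: "b\<^sup>2 - 4 * a * c = - int M" and k: "k = nat (2 * a + b + 2 * c)"
        using f by (auto simp: pos_forms_def abc)
      have step: "\<exists>t\<in>odd_triples M. bqf_equiv f (triple_form t)"
        if g: "bqf_equiv f (a', b', c')" "b'\<^sup>2 - 4 * a' * c' = b\<^sup>2 - 4 * a * c" "2 * a' + b' + 2 * c' < 2 * a + b + 2 * c"
        for a' b' c'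
      proof -
        have pd': "bqf_pos_def (a', b', c')" by (rule bqf_pos_def_equiv[OF pd g(1)])
        have "0 < bqf_eval (a', b', c') 1 0" "0 < bqf_eval (a', b', c') 0 1" "0 < bqf_eval (a', b', c') 1 1"
          using pd'[unfolded bqf_pos_def_def, rule_format, of 1 0] pd'[unfolded bqf_pos_def_def, rule_format, of 0 1]
            pd'[unfolded bqf_pos_def_def, rule_format, of 1 1] by simp_all
        then have "0 < 2 * a' + b' + 2 * c'" by simp
        then have lt: "nat (2 * a' + b' + 2 * c') < k" using g(3) k by simp
        have "(a', b', c') \<in> pos_forms M" using pd' g(2) disc by (simp add: pos_forms_def)
        then obtain t where "t \<in> odd_triples M" "bqf_equiv (a', b', c') (triple_form t)"
          using less.IH[OF lt, rule_format, of "(a', b', c')"] by auto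
        then show ?thesis using bqf_equiv_trans[OF g(1)] by blast
      qed
      have odd_b: "odd b"
      proof
        assume "even b"
        then have "even (b\<^sup>2 - 4 * a * c)" by simp
        then show False using disc assms(2) by simp
      qed
      then have nz: "b \<noteq> 0" "2 * a + b \<noteq> 0" "2 * c + b \<noteq> 0" by presburger+
      consider "b > 0" | "2 * a + b < 0" | "2 * c + b < 0" | "b < 0" "2 * a + b > 0" "2 * c + b > 0"
        using nz by linarith
      then show "\<exists>t\<in>odd_triples M. bqf_equiv f (triple_form t)"
      proof cases
        case 1
        show ?thesis
        proof (rule step)
          show "bqf_equiv f (c, - b, a)"
            unfolding bqf_equiv_def abc
            by (rule exI[of _ 0], rule exI[of _ "- 1"], rule exI[of _ 1], rule exI[of _ 0]) (simp add: algebra_simps)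
        qed (use 1 in \<open>simp_all add: algebra_simps\<close>)
      next
        case 2
        show ?thesis
        proof (rule step)
          show "bqf_equiv f (a, 2 * a + b, a + b + c)"
            unfolding bqf_equiv_def abc
            by (rule exI[of _ 1], rule exI[of _ 1], rule exI[of _ 0], rule exI[of _ 1])
              (simp add: algebra_simps power2_eq_square)
        qed (use 2 in \<open>simp_all add: algebra_simps power2_eq_square\<close>)
      next
        case 3
        show ?thesis
        proof (rule step)
          show "bqf_equiv f (a + b + c, 2 * c + b, c)"
            unfolding bqf_equiv_def abc
            by (rule exI[of _ 1], rule exI[of _ 0], rule exI[of _ 1], rule exI[of _ 1])
              (simp add: algebra_simps power2_eq_square)
        qed (use 3 in \<open>simp_all add: algebra_simps power2_eq_square\<close>)
      next
        case 4
        define t where "t = (- b, 2 * c + b, 2 * a + b)"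
        have "t \<in> odd_triples M"
          using 4 odd_b disc by (simp add: t_def odd_triples_def algebra_simps power2_eq_square)
        moreover have "triple_form t = f" by (simp add: t_def abc)
        ultimately show ?thesis using bqf_equiv_refl by metis
      qed
    qed
  qed
  then show ?thesis using assms(1) by blast
qed

lemma finite_odd_triples: "finite (odd_triples M)"
proof (rule finite_subset)
  have le: "P \<le> int M" if "0 < P" "0 < Q" "0 < R" "P * Q + Q * R + R * P = int M" for P Q R :: int
  proof -
    have "P * 1 \<le> P * Q" using that by (intro mult_left_mono) auto
    moreover have "0 \<le> Q * R" "0 \<le> R * P" using that by auto
    ultimately show ?thesis using that(4) by linarith
  qed
  show "odd_triples M \<subseteq> {0..int M} \<times> {0..int M} \<times> {0..int M}"
  proof
    fix t assume t: "t \<in> odd_triples M"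
    obtain P Q R where tt: "t = (P, Q, R)" by (metis prod_cases3)
    show "t \<in> {0..int M} \<times> {0..int M} \<times> {0..int M}"
      using t le[of P Q R] le[of Q R P] le[of R P Q] by (auto simp: tt odd_triples_def algebra_simps)
  qed
qed auto

section \<open>Form classes as rotation orbits of triples\<close>

definition form_rel :: "nat \<Rightarrow> (bqf \<times> bqf) set" where
  "form_rel M = {(f, g). f \<in> pos_forms M \<and> g \<in> pos_forms M \<and> bqf_equiv f g}"

lemma equiv_form_rel: "equiv (pos_forms M) (form_rel M)"
  unfolding equiv_def form_rel_def refl_on_def sym_def trans_def
  using bqf_equiv_refl bqf_equiv_sym bqf_equiv_trans by blast

text \<open>The triples belonging to one class form one rotation orbit, of size 3, or of size 1 when
  P = Q = R. The latter is the class of a multiple of x^2 + x y + y^2, of weight 1/3, so orbit size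
  is always three times the weight. Weight 1/2 would need the even discriminant -4 m^2.\<close>

lemma hurwitz_eq_card:
  assumes "M mod 4 = 3"
  shows "3 * hurwitz M = real (card (odd_triples M))"
proof -
  have oddM: "odd M" using assms by presburger
  define T where "T = odd_triples M"
  define cls where "cls t = form_rel M `` {triple_form t}" for t
  have fT: "finite T" by (simp add: T_def finite_odd_triples)
  have classes: "form_classes M = cls ` T"
  proof
    show "form_classes M \<subseteq> cls ` T"
    proof
      fix C assume "C \<in> form_classes M"
      then obtain f where f: "f \<in> pos_forms M" "C = form_rel M `` {f}"
        unfolding form_classes_def form_rel_def[symmetric] by (rule quotientE)
      obtain t where t: "t \<in> T" "bqf_equiv f (triple_form t)"
        using reduce_form[OF f(1) oddM] by (auto simp: T_def)
      then have "(f, triple_form t) \<in> form_rel M"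
        using f(1) triple_form_pos_forms by (auto simp: form_rel_def T_def)
      then have "C = cls t" unfolding f(2) cls_def by (rule equiv_class_eq[OF equiv_form_rel])
      then show "C \<in> cls ` T" using t by blast
    qed
    show "cls ` T \<subseteq> form_classes M"
      unfolding form_classes_def form_rel_def[symmetric] cls_def T_def
      by (auto intro!: quotientI triple_form_pos_forms)
  qed
  have rot: "bqf_equiv (triple_form t) (triple_form (rotate_triple t))"
    "bqf_equiv (triple_form t) (triple_form (rotate_triple (rotate_triple t)))" if "t \<in> T" for t
    using that rotate_equiv rotate_odd_triples bqf_equiv_trans unfolding T_def by blast+
  have cls_eq: "cls t = cls u \<longleftrightarrow> bqf_equiv (triple_form t) (triple_form u)" if "t \<in> T" "u \<in> T" for t u
    using eq_equiv_class_iff[OF equiv_form_rel, of "triple_form t" M "triple_form u"] that triple_form_pos_forms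
    by (auto simp: cls_def form_rel_def T_def)
  have fibre: "{u \<in> T. cls u = cls t} = {t, rotate_triple t, rotate_triple (rotate_triple t)}" if "t \<in> T" for t
  proof
    show "{u \<in> T. cls u = cls t} \<subseteq> {t, rotate_triple t, rotate_triple (rotate_triple t)}"
      using cls_eq that equiv_triple_rotations bqf_equiv_sym unfolding T_def by blast
    have "rotate_triple t \<in> T" "rotate_triple (rotate_triple t) \<in> T"
      using that rotate_odd_triples unfolding T_def by blast+
    moreover from this have "cls t = cls (rotate_triple t)" "cls t = cls (rotate_triple (rotate_triple t))"
      using cls_eq[OF that] rot[OF that] by simp_all
    ultimately show "{t, rotate_triple t, rotate_triple (rotate_triple t)} \<subseteq> {u \<in> T. cls u = cls t}"
      using that by auto
  qed
  have weight: "3 * class_weight (cls t) = real (card {u \<in> T. cls u = cls t})" if t: "t \<in> T" for t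
  proof -
    obtain P Q R where tt: "t = (P, Q, R)" by (metis prod_cases3)
    have mem: "g \<in> cls t \<longleftrightarrow> g \<in> pos_forms M \<and> bqf_equiv (triple_form t) g" for g
      using t triple_form_pos_forms by (auto simp: cls_def form_rel_def T_def)
    have no: "\<not> (\<exists>m. (m, 0, m) \<in> cls t)"
    proof
      assume "\<exists>m. (m, 0, m) \<in> cls t"
      then obtain m where "(m, 0, m) \<in> pos_forms M" using mem by blast
      then have "int M = 4 * m * m" by (simp add: pos_forms_def)
      then have "even (int M)" by simp
      then show False using oddM by simp
    qed
    \<comment> \<open>The triple (m, m, m) gives middle coefficient -m; a quarter turn brings the
      form to the shape tested by \<open>class_weight\<close>.\<close>
    have mmm: "bqf_equiv (m, - m, m) (m, m, m)" for m
      unfolding bqf_equiv_def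
      by (rule exI[of _ 0], rule exI[of _ 1], rule exI[of _ "- 1"], rule exI[of _ 0]) (simp add: algebra_simps)
    have "(\<exists>m. (m, m, m) \<in> cls t) \<longleftrightarrow> P = Q \<and> Q = R"
    proof
      assume "P = Q \<and> Q = R"
      then have tf: "triple_form t = (P, - P, P)" by (simp add: tt)
      have "(P, P, P) \<in> pos_forms M"
        using triple_form_pos_forms[of t M] t bqf_pos_def_equiv[OF _ mmm[of P]] unfolding tf T_def
        by (auto simp: pos_forms_def)
      then show "\<exists>m. (m, m, m) \<in> cls t" using mem mmm tf by auto
    next
      assume "\<exists>m. (m, m, m) \<in> cls t"
      then obtain m where m: "(m, m, m) \<in> pos_forms M" "bqf_equiv (triple_form t) (m, m, m)" using mem by blast
      have M: "int M = 3 * m * m" using m(1) by (simp add: pos_forms_def power2_eq_square)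
      have "bqf_pos_def (m, m, m)" using m(1) by (simp add: pos_forms_def)
      from this[unfolded bqf_pos_def_def, rule_format, of 1 0] have m0: "0 < m" by simp
      have "odd m" using M oddM by (metis even_mult_iff even_of_nat)
      then have mT: "(m, m, m) \<in> T" using M m0 by (simp add: T_def odd_triples_def)
      have "bqf_equiv (triple_form (m, m, m)) (triple_form t)"
        using bqf_equiv_trans[OF mmm[of m] bqf_equiv_sym[OF m(2)]] by simp
      then have "t \<in> {(m, m, m)}"
        using equiv_triple_rotations[of "(m, m, m)" M t] mT t unfolding T_def by auto
      then show "P = Q \<and> Q = R" by (simp add: tt)
    qed
    then have "class_weight (cls t) = (if P = Q \<and> Q = R then 1 / 3 else 1)"
      using no by (simp add: class_weight_def)
    moreover have "card {t, rotate_triple t, rotate_triple (rotate_triple t)} = (if P = Q \<and> Q = R then 1 else 3)"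
      by (cases "P = Q"; cases "Q = R"; cases "R = P"; simp add: tt)
    ultimately show ?thesis unfolding fibre[OF t] by simp
  qed
  have "real (card T) = (\<Sum>t\<in>T. 1)" by simp
  also have "\<dots> = (\<Sum>C\<in>cls ` T. \<Sum>t\<in>{t \<in> T. cls t = C}. 1)"
    by (rule sum.image_gen[OF fT])
  also have "\<dots> = (\<Sum>C\<in>cls ` T. 3 * class_weight C)"
    by (rule sum.cong) (use weight in auto)
  also have "\<dots> = 3 * hurwitz M"
    using assms by (simp add: hurwitz_def classes sum_distrib_left)
  finally show ?thesis by (simp add: T_def)
qed

section \<open>From the Hurwitz class number to \<open>F\<close>\<close>

lemma triple_mod_8:
  fixes P Q R :: int
  assumes "odd P" "odd Q" "odd R"
  shows "(P * Q + Q * R + R * P) mod 8 = (if P mod 4 = Q mod 4 \<and> Q mod 4 = R mod 4 then 3 else 7)"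
proof -
  have c: "x mod 8 \<in> {1, 3, 5, 7}" if "odd x" for x :: int using that by (auto; presburger)
  define p q r where "p = P mod 8" "q = Q mod 8" "r = R mod 8"
  have "(P * Q + Q * R + R * P) mod 8 = (p * q + q * r + r * p) mod 8"
    unfolding p_q_r_def by (intro mod_add_cong) (simp_all add: mod_mult_eq)
  moreover have "\<forall>p\<in>{1, 3, 5, 7}. \<forall>q\<in>{1, 3, 5, 7}. \<forall>r\<in>{1, 3, 5, 7::int}.
      (p * q + q * r + r * p) mod 8 = (if p mod 4 = q mod 4 \<and> q mod 4 = r mod 4 then 3 else 7)"
    by code_simp
  then have "(p * q + q * r + r * p) mod 8 = (if p mod 4 = q mod 4 \<and> q mod 4 = r mod 4 then 3 else 7)"
    using c[OF assms(1)] c[OF assms(2)] c[OF assms(3)] unfolding p_q_r_def[symmetric] by blast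
  moreover have "p mod 4 = P mod 4" "q mod 4 = Q mod 4" "r mod 4 = R mod 4"
    by (simp_all add: p_q_r_def mod_mod_cancel)
  ultimately show ?thesis by (simp only:)
qed

text \<open>If M is 3 modulo 8, all entries agree modulo 4, so the condition is automatic and the
  count is 3 H(M). If M is 7 modulo 8, exactly one of the three pairs agrees, since only two odd
  residues exist; rotations carry the three cases into each other, so the count is a third of 3
  H(M).\<close>

lemma F_eq_card:
  assumes "M mod 4 = 3"
  shows "F (int M) = real (card {(P, Q, R) \<in> odd_triples M. P mod 4 = Q mod 4})"
proof -
  define T where "T = odd_triples M"
  define A where "A = {(P, Q, R) \<in> T. P mod 4 = Q mod 4}"
  have h: "3 * hurwitz M = real (card T)" using hurwitz_eq_card[OF assms] by (simp add: T_def)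
  have fT: "finite T" by (simp add: T_def finite_odd_triples)
  have T8: "int M mod 8 = (if P mod 4 = Q mod 4 \<and> Q mod 4 = R mod 4 then 3 else 7)" and
    Todd: "odd P" "odd Q" "odd R" if "(P, Q, R) \<in> T" for P Q R
    using that triple_mod_8[of P Q R] by (auto simp: T_def odd_triples_def)
  have "M mod 8 = 3 \<or> M mod 8 = 7" using assms by presburger
  then consider "M mod 8 = 3" | "M mod 8 = 7" by blast
  then have "F (int M) = real (card A)"
  proof cases
    case 1
    then have "int M mod 8 = 3" by (metis of_nat_mod of_nat_numeral)
    moreover have "P mod 4 = Q mod 4" if "(P, Q, R) \<in> T" for P Q R
      using T8[OF that] \<open>int M mod 8 = 3\<close> by (auto split: if_splits)
    then have "A = T" by (auto simp: A_def)
    ultimately show ?thesis using h by (simp add: F_def)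
  next
    case 2
    then have M8: "int M mod 8 = 7" by (metis of_nat_mod of_nat_numeral)
    define A1 where "A1 = {(P, Q, R) \<in> T. Q mod 4 = R mod 4}"
    define A2 where "A2 = {(P, Q, R) \<in> T. R mod 4 = P mod 4}"
    have rotT: "(Q, R, P) \<in> T \<and> (R, P, Q) \<in> T" if "(P, Q, R) \<in> T" for P Q R
      using that by (auto simp: T_def odd_triples_def algebra_simps)
    have "bij_betw (\<lambda>(P, Q, R). (R, P, Q)) A A1"
    proof (rule bij_betw_byWitness[where f' = "\<lambda>(P, Q, R). (Q, R, P)"])
      show "(\<lambda>(P, Q, R). (R, P, Q)) ` A \<subseteq> A1" "(\<lambda>(P, Q, R). (Q, R, P)) ` A1 \<subseteq> A"
        unfolding A_def A1_def by (clarsimp, drule rotT, simp)+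
    qed auto
    moreover have "bij_betw (\<lambda>(P, Q, R). (Q, R, P)) A A2"
    proof (rule bij_betw_byWitness[where f' = "\<lambda>(P, Q, R). (R, P, Q)"])
      show "(\<lambda>(P, Q, R). (Q, R, P)) ` A \<subseteq> A2" "(\<lambda>(P, Q, R). (R, P, Q)) ` A2 \<subseteq> A"
        unfolding A_def A2_def by (clarsimp, drule rotT, simp)+
    qed auto
    ultimately have c: "card A1 = card A" "card A2 = card A" by (auto dest: bij_betw_same_card)
    have cover: "P mod 4 = Q mod 4 \<or> Q mod 4 = R mod 4 \<or> R mod 4 = P mod 4" if "(P, Q, R) \<in> T" for P Q R
      using Todd[OF that] by presburger
    have T: "T = (A \<union> A1) \<union> A2"
      using cover by (fastforce simp: A_def A1_def A2_def)
    have d: "A \<inter> A1 = {}" "(A \<union> A1) \<inter> A2 = {}"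
      using T8 M8 by (fastforce simp: A_def A1_def A2_def)+
    have "A \<subseteq> T" "A1 \<subseteq> T" "A2 \<subseteq> T" by (auto simp: A_def A1_def A2_def)
    then have fin: "finite A" "finite A1" "finite A2" using fT finite_subset by blast+
    have "card T = card A + card A1 + card A2"
      unfolding T using d fin by (simp add: card_Un_disjoint)
    then show ?thesis using h c M8 by (simp add: F_def)
  qed
  then show ?thesis by (simp add: A_def T_def)
qed

subsection \<open>The dissection modulo 3\<close>

definition cone_fibre :: "nat \<Rightarrow> (nat \<times> nat \<times> int) set" where
  "cone_fibre N = {(r, n, j). (n, j) \<in> cone \<and> cexp r n j = int N}"

lemma finite_cone_fibre: "finite (cone_fibre N)"
proof (rule finite_subset)
  show "cone_fibre N \<subseteq> {..N} \<times> {..N} \<times> {- int N..int N}"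
  proof
    fix x assume x: "x \<in> cone_fibre N"
    obtain r n j where xe: "x = (r, n, j)" by (metis prod_cases3)
    have "int r + int n + \<bar>j\<bar> + 1 \<le> int N"
      using x cexp_ge[of j n r] by (auto simp: xe cone_fibre_def cone_def)
    then show "x \<in> {..N} \<times> {..N} \<times> {- int N..int N}" by (auto simp: xe)
  qed
qed auto

fun cone_to_triple :: "nat \<times> nat \<times> int \<Rightarrow> int \<times> int \<times> int" where
  "cone_to_triple (r, n, j) = (2 * int n + 1 + 2 * j, 2 * int n + 1 - 2 * j, 2 * int r + 1)"

fun triple_to_cone :: "int \<times> int \<times> int \<Rightarrow> nat \<times> nat \<times> int" where
  "triple_to_cone (P, Q, R) = (nat ((R - 1) div 2), nat ((P + Q - 2) div 4), (P - Q) div 4)"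

lemma card_cone_fibre: "F (4 * int N - 1) = real (card (cone_fibre N))"
proof (cases "N = 0")
  \<comment> \<open>Treated apart because 4 N - 1 is truncated to 0 in the natural numbers, whereas
    the integer argument of \<open>F\<close> is -1.\<close>
  case True
  have "cone_fibre 0 = {}"
  proof (rule equals0I)
    fix x assume x: "x \<in> cone_fibre 0"
    obtain r n j where xe: "x = (r, n, j)" by (metis prod_cases3)
    show False using x cexp_ge[of j n r] by (auto simp: xe cone_fibre_def cone_def)
  qed
  then show ?thesis by (simp add: True F_def)
next
  case False
  define M where "M = 4 * N - 1"
  have "M + 1 = 4 * N" using False by (simp add: M_def)
  then have M: "int M = 4 * int N - 1" "M mod 4 = 3" by presburger+
  define A where "A = {(P, Q, R) \<in> odd_triples M. P mod 4 = Q mod 4}"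
  have val: "(2 * n + 1 + 2 * j) * (2 * n + 1 - 2 * j) + (2 * n + 1 - 2 * j) * (2 * r + 1) + (2 * r + 1) * (2 * n + 1 + 2 * j) =
      4 * (n\<^sup>2 + (2 * n + 1) * (r + 1) - j\<^sup>2) - 1" for n j r :: int
    by algebra
  have "bij_betw cone_to_triple (cone_fibre N) A"
  proof (rule bij_betw_byWitness[where f' = triple_to_cone])
    show "\<forall>x\<in>cone_fibre N. triple_to_cone (cone_to_triple x) = x"
      by auto
    \<comment> \<open>P = Q modulo 4 makes j an integer; then P + Q - 2 = 2 (Q - 1) + 4 j with Q
      odd, so n is an integer as well.\<close>
    have inv: "2 * int (nat ((R - 1) div 2)) + 1 = R \<and> 2 * int (nat ((P + Q - 2) div 4)) + 1 + 2 * ((P - Q) div 4) = P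
        \<and> 2 * int (nat ((P + Q - 2) div 4)) + 1 - 2 * ((P - Q) div 4) = Q"
      if asm: "odd P" "odd Q" "odd R" "0 < P" "0 < Q" "0 < R" "P mod 4 = Q mod 4" for P Q R
    proof -
      obtain r where r: "R = 2 * r + 1" using asm(3) by (rule oddE)
      obtain m where m: "Q = 2 * m + 1" using asm(2) by (rule oddE)
      have "4 dvd P - Q" using that(7) by (simp add: mod_eq_dvd_iff)
      then obtain l where l: "P = Q + 4 * l" by (metis dvdE add_diff_cancel_left' diff_add_cancel add.commute)
      have d: "(R - 1) div 2 = r" "(P - Q) div 4 = l" by (simp_all add: r l)
      have "P + Q - 2 = 4 * (m + l)" by (simp add: l m)
      then have d': "(P + Q - 2) div 4 = m + l" by simp
      have "0 \<le> r" "0 \<le> m + l" using that(4-6) by (simp_all add: r l m)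
      then show ?thesis unfolding d d' by (simp add: r l m)
    qed
    show "\<forall>x\<in>A. cone_to_triple (triple_to_cone x) = x"
    proof (rule ballI)
      fix x assume x: "x \<in> A"
      obtain P Q R where xe: "x = (P, Q, R)" by (metis prod_cases3)
      have h: "odd P" "odd Q" "odd R" "0 < P" "0 < Q" "0 < R" "P mod 4 = Q mod 4"
        using x by (auto simp: xe A_def odd_triples_def)
      show "cone_to_triple (triple_to_cone x) = x"
        unfolding xe triple_to_cone.simps cone_to_triple.simps by (simp only: inv[OF h])
    qed
    show "cone_to_triple ` cone_fibre N \<subseteq> A"
    proof (rule image_subsetI)
      fix x assume x: "x \<in> cone_fibre N"
      obtain r n j where xe: "x = (r, n, j)" by (metis prod_cases3)
      have h: "\<bar>j\<bar> \<le> int n" "cexp r n j = int N" using x by (auto simp: xe cone_fibre_def cone_def)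
      have "(2 * int n + 1 + 2 * j) mod 4 = (2 * int n + 1 - 2 * j) mod 4" by (simp add: mod_eq_dvd_iff)
      moreover have "0 < 2 * int n + 1 + 2 * j" "0 < 2 * int n + 1 - 2 * j" using h(1) by linarith+
      ultimately show "cone_to_triple x \<in> A"
        using h val[of "int n" j "int r"] by (simp add: xe A_def odd_triples_def M(1) cexp_def)
    qed
    show "triple_to_cone ` A \<subseteq> cone_fibre N"
    proof (rule image_subsetI)
      fix x assume x: "x \<in> A"
      obtain P Q R where xe: "x = (P, Q, R)" by (metis prod_cases3)
      define r n j where "r = nat ((R - 1) div 2)" "n = nat ((P + Q - 2) div 4)" "j = (P - Q) div 4"
      have h: "odd P" "odd Q" "odd R" "0 < P" "0 < Q" "0 < R" "P mod 4 = Q mod 4" "P * Q + Q * R + R * P = int M"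
        using x by (auto simp: xe A_def odd_triples_def)
      have e: "R = 2 * int r + 1" "P = 2 * int n + 1 + 2 * j" "Q = 2 * int n + 1 - 2 * j"
        using inv[OF h(1-7)] by (auto simp: r_n_j_def)
      have "4 * cexp r n j = 4 * int N"
        using h(8) val[of "int n" j "int r"] unfolding M(1) e cexp_def by linarith
      moreover have "\<bar>j\<bar> \<le> int n" using h(4,5) unfolding e by linarith
      ultimately show "triple_to_cone x \<in> cone_fibre N"
        unfolding xe triple_to_cone.simps r_n_j_def[symmetric] by (simp add: cone_fibre_def cone_def)
    qed
  qed
  then have "card (cone_fibre N) = card A" by (rule bij_betw_same_card)
  moreover have "F (int M) = real (card A)" unfolding A_def by (rule F_eq_card[OF M(2)])
  ultimately show ?thesis by (simp add: M(1))
qed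

lemma cone_sum_power_series:
  assumes "norm q < 1"
  shows "(\<lambda>N. of_real (F (4 * int N - 1)) * q ^ N) abs_summable_on UNIV"
    and "cone_sum q = (\<Sum>\<^sub>\<infinity>N. of_real (F (4 * int N - 1)) * q ^ N)"
proof -
  define Y where "Y = (UNIV :: nat set) \<times> cone"
  have pos: "0 \<le> cexp r n j" if "(n, j) \<in> cone" for r n j
    using that cexp_ge[of j n r] by (auto simp: cone_def)
  have c: "(\<Sum>\<^sub>\<infinity>x\<in>cone_fibre N. q ^ N) = of_real (F (4 * int N - 1)) * q ^ N" for N
    by (simp add: finite_cone_fibre card_cone_fibre)
  have s: "(\<lambda>(r, n, j). q powi cexp r n j) summable_on Y"
    unfolding Y_def by (rule abs_summable_summable[OF cone_abs_summable[OF assms]])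
  have w: "(\<lambda>(r, n, j). q powi cexp r n j) summable_on Y \<longleftrightarrow> (\<lambda>(N, x). q ^ N) summable_on Sigma UNIV cone_fibre"
    by (rule summable_on_reindex_bij_witness[of _ "\<lambda>(N, x). x" "\<lambda>(r, n, j). (nat (cexp r n j), (r, n, j))"])
      (use pos in \<open>auto simp: Y_def cone_fibre_def power_int_def\<close>)
  have "(\<Sum>\<^sub>\<infinity>(r, n, j)\<in>Y. q powi cexp r n j) = (\<Sum>\<^sub>\<infinity>(N, x)\<in>Sigma UNIV cone_fibre. q ^ N)"
    by (rule infsum_reindex_bij_witness[of _ "\<lambda>(N, x). x" "\<lambda>(r, n, j). (nat (cexp r n j), (r, n, j))"])
      (use pos in \<open>auto simp: Y_def cone_fibre_def power_int_def\<close>)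
  also have "\<dots> = (\<Sum>\<^sub>\<infinity>N. \<Sum>\<^sub>\<infinity>x\<in>cone_fibre N. q ^ N)"
    using infsum_Sigma'_banach[of "\<lambda>N x. q ^ N" UNIV cone_fibre] s w by simp
  finally show "cone_sum q = (\<Sum>\<^sub>\<infinity>N. of_real (F (4 * int N - 1)) * q ^ N)"
    by (simp add: cone_sum_def Y_def c)
  have "(\<lambda>N. \<Sum>\<^sub>\<infinity>x\<in>cone_fibre N. q ^ N) summable_on UNIV"
    using summable_on_Sigma_banach[of "\<lambda>N x. q ^ N" UNIV cone_fibre] s w by simp
  then have "(\<lambda>N. of_real (F (4 * int N - 1)) * q ^ N) summable_on UNIV" unfolding c .
  then show "(\<lambda>N. of_real (F (4 * int N - 1)) * q ^ N) abs_summable_on UNIV"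
    by (rule iffD1[OF summable_on_iff_abs_summable_on_complex])
qed

section \<open>Residue classes modulo 3, with x = q^3\<close>

lemma cube_powi: "q ^ 3 = x \<Longrightarrow> q powi (3 * k) = x powi k" for q x :: complex
  using power_powi[of q 3 k] by simp

lemma th_3:
  assumes "q ^ 3 = x"
  shows "th q (3 * k) = (-1) powi k * x powi (3 * k\<^sup>2)"
proof -
  have "(3 * k)\<^sup>2 = 3 * (3 * k\<^sup>2)" by (simp add: power2_eq_square)
  moreover have "(-1) powi (3 * k) = ((-1) powi k :: complex)" by (simp add: power_int_minus_left)
  ultimately show ?thesis unfolding th_def by (simp only: cube_powi[OF assms])
qed

lemma infsum_th9_cube:
  assumes "q \<noteq> 0" "q ^ 3 = x"
  shows "infsum (th9 q) UNIV = theta (x ^ 3) (x ^ 6)"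
proof -
  have "infsum (th9 q) UNIV = (\<Sum>\<^sub>\<infinity>k. th9 q (3 * k))"
    by (rule infsum_int_multiples) (auto simp: th9_def)
  also have "\<dots> = infsum (th (x ^ 3)) UNIV"
  proof (rule infsum_cong)
    fix k
    have "th9 q (3 * k) = th q (3 * k)" by (simp add: th9_def)
    also have "\<dots> = th (x ^ 3) k"
      unfolding th_3[OF assms(2)] by (simp add: th_def power_powi[of x 3, simplified])
    finally show "th9 q (3 * k) = th (x ^ 3) k" .
  qed
  also have "\<dots> = theta (x ^ 3) (x ^ 6)"
    using infsum_th[of "x ^ 3"] assms by (auto simp flip: power_mult)
  finally show ?thesis .
qed

text \<open>The class n = 3k - 1 of the Lambert series for \<open>th9\<close>, freed from q^(-2).
  The factor q^(-2) makes it cancel in the average over cube roots of x.\<close>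

definition zsum :: "complex \<Rightarrow> complex" where
  "zsum x = (\<Sum>\<^sub>\<infinity>k. of_int (6 * k - 3) * ((-1) powi k * x powi (3 * k\<^sup>2)) / (1 + x powi (6 * k - 3)))"

text \<open>The weight n is replaced by 2n - 1, which changes sign under n -> 1 - n like the Lambert
  coefficients; the added constant sums to 0. The products are then symmetric, so the classes 3k and
  3k - 2 contribute equally and the 2 cancels. At n = 3k the weight is the 6k - 1 of the
  theorem.\<close>

lemma infsum_lambert_th9:
  assumes "norm q < 1" "q \<noteq> 0" "q ^ 3 = x"
  shows "bilateral_expr k x = - (of_int (6 * k - 1) * lambert q (th9 q) (3 * k))"
    and "(\<lambda>k. bilateral_expr k x) summable_on UNIV"
    and "- (\<Sum>\<^sub>\<infinity>n. of_int n * lambert q (th9 q) n) = (\<Sum>\<^sub>\<infinity>k. bilateral_expr k x) - q powi (-2) / 2 * zsum x"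
proof -
  define c where "c = lambert q (th9 q)"
  define S where "S n = of_int (2 * n - 1) * c n" for n
  note g = theta_type_th9[OF assms(1,2)]
  have cs: "c summable_on UNIV" "(\<lambda>n. of_int n * c n) summable_on UNIV"
    unfolding c_def by (intro gauss_bounded_summable gauss_bounded_mult_of_int gauss_bounded_lambert[OF assms(1,2) g])+
  have cr: "c (1 - n) = - c n" for n unfolding c_def by (rule lambert_reflect[OF assms(1,2) g])
  have Sr: "S (1 - n) = S n" for n by (simp add: S_def cr algebra_simps)
  have S2: "S n = 2 * (of_int n * c n) - c n" for n by (simp add: S_def algebra_simps)
  have Ss: "S summable_on UNIV"
    unfolding S2[abs_def] by (rule summable_on_diff) (intro summable_on_cmult_right cs)+
  have p: "q powi (18 * k - 3) = x powi (6 * k - 1)" "q powi (18 * k - 9) = x powi (6 * k - 3)" for k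
    using cube_powi[OF assms(3), of "6 * k - 1"] cube_powi[OF assms(3), of "6 * k - 3"] by (simp_all add: algebra_simps)
  have S0: "S (3 * k) = - bilateral_expr k x" for k
    unfolding S_def c_def lambert_th9(1)[OF assms(2)] th_3[OF assms(3)] p bilateral_expr_def
    by (simp add: power_int_diff)
  then show "bilateral_expr k x = - (of_int (6 * k - 1) * lambert q (th9 q) (3 * k))"
    by (simp add: S_def c_def)
  have S1: "S (3 * k - 1) = q powi (-2) * (of_int (6 * k - 3) * ((-1) powi k * x powi (3 * k\<^sup>2)) / (1 + x powi (6 * k - 3)))" for k
    unfolding S_def c_def lambert_th9(2)[OF assms(2)] th_3[OF assms(3)] p by (simp add: algebra_simps)
  have "S summable_on {n. 3 dvd n}" by (rule summable_on_subset_banach[OF Ss]) simp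
  also have "?this \<longleftrightarrow> (\<lambda>k. S (3 * k)) summable_on UNIV"
    by (rule summable_on_reindex_bij_witness[of _ "\<lambda>k. 3 * k" "\<lambda>n. n div 3"]) auto
  finally have "(\<lambda>k. - S (3 * k)) summable_on UNIV" by (simp only: summable_on_uminus)
  then show "(\<lambda>k. bilateral_expr k x) summable_on UNIV" by (simp add: S0)
  have "infsum S UNIV = 2 * (\<Sum>\<^sub>\<infinity>n. of_int n * c n) - infsum c UNIV"
    unfolding S2[abs_def] by (subst infsum_diff[OF summable_on_cmult_right[OF cs(2)] cs(1)]) (simp only: infsum_cmult_right')
  also have "infsum c UNIV = 0" by (rule infsum_antisymmetric) (rule cr)
  finally have 1: "infsum S UNIV = 2 * (\<Sum>\<^sub>\<infinity>n. of_int n * c n)" by simp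
  have e: "S (3 * k - 2) = S (3 * (1 - k))" for k
    using Sr[of "3 * k - 2"] by (simp add: algebra_simps)
  have "infsum S UNIV = (\<Sum>\<^sub>\<infinity>k. S (3 * k)) + (\<Sum>\<^sub>\<infinity>k. S (3 * k - 1)) + (\<Sum>\<^sub>\<infinity>k. S (3 * k - 2))"
    by (rule infsum_int_mod3[OF Ss])
  also have "(\<Sum>\<^sub>\<infinity>k. S (3 * k - 2)) = (\<Sum>\<^sub>\<infinity>k. S (3 * k))"
    unfolding e by (rule infsum_int_reflect[of "\<lambda>k. S (3 * k)"])
  also have "(\<Sum>\<^sub>\<infinity>k. S (3 * k)) = - (\<Sum>\<^sub>\<infinity>k. bilateral_expr k x)"
    unfolding S0 by (rule infsum_uminus)
  also have "(\<Sum>\<^sub>\<infinity>k. S (3 * k - 1)) = q powi (-2) * zsum x"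
    unfolding S1 zsum_def by (rule infsum_cmult_right')
  finally show "- (\<Sum>\<^sub>\<infinity>n. of_int n * lambert q (th9 q) n) = (\<Sum>\<^sub>\<infinity>k. bilateral_expr k x) - q powi (-2) / 2 * zsum x"
    unfolding 1 c_def[symmetric] by (simp add: field_simps)
qed

text \<open>The class n = 3k - j of the sum of q^n / (1 + q^(6n+3)), freed from q^(-j) and written
  in x = q^3.\<close>

definition usum :: "int \<Rightarrow> complex \<Rightarrow> complex" where
  "usum j x = (\<Sum>\<^sub>\<infinity>k. x powi k / (1 + x powi (6 * k + 1 - 2 * j)))"

lemma kronecker_sum_mod3:
  assumes "norm q < 1" "q \<noteq> 0" "q ^ 3 = x"
  shows "kronecker_sum q (- (q ^ 3)) (q ^ 6) = usum 0 x + q powi (-1) * usum 1 x + q powi (-2) * usum 2 x"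
proof -
  define f where "f n = q powi n / (1 - - (q ^ 3) * (q ^ 6) powi n)" for n
  have "int 6 * n + int 3 \<noteq> 0" for n :: int by presburger
  note ne = minus_power_powi_neq_1[OF assms(1,2) this]
  have "f summable_on UNIV"
    unfolding f_def
    by (rule abs_summable_summable, rule kronecker_abs_summable[OF norm_power_less_1[OF assms(1)] _ _ ne])
      (use assms norm_power_strict_decreasing[OF assms(1,2), of 1 6] in auto)
  note s = infsum_int_mod3[OF this]
  have fe: "f (3 * k - j) = q powi (- j) * (x powi k / (1 + x powi (6 * k + 1 - 2 * j)))" for k j
  proof -
    have "q ^ 3 * (q ^ 6) powi (3 * k - j) = q powi (3 * (6 * k + 1 - 2 * j))"
      using assms(2) power_int_add[of q 3 "6 * (3 * k - j)"] by (simp add: power_powi[of q 6, simplified] algebra_simps)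
    then have "q ^ 3 * (q ^ 6) powi (3 * k - j) = x powi (6 * k + 1 - 2 * j)"
      unfolding cube_powi[OF assms(3)] .
    moreover have "q powi (3 * k - j) = q powi (- j) * x powi k"
      using assms(2) by (simp add: power_int_diff power_int_minus divide_inverse cube_powi[OF assms(3)])
    ultimately show ?thesis by (simp add: f_def)
  qed
  have "kronecker_sum q (- (q ^ 3)) (q ^ 6) = infsum f UNIV"
    by (simp add: kronecker_sum_def f_def[abs_def])
  also have "\<dots> = usum 0 x + q powi (-1) * usum 1 x + q powi (-2) * usum 2 x"
  proof -
    have "(\<Sum>\<^sub>\<infinity>k. f (3 * k)) = usum 0 x" using fe[of _ 0] by (simp add: usum_def)
    moreover have "(\<Sum>\<^sub>\<infinity>k. f (3 * k - 1)) = q powi (-1) * usum 1 x" "(\<Sum>\<^sub>\<infinity>k. f (3 * k - 2)) = q powi (-2) * usum 2 x"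
      unfolding fe usum_def by (rule infsum_cmult_right')+
    ultimately show ?thesis unfolding s by simp
  qed
  finally show ?thesis .
qed

text \<open>The exponents 6k - 1 would mean b = -1/x; shifting k by one gives 6k + 5 and b = -x^5,
  and produces the factor x.\<close>

lemma usum_1:
  assumes "x \<noteq> 0"
  shows "usum 1 x = x * kronecker_sum x (- (x ^ 5)) (x ^ 6)"
proof -
  have "usum 1 x = (\<Sum>\<^sub>\<infinity>k. x powi (k + 1) / (1 + x powi (6 * (k + 1) + 1 - 2 * 1)))"
    unfolding usum_def by (rule infsum_int_shift[symmetric])
  also have "\<dots> = (\<Sum>\<^sub>\<infinity>k. x * (x powi k / (1 - - (x ^ 5) * (x ^ 6) powi k)))"
  proof (rule infsum_cong)
    fix k
    have "x powi (6 * (k + 1) + 1 - 2 * 1) = x ^ 5 * (x ^ 6) powi k"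
      using assms power_int_add[of x 5 "6 * k"] by (simp add: power_powi[of x 6, simplified] algebra_simps)
    then show "x powi (k + 1) / (1 + x powi (6 * (k + 1) + 1 - 2 * 1)) = x * (x powi k / (1 - - (x ^ 5) * (x ^ 6) powi k))"
      using assms by (simp add: power_int_add)
  qed
  finally show ?thesis by (simp only: infsum_cmult_right' kronecker_sum_def)
qed

text \<open>The right side is sorted by the power of q beside functions of x: exponent 0 first, then
  1 and -2, then -1, one group for each residue modulo 3.\<close>

lemma cone_sum_cube:
  assumes "norm q < 1" "q \<noteq> 0" "q ^ 3 = x"
  shows "theta (x ^ 3) (x ^ 6) * cone_sum q = (\<Sum>\<^sub>\<infinity>k. bilateral_expr k x) + J 2 x * phi x * usum 1 x
    + q * (J 2 x * phi x * usum 0 x) + q powi (-2) * (- zsum x / 2) + q powi (-1) * (J 2 x * phi x * usum 2 x)"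
proof -
  have J: "J 6 q = J 2 x" unfolding J_eq_qprod assms(3)[symmetric] by (simp flip: power_mult)
  have q: "q * q powi (-1) = 1" "q * q powi (-2) = q powi (-1)"
    using assms(2) by (simp_all add: power_int_minus power2_eq_square)
  have "theta (x ^ 3) (x ^ 6) * cone_sum q = (\<Sum>\<^sub>\<infinity>k. bilateral_expr k x) - q powi (-2) / 2 * zsum x
      + q * J 2 x * phi x * (usum 0 x + q powi (-1) * usum 1 x + q powi (-2) * usum 2 x)"
    using infsum_th9_mult_cone_sum[OF assms(1,2)]
    unfolding infsum_th9_cube[OF assms(2,3)] infsum_lambert_th9(3)[OF assms] kronecker_sum_mod3[OF assms] J
    by (simp add: assms(3))
  also have "\<dots> = (\<Sum>\<^sub>\<infinity>k. bilateral_expr k x) + (q * q powi (-1)) * (J 2 x * phi x * usum 1 x)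
    + q * (J 2 x * phi x * usum 0 x) + q powi (-2) * (- zsum x / 2) + (q * q powi (-2)) * (J 2 x * phi x * usum 2 x)"
    by (simp add: algebra_simps)
  finally show ?thesis unfolding q by simp
qed

text \<open>All three cube roots u q of x satisfy \<open>cone_sum_cube\<close> with the same
  functions of x. Summing over u multiplies the groups of nonzero residue by 1 + w + w^2 = 0. On the
  left only the indices N = 3n survive, where 4N - 1 = 12n - 1.\<close>

lemma theorem3p10_nonzero:
  assumes "norm x < 1" "x \<noteq> 0"
  shows "summable (\<lambda>n. of_real (F (12 * int n - 1)) * x ^ n)"
    and "(\<lambda>k. bilateral_expr k x) summable_on UNIV"
    and "(J 3 x)^2 / J 6 x * F_12_m1 x = (\<Sum>\<^sub>\<infinity>k. bilateral_expr k x)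
      + 2 * x * J 12 x * J 6 x * (J 2 x)^5 / (J 4 x * (J 1 x)^2)"
proof -
  define q where "q = exp (Ln x / 3)"
  have q: "q ^ 3 = x" "q \<noteq> 0"
    using assms(2) by (simp_all add: q_def flip: exp_of_nat_mult)
  have nq: "norm q < 1"
  proof (rule ccontr)
    assume "\<not> norm q < 1"
    then have "1 \<le> norm q ^ 3" by (intro one_le_power) simp
    then show False using assms(1) q(1) by (metis norm_power not_le)
  qed
  define g where "g N = complex_of_real (F (4 * int N - 1))" for N :: nat
  define w where "w = cis (2 * pi / 3)"
  have w3: "w ^ 3 = 1" unfolding w_def Complex.DeMoivre by simp
  have w1: "w \<noteq> 1"
  proof
    assume "w = 1"
    then have "Re w = 1" by simp
    then show False by (simp add: w_def cos_120)
  qed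
  have wn: "norm w = 1" and w0: "w \<noteq> 0" by (simp_all add: w_def)
  have "(w - 1) * (1 + w + w\<^sup>2) = 0" using w3 by (simp add: algebra_simps power2_eq_square power3_eq_cube)
  then have w2: "1 + w + w\<^sup>2 = 0" using w1 by simp
  have ps: "(\<lambda>N. g N * (u * q) ^ N) summable_on UNIV" "cone_sum (u * q) = (\<Sum>\<^sub>\<infinity>N. g N * (u * q) ^ N)"
    if "norm u = 1" for u
    using cone_sum_power_series[of "u * q"] that nq abs_summable_summable[OF cone_sum_power_series(1), of "u * q"]
    by (simp_all add: g_def norm_mult)
  have wN: "1 + w ^ N + (w\<^sup>2) ^ N = (if 3 dvd N then 3 else 0)" for N
  proof -
    define m r where "m = N div 3" "r = N mod 3"
    have N: "N = 3 * m + r" by (simp add: m_r_def)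
    have wp: "w ^ N = w ^ r" unfolding N by (simp add: power_add power_mult w3)
    have "r = 0 \<or> r = 1 \<or> r = 2" unfolding m_r_def by presburger
    moreover have "3 dvd N \<longleftrightarrow> r = 0" by (simp add: m_r_def dvd_eq_mod_eq_0)
    moreover have "(w\<^sup>2) ^ N = (w ^ r)\<^sup>2" using wp by (metis power_mult mult.commute)
    moreover have "(w\<^sup>2)\<^sup>2 = w" using w3 by (simp add: eval_nat_numeral)
    ultimately show ?thesis using wp w2 by (auto simp: algebra_simps)
  qed
  have "cone_sum (1 * q) + cone_sum (w * q) + cone_sum (w\<^sup>2 * q) =
      (\<Sum>\<^sub>\<infinity>N. g N * (1 * q) ^ N + g N * (w * q) ^ N + g N * (w\<^sup>2 * q) ^ N)"
    using ps(1)[of 1] ps(1)[of w] ps(1)[of "w\<^sup>2"] ps(2)[of 1] ps(2)[of w] ps(2)[of "w\<^sup>2"] wn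
    by (simp only: infsum_add summable_on_add norm_one norm_power power_one)
  also have "\<dots> = (\<Sum>\<^sub>\<infinity>N. if 3 dvd N then 3 * (g N * q ^ N) else 0)"
  proof (rule infsum_cong)
    fix N
    have "g N * (1 * q) ^ N + g N * (w * q) ^ N + g N * (w\<^sup>2 * q) ^ N = g N * q ^ N * (1 + w ^ N + (w\<^sup>2) ^ N)"
      by (simp add: power_mult_distrib algebra_simps)
    then show "g N * (1 * q) ^ N + g N * (w * q) ^ N + g N * (w\<^sup>2 * q) ^ N = (if 3 dvd N then 3 * (g N * q ^ N) else 0)"
      unfolding wN by simp
  qed
  also have "\<dots> = (\<Sum>\<^sub>\<infinity>N\<in>{N. 3 dvd N}. 3 * (g N * q ^ N))"
    by (rule infsum_cong_neutral) auto
  also have "\<dots> = (\<Sum>\<^sub>\<infinity>n. 3 * (g (3 * n) * x ^ n))"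
    by (rule infsum_reindex_bij_witness[of _ "\<lambda>n. 3 * n" "\<lambda>n. n div 3"]) (auto simp: power_mult q(1))
  finally have avg: "cone_sum (1 * q) + cone_sum (w * q) + cone_sum (w\<^sup>2 * q) = 3 * (\<Sum>\<^sub>\<infinity>n. g (3 * n) * x ^ n)"
    by (simp only: infsum_cmult_right')
  have "(\<lambda>N. g N * q ^ N) summable_on {N. 3 dvd N}"
    using ps(1)[of 1] summable_on_subset_banach by force
  also have "?this \<longleftrightarrow> (\<lambda>n. g (3 * n) * x ^ n) summable_on UNIV"
    by (rule summable_on_reindex_bij_witness[of _ "\<lambda>n. 3 * n" "\<lambda>n. n div 3"]) (auto simp: power_mult q(1))
  finally have gs: "(\<lambda>n. g (3 * n) * x ^ n) summable_on UNIV" .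
  have gF: "g (3 * n) = of_real (F (12 * int n - 1))" for n by (simp add: g_def)
  show "summable (\<lambda>n. of_real (F (12 * int n - 1)) * x ^ n)"
    using summable_on_imp_summable[OF gs] by (simp add: gF)
  have G: "(\<Sum>\<^sub>\<infinity>n. g (3 * n) * x ^ n) = F_12_m1 x"
    using has_sum_imp_sums[OF has_sum_infsum[OF gs]] by (simp add: F_12_m1_def gF sums_iff)
  show "(\<lambda>k. bilateral_expr k x) summable_on UNIV"
    by (rule infsum_lambert_th9(2)[OF nq q(2,1)])
  define B where "B = (\<Sum>\<^sub>\<infinity>k. bilateral_expr k x) + J 2 x * phi x * usum 1 x"
  define T where "T = theta (x ^ 3) (x ^ 6)"
  define a b c where "a = J 2 x * phi x * usum 0 x" "b = - zsum x / 2" "c = J 2 x * phi x * usum 2 x"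
  have each: "T * cone_sum (u * q) = B + u * (q * a) + u powi (-2) * (q powi (-2) * b) + u powi (-1) * (q powi (-1) * c)"
    if "norm u = 1" "u ^ 3 = 1" for u
  proof -
    have "u \<noteq> 0" using that by auto
    then show ?thesis
      using cone_sum_cube[of "u * q" x] that nq q
      by (simp add: B_def T_def a_b_c_def norm_mult power_mult_distrib power_int_mult_distrib mult_ac)
  qed
  have wi: "w powi (-1) = w\<^sup>2" "w powi (-2) = w" "(w\<^sup>2) powi (-1) = w" "(w\<^sup>2) powi (-2) = w\<^sup>2"
    using w3 w0 by (simp_all add: power_int_minus field_simps eval_nat_numeral)
  have iw: "inverse w = w\<^sup>2" "inverse (w\<^sup>2) = w"
    using wi(1,3) by (simp_all add: power_int_minus)
  have "T * (cone_sum (1 * q) + cone_sum (w * q) + cone_sum (w\<^sup>2 * q)) =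
      3 * B + (1 + w + w\<^sup>2) * (q * a + q powi (-2) * b + q powi (-1) * c)"
  proof -
    have "(w\<^sup>2) ^ 3 = 1" using w3 by (metis power_mult mult.commute power_one)
    then show ?thesis
      unfolding distrib_left using each[of 1] each[of w] each[of "w\<^sup>2"] wn w3
      by (simp add: wi iw norm_power algebra_simps)
  qed
  then have "3 * (T * F_12_m1 x) = 3 * B" unfolding avg G w2 by simp
  then have TF: "T * F_12_m1 x = B" by simp
  have "T * J 6 x = J 3 x ^ 2" using theta_J_square[OF assms, of 3] by (simp add: T_def)
  then have "T = J 3 x ^ 2 / J 6 x" using J_nonzero[OF assms(1), of 6] by (simp add: field_simps)
  then have "(J 3 x)^2 / J 6 x * F_12_m1 x = (\<Sum>\<^sub>\<infinity>k. bilateral_expr k x) + x * (J 2 x * phi x * kronecker_sum x (- (x ^ 5)) (x ^ 6))"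
    using TF by (simp add: B_def usum_1[OF assms(2)] mult_ac)
  then show "(J 3 x)^2 / J 6 x * F_12_m1 x = (\<Sum>\<^sub>\<infinity>k. bilateral_expr k x)
      + 2 * x * J 12 x * J 6 x * (J 2 x)^5 / (J 4 x * (J 1 x)^2)"
    unfolding kronecker_q5[OF assms] by (simp add: mult_ac)
qed

text \<open>For k >= 1 the exponent 3k^2 is positive. For k <= 0, expanding the fraction by q^(1-6k)
  exposes a factor that tends to 0 while the denominator tends to 1; this covers k = 0, where
  q^(3k^2) is constant.\<close>

lemma bilateral_term_0: "bilateral_term k 0 = 0"
proof -
  have z: "((\<lambda>q::complex. q ^ n) \<longlongrightarrow> 0) (at 0)" if "0 < n" for n
    using tendsto_power[OF tendsto_ident_at[of "0::complex" UNIV], where n = n] that by (simp add: power_0_left)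
  have "(bilateral_expr k \<longlongrightarrow> 0) (at 0)"
  proof (cases "k \<ge> 1")
    case True
    define m where "m = nat (6 * k - 1)"
    define n where "n = nat (3 * k\<^sup>2)"
    have mn: "6 * k - 1 = int m" "3 * k\<^sup>2 = int n" "0 < m" "0 < n" using True by (auto simp: m_def n_def)
    have "((\<lambda>q. (-1) powi (k - 1) * of_int (6 * k - 1) * q ^ n / (1 + q ^ m)) \<longlongrightarrow>
        (-1) powi (k - 1) * of_int (6 * k - 1) * 0 / (1 + 0)) (at (0::complex))"
      by (intro tendsto_intros z mn) simp
    moreover have "bilateral_expr k = (\<lambda>q. (-1) powi (k - 1) * of_int (6 * k - 1) * q ^ n / (1 + q ^ m))"
      unfolding bilateral_expr_def mn(1,2) power_int_of_nat by (rule refl)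
    ultimately show ?thesis by simp
  next
    case False
    define m where "m = nat (1 - 6 * k)"
    define n where "n = nat (3 * k\<^sup>2)"
    have mn: "6 * k - 1 = - int m" "3 * k\<^sup>2 = int n" "0 < m" using False by (auto simp: m_def n_def)
    have "((\<lambda>q. (-1) powi (k - 1) * of_int (6 * k - 1) * (q ^ n * q ^ m) / (q ^ m + 1)) \<longlongrightarrow>
        (-1) powi (k - 1) * of_int (6 * k - 1) * (0 ^ n * 0) / (0 + 1)) (at (0::complex))"
      by (intro tendsto_intros z mn) simp
    then have l: "((\<lambda>q. (-1) powi (k - 1) * of_int (6 * k - 1) * (q ^ n * q ^ m) / (q ^ m + 1)) \<longlongrightarrow> 0) (at (0::complex))"
      by simp
    have "(-1) powi (k - 1) * of_int (6 * k - 1) * (q ^ n * q ^ m) / (q ^ m + 1) = bilateral_expr k q" if "q \<noteq> 0" for q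
    proof -
      have "1 + inverse (q ^ m) = (q ^ m + 1) / q ^ m" using that by (simp add: field_simps)
      then show ?thesis
        unfolding bilateral_expr_def mn(1,2) power_int_of_nat power_int_minus by (simp add: mult_ac)
    qed
    then have "\<forall>\<^sub>F q in at 0. (-1) powi (k - 1) * of_int (6 * k - 1) * (q ^ n * q ^ m) / (q ^ m + 1) = bilateral_expr k q"
      unfolding eventually_at by (intro exI[of _ 1]) auto
    with l show ?thesis by (rule Lim_transform_eventually)
  qed
  then show ?thesis by (simp add: bilateral_term_def tendsto_Lim)
qed

theorem theorem3p10:
  fixes q :: complex
  assumes "norm q < 1"
  shows "summable (\<lambda>n. of_real (F (12 * int n - 1)) * q ^ n)
    \<and> (\<lambda>k. bilateral_term k q) summable_on (UNIV :: int set)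
    \<and> (J 3 q)^2 / J 6 q * F_12_m1 q
        = (\<Sum>\<^sub>\<infinity>k\<in>(UNIV :: int set). bilateral_term k q)
          + 2 * q * J 12 q * J 6 q * (J 2 q)^5 / (J 4 q * (J 1 q)^2)"
proof (cases "q = 0")
  case True
  \<comment> \<open>Only the constant term F(-1) = 0 is left at q = 0.\<close>
  have "F_12_m1 0 = 0"
    unfolding F_12_m1_def by (simp add: F_def)
  then show ?thesis
    by (simp add: True bilateral_term_0)
next
  case False
  then have "(\<lambda>k. bilateral_term k q) = (\<lambda>k. bilateral_expr k q)"
    by (simp add: bilateral_term_def)
  then show ?thesis
    using theorem3p10_nonzero[OF assms False] by simp
qed

end
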